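(* Let $d\in\mathbb N$, $0<p,q,r\le\infty$ and $\psi\in\mathfrak M'_\infty\cup\mathfrak M^c_\infty$. Put $\widetilde n_m=(m/M_{r,d})^{1/d}$, where $M_{r,d}=\frac{(2\Gamma(1+\frac1r))^d}{\Gamma(1+\frac dr)}$. Then (for $m\in\mathbb N$ with $\widetilde n_m\ge1$) $$\mathscr D_m(\mathcal F_{q,r}^\psi)_{\mathcal S^p}\asymp\begin{cases}\psi(\widetilde n_m),&0<q\le p\le\infty,\\ \psi(\widetilde n_m)\big(m\,\alpha(\psi,\widetilde n_m)\big)^{\frac1p-\frac1q},&0<p<q\le\infty,\end{cases}$$ and $$\sigma_m(\mathcal F_{q,r}^\psi)_{\mathcal S^p}\asymp\psi(\widetilde n_m)\big(m\,\alpha(\psi,\widetilde n_m)\big)^{\frac1p-\frac1q},\qquad 0<p,q\le\infty.$$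
   Context: $1/\infty:=0$. $L_1=L_1(\mathbb T^d)$, $\mathbb T^d=[0,2\pi)^d$, is the space of functions integrable on $\mathbb T^d$ and $2\pi$-periodic in each variable; $e_k(x)=e^{i(k,x)}$, $\widehat f(k)=(2\pi)^{-d}\int_{\mathbb T^d}f\,\overline{e_k}\,dx$. For $0<p\le\infty$, $\mathcal S^p$ is the space of $f\in L_1$ with finite $\|f\|_{\mathcal S^p}=\|\{\widehat f(k)\}\|_{\ell_p(\mathbb Z^d)}$. For a positive non-increasing $\psi$ on $[1,\infty)$ and $0<q,r\le\infty$, set $\Psi_0=\psi(1)$, $\Psi_k=\psi(|k|_r)$ for $k\in\mathbb Z^d\setminus\{0\}$, where $|k|_r=\|k\|_{\ell_r^d}$ is the $\ell_r$-(quasi-)norm, and $\mathcal F_{q,r}^\psi=\{f\in L_1:\|\{\widehat f(k)/\Psi_k\}_{k}\|_{\ell_q(\mathbb Z^d)}\le1\}$. $\Gamma_m$ is the set of all collections $\gamma_m$ of $m$ different vectors of $\mathbb Z^d$; $E_{\gamma_m}(f)_{\mathcal S^p}=\inf_{c_k\in\mathbb C}\|f-\sum_{k\in\gamma_m}c_ke_k\|_{\mathcal S^p}$; $\mathscr D_m(\mathfrak N)_{\mathcal S^p}=\inf_{\gamma_m\in\Gamma_m}\sup_{f\in\mathfrak N}E_{\gamma_m}(f)_{\mathcal S^p}$; $\sigma_m(\mathfrak N)_{\mathcal S^p}=\sup_{f\in\mathfrak N}\inf_{\gamma_m\in\Gamma_m}E_{\gamma_m}(f)_{\mathcal S^p}$.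 $\mathfrak M$ is the set of all positive convex functions $\psi(t)$, $t\ge1$, with $\lim_{t\to\infty}\psi(t)=0$; $\psi'(t):=\psi'(t+)$ and $\alpha(\psi,t):=\frac{\psi(t)}{t|\psi'(t)|}$. $\mathfrak M'_\infty$ is the set of $\psi\in\mathfrak M$ such that $\alpha(\psi,t)$ decreases monotonically to $0$ and $\psi(t)/|\psi'(t)|$ increases monotonically to $\infty$ as $t\to\infty$. $\mathfrak M^c_\infty$ is the set of $\psi\in\mathfrak M$ such that $\alpha(\psi,t)$ decreases monotonically to $0$ and $K_4\le\psi(t)/|\psi'(t)|\le K_5$ for all $t\ge1$ with some positive constants $K_4,K_5$. $a(m)\asymp b(m)$ means there are constants $0<K_1<K_2$ independent of $m$ with $K_1b(m)\le a(m)\le K_2b(m)$ for all indicated $m$. *)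

theory Defs
  imports "HOL-Analysis.Analysis"
begin

text \<open>
  Exponents in $(0,\infty]$ are positive elements of \<^typ>\<open>ennreal\<close>. The following is $1/p$
  as a real number, with $1/\infty = 0$.
\<close>

definition recip :: "ennreal \<Rightarrow> real" where
  "recip p = enn2real (1 / p)"

lemma recip_top [simp]: "recip \<infinity> = 0"
  by (simp add: recip_def)

definition lp_norm :: "ennreal \<Rightarrow> ('k \<Rightarrow> complex) \<Rightarrow> ennreal" where
  "lp_norm p a =
     (if p = \<infinity> then (SUP k. ennreal (cmod (a k)))
      else if (\<lambda>k. cmod (a k) powr enn2real p) summable_on UNIV
      then ennreal ((\<Sum>\<^sub>\<infinity>k. cmod (a k) powr enn2real p) powr recip p)
      else \<infinity>)"

text \<open>The index type \<^typ>\<open>'d\<close> plays the role of $\{1,\dots,d\}$, with $d$ = \<^term>\<open>CARD('d)\<close>.\<close>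

definition vec_norm :: "ennreal \<Rightarrow> int ^ 'd \<Rightarrow> real" where
  "vec_norm r k =
     (if r = \<infinity> then Max (range (\<lambda>j. \<bar>real_of_int (k $ j)\<bar>))
      else (\<Sum>j\<in>UNIV. \<bar>real_of_int (k $ j)\<bar> powr enn2real r) powr recip r)"

definition torus :: "(real ^ 'd) set" where
  "torus = {x. \<forall>j. 0 \<le> x $ j \<and> x $ j < 2 * pi}"

text \<open>Functions rather than classes modulo null sets; everything below depends on a function
  only through its Fourier coefficients.\<close>

definition L1 :: "(real ^ 'd \<Rightarrow> complex) set" where
  "L1 = {f. set_integrable lebesgue torus f \<and> (\<forall>x j. f (x + axis j (2 * pi)) = f x)}"

definition expo :: "int ^ 'd \<Rightarrow> real ^ 'd \<Rightarrow> complex" where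
  "expo k x = exp (\<i> * of_real (\<Sum>j\<in>UNIV. of_int (k $ j) * x $ j))"

definition fourier :: "(real ^ 'd \<Rightarrow> complex) \<Rightarrow> int ^ 'd \<Rightarrow> complex" where
  "fourier f k =
     (LINT x:torus|lebesgue. f x * cnj (expo k x)) / of_real ((2 * pi) ^ CARD('d))"

text \<open>The value is \<^term>\<open>\<infinity>\<close> when \<^term>\<open>f\<close> lies outside $\mathcal S^p$.\<close>

definition S_norm :: "ennreal \<Rightarrow> (real ^ 'd \<Rightarrow> complex) \<Rightarrow> ennreal" where
  "S_norm p f = lp_norm p (fourier f)"

definition Psi :: "(real \<Rightarrow> real) \<Rightarrow> ennreal \<Rightarrow> int ^ 'd \<Rightarrow> real" where
  "Psi \<psi> r k = (if k = 0 then \<psi> 1 else \<psi> (vec_norm r k))"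

definition F_class :: "ennreal \<Rightarrow> ennreal \<Rightarrow> (real \<Rightarrow> real) \<Rightarrow> (real ^ 'd \<Rightarrow> complex) set" where
  "F_class q r \<psi> = {f \<in> L1. lp_norm q (\<lambda>k. fourier f k / of_real (Psi \<psi> r k)) \<le> 1}"

definition Gamma_sets :: "nat \<Rightarrow> (int ^ 'd) set set" where
  "Gamma_sets m = {\<gamma>. finite \<gamma> \<and> card \<gamma> = m}"

definition best_approx ::
    "ennreal \<Rightarrow> (int ^ 'd) set \<Rightarrow> (real ^ 'd \<Rightarrow> complex) \<Rightarrow> ennreal" where
  "best_approx p \<gamma> f =
     (INF c::int ^ 'd \<Rightarrow> complex. S_norm p (\<lambda>x. f x - (\<Sum>k\<in>\<gamma>. c k * expo k x)))"

definition basis_width :: "ennreal \<Rightarrow> nat \<Rightarrow> (real ^ 'd \<Rightarrow> complex) set \<Rightarrow> ennreal" where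
  "basis_width p m N = (INF \<gamma>\<in>Gamma_sets m. SUP f\<in>N. best_approx p \<gamma> f)"

definition best_m_term :: "ennreal \<Rightarrow> nat \<Rightarrow> (real ^ 'd \<Rightarrow> complex) set \<Rightarrow> ennreal" where
  "best_m_term p m N = (SUP f\<in>N. INF \<gamma>\<in>Gamma_sets m. best_approx p \<gamma> f)"

text \<open>
  The right derivative of a convex function on $[1,\infty)$ exists at every point as an extended
  real; it is finite except possibly at $1$, where it may be $-\infty$. In that case the two
  quotients below are $0$ at $1$, because $x/\infty = 0$ in \<^typ>\<open>ereal\<close>.
\<close>

definition right_deriv :: "(real \<Rightarrow> real) \<Rightarrow> real \<Rightarrow> ereal" where
  "right_deriv \<psi> t = Lim (at_right t) (\<lambda>s. ereal ((\<psi> s - \<psi> t) / (s - t)))"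

lemma right_deriv_eqI:
  assumes "(\<psi> has_real_derivative D) (at_right t)"
  shows "right_deriv \<psi> t = ereal D"
  unfolding right_deriv_def
  using assms by (intro tendsto_Lim) (auto simp: has_field_derivative_iff)

definition quot :: "(real \<Rightarrow> real) \<Rightarrow> real \<Rightarrow> real" where
  "quot \<psi> t = real_of_ereal (ereal (\<psi> t) / \<bar>right_deriv \<psi> t\<bar>)"

definition alpha :: "(real \<Rightarrow> real) \<Rightarrow> real \<Rightarrow> real" where
  "alpha \<psi> t = real_of_ereal (ereal (\<psi> t) / (ereal t * \<bar>right_deriv \<psi> t\<bar>))"

lemma alpha_quot_eq:
  assumes "(\<psi> has_real_derivative D) (at_right t)" "D \<noteq> 0" "t \<noteq> 0"
  shows "quot \<psi> t = \<psi> t / \<bar>D\<bar>" "alpha \<psi> t = \<psi> t / (t * \<bar>D\<bar>)"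
  using assms(2,3) by (simp_all add: quot_def alpha_def right_deriv_eqI[OF assms(1)])

definition class_M :: "(real \<Rightarrow> real) set" where
  "class_M = {\<psi>. (\<forall>t\<ge>1. 0 < \<psi> t) \<and> convex_on {1..} \<psi> \<and> (\<psi> \<longlongrightarrow> 0) at_top}"

definition class_M_inf' :: "(real \<Rightarrow> real) set" where
  "class_M_inf' = {\<psi> \<in> class_M.
     antimono_on {1..} (alpha \<psi>) \<and> (alpha \<psi> \<longlongrightarrow> 0) at_top \<and>
     mono_on {1..} (quot \<psi>) \<and> filterlim (quot \<psi>) at_top at_top}"

definition class_M_inf_c :: "(real \<Rightarrow> real) set" where
  "class_M_inf_c = {\<psi> \<in> class_M.
     antimono_on {1..} (alpha \<psi>) \<and> (alpha \<psi> \<longlongrightarrow> 0) at_top \<and>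
     (\<exists>K4 K5. 0 < K4 \<and> 0 < K5 \<and> (\<forall>t\<ge>1. K4 \<le> quot \<psi> t \<and> quot \<psi> t \<le> K5))}"

text \<open>$M_{r,d}$ is the volume of the unit ball of $\ell_r^d$.\<close>

definition M_const :: "ennreal \<Rightarrow> nat \<Rightarrow> real" where
  "M_const r d = (2 * Gamma (1 + recip r)) ^ d / Gamma (1 + real d * recip r)"

definition n_tilde :: "ennreal \<Rightarrow> nat \<Rightarrow> nat \<Rightarrow> real" where
  "n_tilde r d m = (real m / M_const r d) powr (1 / real d)"

definition asymp_eq_on :: "nat set \<Rightarrow> (nat \<Rightarrow> ennreal) \<Rightarrow> (nat \<Rightarrow> real) \<Rightarrow> bool" where
  "asymp_eq_on A a b \<longleftrightarrow>
     (\<exists>K1 K2. 0 < K1 \<and> K1 < K2 \<and>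
        (\<forall>m\<in>A. ennreal (K1 * b m) \<le> a m \<and> a m \<le> ennreal (K2 * b m)))"

end

theory Submission
  imports Defs
begin

text \<open>
  Subtracting a trigonometric polynomial with frequencies in \<open>\<gamma>\<close> changes exactly the Fourier coefficients
  on \<open>\<gamma>\<close>, so everything reduces to weighted sequences on the lattice. Lattice points in the \<open>\<ell>\<^sub>r\<close>-ball
  of radius \<open>t\<close> number \<open>M t\<^sup>d + O(t\<^bsup>d-1\<^esup>)\<close>; hence, up to a shift of the radius by \<open>O(1)\<close>, the \<open>m\<close> largest
  weights live on the ball of radius \<open>n\<close> with \<open>m = M n\<^sup>d\<close>. Write \<open>Q = \<psi> / \<bar>\<psi>'\<bar>\<close>, which is bounded below
  in both classes. Over a distance \<open>O(Q(n))\<close> from \<open>n\<close> the function \<open>\<psi>\<close> changes by a bounded factor, and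
  the shell of that width contains about \<open>N = n\<^bsup>d-1\<^esup> Q(n)\<close> points, which is \<open>m alpha(n)\<close> up to a
  constant. Since \<open>\<psi>\<close> decays faster than every power, the sums of \<open>\<Psi>\<^bsup>s\<^esup>\<close> outside the ball and of
  \<open>\<Psi>\<^bsup>-q\<^esup>\<close> inside it are dominated by this shell. The upper bounds follow by approximating on the
  ball (with Hoelder's inequality if \<open>p < q\<close>), and for the \<open>m\<close>-term approximation with \<open>q \<le> p\<close> by saving
  a fraction of \<open>N\<close> frequencies for the largest remaining coefficients; the lower bounds come from
  polynomials with equal coefficients on a ball with at least \<open>m + M N\<close> points.
\<close>

section \<open>Fourier coefficients of trigonometric polynomials\<close>

text \<open>The number \<open>N\<close> has two opposite roles. To stay in the class, a flat
  polynomial on a ball with \<open>m + M N\<close> points has coefficients of order \<psi>(n)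
  N^(-1/q); the \<open>M N\<close> of them that survive have an l_p norm of order \<psi>(n) N^(1/p -
  1/q). For the width the function may be chosen after the frequencies, so a single exponential
  already gives \<psi>(n); this separates the two quantities when q < p. The obstacle is the
  boundary error in the count of lattice points. It is converted into a bounded shift of the radius,
  which costs a constant factor because \<open>Q\<close> is bounded below. The derivative is never
  integrated: the tangent at \<open>u + 1\<close>, evaluated at \<open>u\<close>, gives a discrete
  inequality, and the sums are built up from shells of width one. Since the constants have to be
  uniform in all \<open>n \<ge> 1\<close>, small radii are clipped to 1 or treated apart. The
  constant \<open>K\<close> lets an increasing \<open>Q\<close> and a \<open>Q\<close> between two
  positive constants be handled alike.\<close>

lemma expo_add: "expo (k + l) x = expo k x * expo l x"
  by (simp add: expo_def sum.distrib distrib_right distrib_left exp_add)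

lemma cnj_expo: "cnj (expo k x) = expo (- k) x"
  by (simp add: expo_def exp_cnj sum_negf)

lemma norm_expo [simp]: "norm (expo k x) = 1"
  by (simp add: expo_def norm_exp_eq_Re)

lemma expo_measurable [measurable]:
  "expo (k :: int ^ 'd) \<in> borel_measurable borel"
  unfolding expo_def
  by (intro borel_measurable_continuous_onI continuous_intros)

lemma expo_periodic: "expo k (x + axis j (2 * pi)) = expo k x"
proof -
  have "(\<Sum>i\<in>UNIV. of_int (k $ i) * (x + axis j (2 * pi)) $ i)
     = (\<Sum>i\<in>UNIV. of_int (k $ i) * x $ i) + (\<Sum>i\<in>UNIV. if i = j then of_int (k $ i) * (2 * pi) else 0)"
    unfolding sum.distrib[symmetric] by (intro sum.cong) (auto simp: axis_def distrib_left)
  also have "\<dots> = (\<Sum>i\<in>UNIV. of_int (k $ i) * x $ i) + of_int (k $ j) * (2 * pi)"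
    by (simp add: sum.delta)
  finally have *: "(\<Sum>i\<in>UNIV. of_int (k $ i) * (x + axis j (2 * pi)) $ i)
     = (\<Sum>i\<in>UNIV. of_int (k $ i) * x $ i) + of_int (k $ j) * (2 * pi)" .
  have "exp (\<i> * (of_int (k $ j) * (of_real pi * 2))) = 1"
    using exp_integer_2pi[of "of_int (k $ j)"] by (simp add: mult_ac)
  then show ?thesis
    unfolding expo_def * by (simp add: distrib_left exp_add mult_ac)
qed

lemma torus_sets [measurable]: "(torus :: (real ^ 'd) set) \<in> sets borel"
proof -
  have "(torus :: (real ^ 'd) set) = {x. \<forall>j. 0 \<le> x $ j \<and> x $ j < 2 * pi}"
    by (simp add: torus_def)
  also have "\<dots> \<in> sets borel"
    by measurable
  finally show ?thesis .
qed

lemma emeasure_torus_finite: "emeasure lborel (torus :: (real ^ 'd) set) < \<infinity>"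
proof -
  have "(torus :: (real ^ 'd) set) \<subseteq> cbox 0 (\<chi> j. 2 * pi)"
    by (auto simp: torus_def mem_box_cart less_imp_le)
  then have "bounded (torus :: (real ^ 'd) set)"
    using bounded_cbox bounded_subset by blast
  then show ?thesis
    by (rule emeasure_bounded_finite)
qed

lemma integral_exp_period:
  fixes a :: int
  shows "(LINT x|lborel. indicator {0..<2 * pi} x *\<^sub>R exp (\<i> * of_real (of_int a * x)))
      = (if a = 0 then of_real (2 * pi) else 0)"
proof -
  have "(LINT x|lborel. indicator {0..<2 * pi} x *\<^sub>R exp (\<i> * of_real (of_int a * x)))
      = (LINT x|lborel. indicator {0..2 * pi} x *\<^sub>R exp (\<i> * of_real (of_int a * x)))"
    by (intro integral_cong_AE, simp, simp)
       (use AE_lborel_singleton[of "2 * pi"] in eventually_elim, auto simp: indicator_def)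
  also have "\<dots> = (if a = 0 then of_real (2 * pi) else 0)"
  proof (cases "a = 0")
    case True
    then show ?thesis by (simp add: scaleR_conv_of_real)
  next
    case False
    define G where "G x = exp (\<i> * of_real (of_int a * x)) / (\<i> * of_int a)" for x :: real
    have "(LINT x|lborel. indicator {0..2 * pi} x *\<^sub>R exp (\<i> * of_real (of_int a * x)))
        = G (2 * pi) - G 0"
    proof (rule integral_FTC_atLeastAtMost)
      show "(G has_vector_derivative exp (\<i> * of_real (of_int a * x))) (at x within {0..2 * pi})" for x
      proof -
        have "((\<lambda>z. exp (\<i> * (of_int a * z)) / (\<i> * of_int a)) has_field_derivative
            exp (\<i> * (of_int a * of_real x))) (at (of_real x))"
          by (rule derivative_eq_intros refl | use False in \<open>simp; fail\<close>)+
            (use False in \<open>simp add: field_simps\<close>)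
        from has_vector_derivative_real_field[OF this] show ?thesis
          unfolding G_def by simp
      qed
      show "continuous_on {0..2 * pi} (\<lambda>x. exp (\<i> * of_real (of_int a * x)))"
        by (intro continuous_intros)
    qed simp
    also have "G (2 * pi) = G 0"
      using exp_integer_2pi[of "of_int a"] by (simp add: G_def mult_ac)
    finally show ?thesis using False by simp
  qed
  finally show ?thesis .
qed

text \<open>The torus and the exponential both factor over the coordinates, so Lebesgue measure is
  written as a product measure and the integral becomes a product of one-dimensional ones.\<close>

lemma integral_expo_torus:
  fixes k :: "int ^ 'd"
  shows "(LINT x|lborel. indicator torus x *\<^sub>R expo k x)
    = (if k = 0 then of_real ((2 * pi) ^ CARD('d)) else 0)"
proof -
  \<comment> \<open>The factors are indexed by basis vectors, as in \<open>lborel_eq\<close>;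
    \<open>axis_index\<close> recovers the coordinate.\<close>
  define g where "g b t = indicator {0..<2 * pi} t *\<^sub>R
      exp (\<i> * of_real (of_int (k $ axis_index b) * t))" for b :: "real ^ 'd" and t :: real
  have g_meas [measurable]: "g b \<in> borel_measurable borel" for b
    unfolding g_def by measurable
  interpret product_sigma_finite "\<lambda>_ :: real ^ 'd. lborel :: real measure" ..
  have g_int: "integrable lborel (g b)" for b
    unfolding g_def
    by (rule integrableI_bounded_set_indicator[where B = 1]) (auto simp: norm_exp_eq_Re)
  have Basis_eq: "(Basis :: (real ^ 'd) set) = (\<lambda>j. axis j 1) ` UNIV"
    by (auto simp: Basis_vec_def)
  have inj: "inj (\<lambda>j :: 'd. axis j (1 :: real))"
    by (auto simp: inj_on_def axis_eq_axis)
  have idx: "axis_index (axis j 1 :: real ^ 'd) = j" for j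
    by (metis axis_index axis_in_Basis_iff Basis_real_def axis_eq_axis insertI1 one_neq_zero)
  have ind: "(indicator torus x :: real) = (\<Prod>j\<in>UNIV. indicator {0..<2 * pi} (x $ j))" for x :: "real ^ 'd"
    by (auto simp: torus_def indicator_def prod_eq_1_iff)
  have prodg: "indicator torus x *\<^sub>R expo k x = (\<Prod>b\<in>Basis. g b (x \<bullet> b))" for x :: "real ^ 'd"
  proof -
    have "(\<Prod>b\<in>Basis. g b (x \<bullet> b)) = (\<Prod>j\<in>UNIV. g (axis j 1) (x $ j))"
      unfolding Basis_eq by (subst prod.reindex[OF inj]) (simp add: inner_axis)
    also have "\<dots> = indicator torus x *\<^sub>R expo k x"
      by (simp add: g_def idx expo_def exp_sum sum_distrib_left ind prod.distrib scaleR_conv_of_real)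
    finally show ?thesis by simp
  qed
  have "(LINT x|lborel. indicator torus x *\<^sub>R expo k x)
      = (LINT x|distr (\<Pi>\<^sub>M b\<in>Basis. lborel) borel (\<lambda>f. \<Sum>b\<in>Basis. f b *\<^sub>R b). (\<Prod>b\<in>Basis. g b (x \<bullet> b)))"
    by (simp add: prodg lborel_eq[symmetric])
  also have "\<dots> = (LINT f|(\<Pi>\<^sub>M b\<in>Basis. lborel). (\<Prod>b\<in>Basis. g b ((\<Sum>b'\<in>Basis. f b' *\<^sub>R b') \<bullet> b)))"
    by (rule integral_distr) measurable
  also have "\<dots> = (LINT f|(\<Pi>\<^sub>M b\<in>Basis. lborel). (\<Prod>b\<in>Basis. g b (f b)))"
    by (intro Bochner_Integration.integral_cong refl prod.cong) (simp add: inner_sum_left_Basis)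
  also have "\<dots> = (\<Prod>b\<in>Basis. integral\<^sup>L lborel (g b))"
    by (rule product_integral_prod) (auto simp: g_int)
  also have "\<dots> = (\<Prod>j\<in>UNIV. integral\<^sup>L lborel (g (axis j 1 :: real ^ 'd)))"
    unfolding Basis_eq by (subst prod.reindex[OF inj]) simp
  also have "\<dots> = (\<Prod>j\<in>UNIV. if k $ j = 0 then of_real (2 * pi) else 0)"
    unfolding g_def idx by (simp only: integral_exp_period)
  also have "\<dots> = (if k = 0 then of_real ((2 * pi) ^ CARD('d)) else 0)"
    by (auto simp: vec_eq_iff)
  finally show ?thesis .
qed

lemma set_integrable_mult_expo:
  fixes f :: "real ^ 'd \<Rightarrow> complex"
  assumes "set_integrable lebesgue torus f"
  shows "set_integrable lebesgue torus (\<lambda>x. f x * expo k x)"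
proof -
  have e: "expo k \<in> borel_measurable lebesgue"
    using expo_measurable[of k] by (auto intro: measurable_completion)
  have f: "integrable lebesgue (\<lambda>x. indicator torus x *\<^sub>R f x)"
    using assms by (simp add: set_integrable_def)
  have "(\<lambda>x. (indicator torus x *\<^sub>R f x) * expo k x) \<in> borel_measurable lebesgue"
    by (rule borel_measurable_times[OF borel_measurable_integrable[OF f] e])
  then have "integrable lebesgue (\<lambda>x. (indicator torus x *\<^sub>R f x) * expo k x)"
    by (rule Bochner_Integration.integrable_bound[OF f]) (simp add: norm_mult)
  then show ?thesis
    by (simp add: set_integrable_def)
qed

lemma set_integrable_expo: "set_integrable lebesgue torus (expo (k :: int ^ 'd))"
proof -
  have "integrable lborel (\<lambda>x. indicator torus x *\<^sub>R expo k x)"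
    by (rule integrableI_bounded_set_indicator[where B = 1])
       (use emeasure_torus_finite in auto)
  then show ?thesis
    unfolding set_integrable_def by (subst integrable_completion) auto
qed

lemma expo_L1: "expo k \<in> L1"
  by (simp add: L1_def set_integrable_expo expo_periodic)

lemma L1_add: "f \<in> L1 \<Longrightarrow> g \<in> L1 \<Longrightarrow> (\<lambda>x. f x + g x) \<in> L1"
  by (auto simp: L1_def)

lemma L1_cmult: "f \<in> L1 \<Longrightarrow> (\<lambda>x. c * f x) \<in> L1"
  by (auto simp: L1_def)

lemma L1_trig_poly: "(\<lambda>x. \<Sum>k\<in>A. c k * expo k x) \<in> L1"
proof (induction A rule: infinite_finite_induct)
  case (insert k A)
  then show ?case by (simp add: L1_add L1_cmult expo_L1)
qed (auto simp: L1_def set_integrable_def)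

lemma fourier_diff:
  fixes f g :: "real ^ 'd \<Rightarrow> complex"
  assumes "f \<in> L1" "g \<in> L1"
  shows "fourier (\<lambda>x. f x - g x) k = fourier f k - fourier g k"
proof -
  have *: "set_integrable lebesgue torus (\<lambda>x. h x * cnj (expo k x))" if "h \<in> L1" for h :: "real ^ 'd \<Rightarrow> complex"
    using that by (simp add: cnj_expo L1_def set_integrable_mult_expo)
  show ?thesis
    using *[OF assms(1)] *[OF assms(2)]
    by (simp add: fourier_def left_diff_distrib set_integral_diff diff_divide_distrib)
qed

lemma fourier_add:
  assumes "f \<in> L1" "g \<in> L1"
  shows "fourier (\<lambda>x. f x + g x) k = fourier f k + fourier g k"
  using fourier_diff[OF L1_add[OF assms] assms(2), of k] by simp

lemma fourier_cmult: "fourier (\<lambda>x. c * f x) k = c * fourier f k"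
proof -
  have "(LINT x:torus|lebesgue. c * f x * cnj (expo k x))
      = c * (LINT x:torus|lebesgue. f x * cnj (expo k x))"
    unfolding set_lebesgue_integral_def
    by (subst integral_mult_right_zero[symmetric]) (simp add: mult_ac)
  then show ?thesis by (simp add: fourier_def)
qed

lemma fourier_expo: "fourier (expo l) k = (if k = l then 1 else 0)"
proof -
  have "(LINT x:torus|lebesgue. expo l x * cnj (expo k x))
      = (LINT x|lebesgue. indicator torus x *\<^sub>R expo (l - k) x)"
    using expo_add[of l "- k"] by (simp add: set_lebesgue_integral_def cnj_expo)
  also have "\<dots> = (LINT x|lborel. indicator torus x *\<^sub>R expo (l - k) x)"
    by (rule integral_completion) measurable
  finally show ?thesis
    by (auto simp: fourier_def integral_expo_torus)
qed

lemma fourier_trig_poly: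
  assumes "finite A"
  shows "fourier (\<lambda>x. \<Sum>l\<in>A. c l * expo l x) k = (if k \<in> A then c k else 0)"
  using assms
proof (induction A)
  case empty
  then show ?case by (simp add: fourier_def)
next
  case (insert l A)
  then show ?case
    by (auto simp: fourier_add L1_cmult expo_L1 L1_trig_poly fourier_cmult fourier_expo)
qed

section \<open>Approximation in weighted sequence spaces\<close>

lemma recip_pos_finite:
  assumes "0 < p" "p \<noteq> \<infinity>"
  shows "0 < enn2real p" "recip p = 1 / enn2real p"
proof -
  show "0 < enn2real p"
    using assms by (simp add: enn2real_positive_iff less_top)
  then show "recip p = 1 / enn2real p"
    using assms unfolding recip_def
    by (metis divide_ennreal enn2real_ennreal enn2real_nonneg ennreal_1 ennreal_enn2real_if
        infinity_ennreal_def le_numeral_extra(4) less_eq_real_def zero_le_divide_1_iff zero_le_one)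
qed

declare recip_top [unfolded infinity_ennreal_def, simp]

lemma recip_nonneg: "0 \<le> recip p"
  by (simp add: recip_def)

lemma recip_antimono:
  assumes "0 < q" "q \<le> p"
  shows "recip p \<le> recip q"
proof (cases "p = \<infinity>")
  case True
  then show ?thesis by (simp add: recip_nonneg)
next
  case False
  then have "q \<noteq> \<infinity>" using assms by (auto simp: top_unique)
  moreover have "enn2real q \<le> enn2real p"
    using assms False by (intro enn2real_mono) (auto simp: less_top)
  ultimately show ?thesis
    using assms False recip_pos_finite[of p] recip_pos_finite[of q]
    by (auto intro!: divide_left_mono)
qed

lemma recip_strict_antimono:
  assumes "0 < p" "p < q"
  shows "recip q < recip p"
proof (cases "q = \<infinity>")
  case True
  then show ?thesis using assms recip_pos_finite[of p] by auto
next
  case False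
  have "p \<noteq> \<infinity>" using assms by auto
  moreover have "enn2real p < enn2real q"
    using assms False by (simp add: enn2real_less_iff less_top)
  ultimately show ?thesis
    using assms False recip_pos_finite[of p] recip_pos_finite[of q]
    by (auto intro!: divide_strict_left_mono)
qed

lemma lp_norm_infinity_le_iff:
  assumes "0 \<le> B"
  shows "lp_norm \<infinity> a \<le> ennreal B \<longleftrightarrow> (\<forall>k. cmod (a k) \<le> B)"
  using assms by (simp add: lp_norm_def SUP_le_iff)

text \<open>Reduces every upper bound on a norm with finite exponent to finite sums, so that
  summability is settled here once.\<close>

lemma lp_norm_finite_le_iff:
  assumes "0 < p" "p \<noteq> \<infinity>" "0 \<le> B"
  shows "lp_norm p a \<le> ennreal B \<longleftrightarrow>
    (\<forall>F. finite F \<longrightarrow> (\<Sum>k\<in>F. cmod (a k) powr enn2real p) \<le> B powr enn2real p)"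
    (is "?L \<longleftrightarrow> ?R")
proof
  have p: "0 < enn2real p" "recip p = 1 / enn2real p"
    using recip_pos_finite assms by auto
  let ?g = "\<lambda>k. cmod (a k) powr enn2real p"
  have nn: "0 \<le> infsum ?g UNIV" by (simp add: infsum_nonneg)
  {
    assume ?L
    then have sm: "?g summable_on UNIV" and le: "ennreal (infsum ?g UNIV powr recip p) \<le> ennreal B"
      using assms by (auto simp: lp_norm_def top_unique split: if_splits)
    have "(infsum ?g UNIV powr recip p) powr enn2real p \<le> B powr enn2real p"
      using le assms p by (intro powr_mono2) auto
    then have "infsum ?g UNIV \<le> B powr enn2real p"
      using p nn by (simp add: powr_powr)
    moreover have "sum ?g F \<le> infsum ?g UNIV" if "finite F" for F
      using that sm by (intro finite_sum_le_infsum) auto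
    ultimately show ?R by fastforce
  next
    assume R: ?R
    have sm: "?g summable_on UNIV"
      by (rule nonneg_bounded_partial_sums_imp_summable_on[where C = "B powr enn2real p"])
         (use R in \<open>auto intro!: eventually_finite_subsets_at_top_weakI\<close>)
    have "infsum ?g UNIV \<le> B powr enn2real p"
      using sm R by (intro infsum_le_finite_sums) auto
    then have "infsum ?g UNIV powr recip p \<le> (B powr enn2real p) powr recip p"
      using nn by (intro powr_mono2) (auto simp: recip_nonneg)
    also have "\<dots> = B" using p assms by (simp add: powr_powr)
    finally show ?L
      using sm assms by (simp add: lp_norm_def ennreal_leI)
  }
qed

lemma lp_norm_mono:
  assumes "\<And>k. cmod (a k) \<le> cmod (b k)"
  shows "lp_norm p a \<le> lp_norm p b"
proof (cases "p = \<infinity>")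
  case True
  then show ?thesis
    using assms by (auto simp: lp_norm_def intro!: SUP_mono ennreal_leI)
next
  case False
  let ?g = "\<lambda>a k. cmod (a k) powr enn2real p"
  have le: "?g a k \<le> ?g b k" for k
    using assms by (intro powr_mono2) auto
  show ?thesis
  proof (cases "?g b summable_on UNIV")
    case True
    then have sa: "?g a summable_on UNIV"
      by (rule summable_on_comparison_test) (use le in auto)
    have "infsum (?g a) UNIV powr recip p \<le> infsum (?g b) UNIV powr recip p"
      using infsum_mono[OF sa True le] by (intro powr_mono2 infsum_nonneg) (auto simp: recip_nonneg)
    then show ?thesis
      using False True sa by (simp add: lp_norm_def ennreal_leI)
  qed (use False in \<open>simp add: lp_norm_def\<close>)
qed

text \<open>The choice \<open>c = fourier f\<close> annihilates the coefficients on \<gamma>, and no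
  choice affects the others, so the infimum is attained.\<close>

lemma best_approx_eq:
  assumes "f \<in> L1" "finite \<gamma>"
  shows "best_approx p \<gamma> f = lp_norm p (\<lambda>k. if k \<in> \<gamma> then 0 else fourier f k)"
proof -
  have F: "fourier (\<lambda>x. f x - (\<Sum>k\<in>\<gamma>. c k * expo k x)) =
      (\<lambda>k. fourier f k - (if k \<in> \<gamma> then c k else 0))" for c
    using assms by (simp add: fun_eq_iff fourier_diff L1_trig_poly fourier_trig_poly)
  show ?thesis
    unfolding best_approx_def S_norm_def F
  proof (rule antisym)
    show "(INF c. lp_norm p (\<lambda>k. fourier f k - (if k \<in> \<gamma> then c k else 0)))
        \<le> lp_norm p (\<lambda>k. if k \<in> \<gamma> then 0 else fourier f k)"
      by (rule INF_lower2[where i = "fourier f"]) (auto intro!: lp_norm_mono)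
  qed (auto intro!: INF_greatest lp_norm_mono)
qed

lemma weighted_lq_bound:
  assumes "0 < q" "q \<noteq> \<infinity>" "\<And>k. 0 < w k"
    and "lp_norm q (\<lambda>k. a k / of_real (w k)) \<le> 1" "finite F"
  shows "(\<Sum>k\<in>F. (cmod (a k) / w k) powr enn2real q) \<le> 1"
proof -
  have "cmod (a k / of_real (w k)) = cmod (a k) / w k" for k
    using assms(3)[of k] by (simp add: norm_divide)
  then show ?thesis
    using lp_norm_finite_le_iff[of q 1 "\<lambda>k. a k / of_real (w k)"] assms by (simp add: ennreal_1)
qed

lemma weighted_le:
  assumes "0 < q" "\<And>k. 0 < w k" and "lp_norm q (\<lambda>k. a k / of_real (w k)) \<le> 1"
  shows "cmod (a k) \<le> w k"
proof (cases "q = \<infinity>")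
  case True
  have "cmod (a k / of_real (w k)) \<le> 1"
    using assms True lp_norm_infinity_le_iff[of 1 "\<lambda>k. a k / of_real (w k)"] by (simp add: ennreal_1)
  then show ?thesis using assms(2)[of k] by (simp add: norm_divide divide_simps)
next
  case False
  have "(cmod (a k) / w k) powr enn2real q \<le> 1"
    using weighted_lq_bound[of q w a "{k}"] assms False by simp
  then have "cmod (a k) / w k \<le> 1"
    using recip_pos_finite[OF assms(1) False] assms(2)[of k]
      by (metis divide_nonneg_pos less_eq_real_def norm_ge_zero not_le powr_gt_zero powr_less_mono2 powr_one_eq_one zero_le_one)
  then show ?thesis using assms(2)[of k] by (simp add: divide_simps)
qed

text \<open>The coefficients exceeding the level \<open>W L\<^bsup>-1/q\<^esup>\<close> are at most \<open>L\<close> many.\<close>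

lemma lp_norm_threshold:
  assumes q: "0 < q" "q \<le> p" and w: "\<And>k. 0 < w k"
    and a: "lp_norm q (\<lambda>k. a k / of_real (w k)) \<le> 1"
    and W: "\<And>k. k \<notin> \<gamma> \<Longrightarrow> w k \<le> W" "0 < W" and L: "0 < L"
  obtains \<gamma>' where "finite \<gamma>'" "real (card \<gamma>') \<le> L"
    "lp_norm p (\<lambda>k. if k \<in> \<gamma> \<union> \<gamma>' then 0 else a k) \<le> ennreal (W * L powr (recip p - recip q))"
proof (cases "q = \<infinity>")
  \<comment> \<open>Here p = \<infinity> as well, the exponent of \<open>L\<close> is 0, and no
    frequency has to be spent.\<close>
  case True
  then have p: "p = \<infinity>" using q by (simp add: top_unique)
  have "cmod (a k) \<le> W" if "k \<notin> \<gamma>" for k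
    using weighted_le[OF q(1) w a, of k] W(1)[OF that] by simp
  then have "lp_norm p (\<lambda>k. if k \<in> \<gamma> \<union> {} then 0 else a k) \<le> ennreal (W * L powr (recip p - recip q))"
    using p True W L by (auto simp: lp_norm_infinity_le_iff[unfolded infinity_ennreal_def])
  then show ?thesis using L by (intro that[of "{}"]) auto
next
  case False
  let ?q = "enn2real q"
  \<comment> \<open>Chosen so that \<open>\<tau> powr ?q = W powr ?q / L\<close>: the q-th powers
    outside \<gamma> add up to at most \<open>W powr ?q\<close>, hence at most \<open>L\<close> of
    them can exceed this level.\<close>
  define \<tau> where "\<tau> = W * L powr (- recip q)"
  define \<gamma>' where "\<gamma>' = {k. k \<notin> \<gamma> \<and> cmod (a k) > \<tau>}"
  note q' = recip_pos_finite[OF q(1) False]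
  have \<tau>: "0 < \<tau>" "\<tau> powr ?q = W powr ?q / L"
  proof -
    show "0 < \<tau>" using W L by (simp add: \<tau>_def)
    have "\<tau> powr ?q = W powr ?q * L powr (- recip q * ?q)"
      using W L by (simp add: \<tau>_def powr_mult powr_powr)
    also have "- recip q * ?q = - 1" using q' by simp
    finally show "\<tau> powr ?q = W powr ?q / L"
      using L by (simp add: powr_minus divide_simps)
  qed
  have sumq: "(\<Sum>k\<in>F. cmod (a k) powr ?q) \<le> W powr ?q" if F: "finite F" "F \<inter> \<gamma> = {}" for F
  proof -
    have "(\<Sum>k\<in>F. cmod (a k) powr ?q) \<le> (\<Sum>k\<in>F. W powr ?q * (cmod (a k) / w k) powr ?q)"
    proof (rule sum_mono)
      fix k assume "k \<in> F"
      then have "k \<notin> \<gamma>" using F by auto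
      then have "cmod (a k) \<le> W * (cmod (a k) / w k)"
        using W w[of k] by (simp add: divide_simps mult.commute mult_right_mono)
      then have "cmod (a k) powr ?q \<le> (W * (cmod (a k) / w k)) powr ?q"
        by (intro powr_mono2) auto
      then show "cmod (a k) powr ?q \<le> W powr ?q * (cmod (a k) / w k) powr ?q"
        using W(2) w[of k] powr_mult[of W "cmod (a k) / w k" ?q] by simp
    qed
    also have "\<dots> \<le> W powr ?q * 1"
      unfolding sum_distrib_left[symmetric]
      by (intro mult_left_mono weighted_lq_bound q False w a F) auto
    finally show ?thesis by simp
  qed
  have card_le: "real (card F) \<le> L" if F: "finite F" "F \<subseteq> \<gamma>'" for F
  proof -
    have "real (card F) * \<tau> powr ?q = (\<Sum>k\<in>F. \<tau> powr ?q)" by simp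
    also have "\<dots> \<le> (\<Sum>k\<in>F. cmod (a k) powr ?q)"
      using F \<tau> by (intro sum_mono powr_mono2) (auto simp: \<gamma>'_def)
    also have "\<dots> \<le> W powr ?q"
      using F by (intro sumq) (auto simp: \<gamma>'_def)
    finally show ?thesis using \<tau> L W by (simp add: divide_simps)
  qed
  have fin: "finite \<gamma>'"
  proof (rule ccontr)
    assume "infinite \<gamma>'"
    then obtain F where "finite F" "card F = Suc (nat \<lceil>L\<rceil>)" "F \<subseteq> \<gamma>'"
      using infinite_arbitrarily_large by blast
    then show False using card_le[of F] by linarith
  qed
  have small: "cmod (a k) \<le> \<tau>" if "k \<notin> \<gamma> \<union> \<gamma>'" for k
    using that by (auto simp: \<gamma>'_def)
  have "lp_norm p (\<lambda>k. if k \<in> \<gamma> \<union> \<gamma>' then 0 else a k) \<le> ennreal (W * L powr (recip p - recip q))"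
  proof (cases "p = \<infinity>")
    case True
    then show ?thesis
      using small \<tau> by (simp add: lp_norm_infinity_le_iff[unfolded infinity_ennreal_def] \<tau>_def[symmetric])
  next
    case pf: False
    let ?p = "enn2real p"
    have "0 < p" using q by auto
    note p' = recip_pos_finite[OF this pf]
    have qp: "?q \<le> ?p" using q pf by (intro enn2real_mono) (auto simp: less_top)
    have "(\<Sum>k\<in>F. cmod (if k \<in> \<gamma> \<union> \<gamma>' then 0 else a k) powr ?p)
        \<le> (W * L powr (recip p - recip q)) powr ?p" if "finite F" for F
    proof -
      have "(\<Sum>k\<in>F. cmod (if k \<in> \<gamma> \<union> \<gamma>' then 0 else a k) powr ?p)
         = (\<Sum>k\<in>F - (\<gamma> \<union> \<gamma>'). cmod (a k) powr ?p)"
        using that by (intro sum.mono_neutral_cong_right) auto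
      \<comment> \<open>Interpolation: p - q of the p factors are bounded by the level \<tau>, and
        the remaining q are summed.\<close>
      also have "\<dots> \<le> (\<Sum>k\<in>F - (\<gamma> \<union> \<gamma>'). \<tau> powr (?p - ?q) * cmod (a k) powr ?q)"
      proof (rule sum_mono)
        fix k assume "k \<in> F - (\<gamma> \<union> \<gamma>')"
        then have "cmod (a k) \<le> \<tau>" using small by auto
        then have "cmod (a k) powr (?p - ?q) \<le> \<tau> powr (?p - ?q)"
          using qp by (intro powr_mono2) auto
        then have "cmod (a k) powr (?p - ?q) * cmod (a k) powr ?q \<le> \<tau> powr (?p - ?q) * cmod (a k) powr ?q"
          by (intro mult_right_mono) auto
        then show "cmod (a k) powr ?p \<le> \<tau> powr (?p - ?q) * cmod (a k) powr ?q"
          by (simp add: powr_add[symmetric])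
      qed
      also have "\<dots> \<le> \<tau> powr (?p - ?q) * W powr ?q"
        unfolding sum_distrib_left[symmetric]
        using that by (intro mult_left_mono sumq) auto
      also have "\<dots> = (W * L powr (recip p - recip q)) powr ?p"
      proof -
        have "\<tau> powr (?p - ?q) = W powr (?p - ?q) * L powr (- recip q * (?p - ?q))"
          using W L by (simp add: \<tau>_def powr_mult powr_powr)
        also have "- recip q * (?p - ?q) = (recip p - recip q) * ?p"
          using p' q' by (simp add: field_simps)
        finally show ?thesis
          using W L by (simp add: powr_mult powr_powr powr_add[symmetric] mult_ac)
      qed
      finally show ?thesis .
    qed
    then show ?thesis
      using W L \<open>0 < p\<close> pf by (subst lp_norm_finite_le_iff) auto
  qed
  then show ?thesis using fin card_le[OF fin] by (intro that[of \<gamma>']) auto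
qed

text \<open>The normalised moduli \<open>cmod (a k) / w k\<close> are at most 1, so their p-th
  powers do not exceed their q-th powers.\<close>

lemma lp_norm_embed:
  assumes q: "0 < q" "q \<le> p" and w: "\<And>k. 0 < w k"
    and a: "lp_norm q (\<lambda>k. a k / of_real (w k)) \<le> 1"
    and W: "\<And>k. k \<notin> \<gamma> \<Longrightarrow> w k \<le> W" "0 < W"
  shows "lp_norm p (\<lambda>k. if k \<in> \<gamma> then 0 else a k) \<le> ennreal W"
proof (cases "p = \<infinity>")
  case True
  have "cmod (a k) \<le> W" if "k \<notin> \<gamma>" for k
    using weighted_le[OF q(1) w a, of k] W(1)[OF that] by simp
  then show ?thesis
    using True W by (auto simp: lp_norm_infinity_le_iff[unfolded infinity_ennreal_def])
next
  case False
  let ?q = "enn2real q" let ?p = "enn2real p"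
  have "0 < p" and qf: "q \<noteq> \<infinity>" using q False by (auto simp: top_unique)
  have qp: "?q \<le> ?p" using q False by (intro enn2real_mono) (auto simp: less_top)
  have "(\<Sum>k\<in>F. cmod (if k \<in> \<gamma> then 0 else a k) powr ?p) \<le> W powr ?p" if "finite F" for F
  proof -
    have "(\<Sum>k\<in>F. cmod (if k \<in> \<gamma> then 0 else a k) powr ?p) = (\<Sum>k\<in>F - \<gamma>. cmod (a k) powr ?p)"
      using that by (intro sum.mono_neutral_cong_right) auto
    also have "\<dots> \<le> (\<Sum>k\<in>F - \<gamma>. W powr ?p * (cmod (a k) / w k) powr ?q)"
    proof (rule sum_mono)
      fix k assume k: "k \<in> F - \<gamma>"
      have le1: "cmod (a k) / w k \<le> 1"
        using weighted_le[OF q(1) w a, of k] w[of k] by (simp add: divide_simps)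
      have "cmod (a k) \<le> W * (cmod (a k) / w k)"
        using W(1)[of k] k w[of k] by (simp add: divide_simps mult.commute mult_right_mono)
      then have "cmod (a k) powr ?p \<le> (W * (cmod (a k) / w k)) powr ?p"
        by (intro powr_mono2) auto
      also have "\<dots> = W powr ?p * (cmod (a k) / w k) powr ?p"
        using W(2) w[of k] by (subst powr_mult) auto
      also have "\<dots> \<le> W powr ?p * (cmod (a k) / w k) powr ?q"
        using le1 qp w[of k] by (intro mult_left_mono powr_mono') auto
      finally show "cmod (a k) powr ?p \<le> W powr ?p * (cmod (a k) / w k) powr ?q" .
    qed
    also have "\<dots> \<le> W powr ?p * 1"
      unfolding sum_distrib_left[symmetric]
      by (intro mult_left_mono weighted_lq_bound q qf w a) (use that in auto)
    finally show ?thesis by simp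
  qed
  then show ?thesis
    using W \<open>0 < p\<close> False by (subst lp_norm_finite_le_iff) auto
qed

text \<open>Hoelder's inequality, obtained by applying Young's inequality termwise after normalisation.\<close>

lemma lp_norm_hoelder:
  assumes p: "0 < p" "p < q" and w: "\<And>k. 0 < w k"
    and a: "lp_norm q (\<lambda>k. a k / of_real (w k)) \<le> 1"
    and s: "s = 1 / (recip p - recip q)"
    and Z: "\<And>F. finite F \<Longrightarrow> F \<inter> \<gamma> = {} \<Longrightarrow> (\<Sum>k\<in>F. w k powr s) \<le> Z" "0 < Z"
  shows "lp_norm p (\<lambda>k. if k \<in> \<gamma> then 0 else a k) \<le> ennreal (Z powr (recip p - recip q))"
proof -
  let ?p = "enn2real p"
  have pf: "p \<noteq> \<infinity>" and q0: "0 < q" using p by auto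
  note p' = recip_pos_finite[OF p(1) pf]
  have s0: "0 < s" and s': "recip p - recip q = 1 / s"
    using recip_strict_antimono[OF p] s by auto
  define \<beta> where "\<beta> = ?p / s"
  have \<beta>: "0 < \<beta>" using p' s0 by (simp add: \<beta>_def)
  have Zp: "(Z powr (recip p - recip q)) powr ?p = Z powr \<beta>"
    using s' by (simp add: powr_powr \<beta>_def)
  have "(\<Sum>k\<in>F. cmod (if k \<in> \<gamma> then 0 else a k) powr ?p) \<le> Z powr \<beta>" if "finite F" for F
  proof -
    have eq: "(\<Sum>k\<in>F. cmod (if k \<in> \<gamma> then 0 else a k) powr ?p) = (\<Sum>k\<in>F - \<gamma>. cmod (a k) powr ?p)"
      using that by (intro sum.mono_neutral_cong_right) auto
    have ZF: "(\<Sum>k\<in>F - \<gamma>. w k powr s) \<le> Z" using Z(1)[of "F - \<gamma>"] that by auto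
    show ?thesis
    proof (cases "q = \<infinity>")
      case True
      then have sp: "s = ?p" using s p' by simp
      have "(\<Sum>k\<in>F - \<gamma>. cmod (a k) powr ?p) \<le> (\<Sum>k\<in>F - \<gamma>. w k powr s)"
        unfolding sp using weighted_le[OF q0 w a] by (intro sum_mono powr_mono2) auto
      also have "\<dots> \<le> Z powr \<beta>" using ZF Z(2) sp p' by (simp add: \<beta>_def)
      finally show ?thesis using eq by simp
    next
      case False
      let ?q = "enn2real q"
      note q' = recip_pos_finite[OF q0 False]
      define \<theta> where "\<theta> = ?p / ?q"
      have \<theta>: "0 < \<theta>" "\<theta> + \<beta> = 1"
      proof -
        show "0 < \<theta>" using p' q' by (simp add: \<theta>_def)
        have "\<theta> + \<beta> = ?p * recip q + ?p * (recip p - recip q)"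
          using q' s' by (simp add: \<theta>_def \<beta>_def)
        also have "\<dots> = ?p * recip p" by (simp add: algebra_simps)
        finally show "\<theta> + \<beta> = 1" using p' by simp
      qed
      \<comment> \<open>The terms \<open>(cmod (a k) / w k) powr ?q\<close> and
        \<open>w k powr s / Z\<close> both have sums at most 1; with weights satisfying \<theta> +
        \<beta> = 1 the bracket therefore sums to at most 1.\<close>
      have "(\<Sum>k\<in>F - \<gamma>. cmod (a k) powr ?p)
        \<le> (\<Sum>k\<in>F - \<gamma>. Z powr \<beta> * (\<theta> * (cmod (a k) / w k) powr ?q + \<beta> * (w k powr s / Z)))"
      proof (rule sum_mono)
        fix k
        show "cmod (a k) powr ?p \<le> Z powr \<beta> * (\<theta> * (cmod (a k) / w k) powr ?q + \<beta> * (w k powr s / Z))"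
        proof (cases "a k = 0")
          case True
          then show ?thesis using \<beta> Z(2) by simp
        next
          case False
          define y where "y = cmod (a k) / w k"
          have y: "0 < y" using False w[of k] by (simp add: y_def)
          have "cmod (a k) powr ?p = (y * w k) powr ?p"
            using w[of k] by (simp add: y_def)
          also have "\<dots> = (y powr ?q) powr \<theta> * (w k powr s) powr \<beta>"
            using y w[of k] q' s0 by (simp add: powr_mult powr_powr \<theta>_def \<beta>_def)
          also have "\<dots> = Z powr \<beta> * ((y powr ?q) powr \<theta> * (w k powr s / Z) powr \<beta>)"
            using Z(2) w[of k] by (simp add: powr_divide)
          also have "\<dots> \<le> Z powr \<beta> * (\<theta> * y powr ?q + \<beta> * (w k powr s / Z))"
            using y w[of k] Z(2) \<theta> \<beta>
            by (intro mult_left_mono Youngs_inequality_0) auto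
          finally show ?thesis by (simp add: y_def)
        qed
      qed
      also have "\<dots> = Z powr \<beta> * (\<theta> * (\<Sum>k\<in>F - \<gamma>. (cmod (a k) / w k) powr ?q) + \<beta> * ((\<Sum>k\<in>F - \<gamma>. w k powr s) / Z))"
        by (simp add: sum_distrib_left sum.distrib sum_divide_distrib distrib_left)
      also have "\<dots> \<le> Z powr \<beta> * (\<theta> * 1 + \<beta> * 1)"
        using \<theta> \<beta> ZF Z(2) that
        by (intro mult_left_mono add_mono weighted_lq_bound q0 False w a) auto
      finally show ?thesis using eq \<theta> by simp
    qed
  qed
  then show ?thesis
    using p pf Zp by (subst lp_norm_finite_le_iff) auto
qed

lemma lp_norm_flat_lower:
  assumes p: "0 < p" and B: "finite B" "L \<le> real (card B)" "0 < L"
    and b: "\<And>k. k \<in> B \<Longrightarrow> c \<le> cmod (b k)" "0 \<le> c"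
  shows "ennreal (c * L powr recip p) \<le> lp_norm p b"
proof (cases "p = \<infinity>")
  case True
  from B obtain k where "k \<in> B" by fastforce
  then show ?thesis using True b B
    by (auto simp: lp_norm_def intro!: SUP_upper2[of k] ennreal_leI)
next
  case False
  let ?p = "enn2real p"
  note p' = recip_pos_finite[OF p False]
  let ?g = "\<lambda>k. cmod (b k) powr ?p"
  show ?thesis
  proof (cases "?g summable_on UNIV")
    case True
    have "L * c powr ?p \<le> real (card B) * c powr ?p"
      using B by (intro mult_right_mono) auto
    also have "\<dots> = (\<Sum>k\<in>B. c powr ?p)" by simp
    also have "\<dots> \<le> sum ?g B" using b by (intro sum_mono powr_mono2) auto
    also have "\<dots> \<le> infsum ?g UNIV" using True B by (intro finite_sum_le_infsum) auto
    finally have "(L * c powr ?p) powr recip p \<le> infsum ?g UNIV powr recip p"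
      using B by (intro powr_mono2) (auto simp: recip_nonneg)
    moreover have "(L * c powr ?p) powr recip p = c * L powr recip p"
      using B b p' by (simp add: powr_mult powr_powr)
    ultimately show ?thesis
      using False True by (simp add: lp_norm_def ennreal_leI)
  qed (use False in \<open>simp add: lp_norm_def\<close>)
qed

lemma lp_norm_flat_upper:
  assumes q: "0 < q" and A: "finite A" and w: "\<And>k. 0 < w k" and c: "0 < c"
    and fin: "q \<noteq> \<infinity> \<Longrightarrow> (\<Sum>k\<in>A. w k powr (- enn2real q)) \<le> c powr (- enn2real q)"
    and inf: "\<And>k. q = \<infinity> \<Longrightarrow> k \<in> A \<Longrightarrow> c \<le> w k"
  shows "lp_norm q (\<lambda>k. (if k \<in> A then of_real c else 0) / of_real (w k)) \<le> 1"
proof (cases "q = \<infinity>")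
  case True
  then show ?thesis
    using inf c w lp_norm_infinity_le_iff[of 1 "\<lambda>k. (if k \<in> A then of_real c else 0) / of_real (w k)"]
    by (auto simp: ennreal_1 norm_divide divide_simps less_imp_le abs_of_pos)
next
  case False
  let ?q = "enn2real q"
  have "(\<Sum>k\<in>F. cmod ((if k \<in> A then of_real c else 0) / of_real (w k)) powr ?q) \<le> 1 powr ?q" if "finite F" for F
  proof -
    have "(\<Sum>k\<in>F. cmod ((if k \<in> A then of_real c else 0) / of_real (w k)) powr ?q)
       = (\<Sum>k\<in>F \<inter> A. c powr ?q * w k powr (- ?q))"
      using that c w
      by (intro sum.mono_neutral_cong_right)
         (auto simp: norm_divide powr_divide powr_minus divide_simps abs_of_pos less_imp_le)
    also have "\<dots> \<le> c powr ?q * (\<Sum>k\<in>A. w k powr (- ?q))"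
      unfolding sum_distrib_left[symmetric] using A
      by (intro mult_left_mono sum_mono2) auto
    also have "\<dots> \<le> c powr ?q * c powr (- ?q)"
      using fin[OF False] by (intro mult_left_mono) auto
    finally show ?thesis using c by (simp add: powr_add[symmetric])
  qed
  then show ?thesis
    unfolding lp_norm_finite_le_iff[OF q False zero_le_one, unfolded ennreal_1] by simp
qed

section \<open>Lattice points in balls\<close>

lemma sum_antimono_integral_bounds:
  fixes f :: "real \<Rightarrow> real"
  assumes t: "0 \<le> t" and anti: "\<And>x y. 0 \<le> x \<Longrightarrow> x \<le> y \<Longrightarrow> y \<le> t \<Longrightarrow> f y \<le> f x"
    and nonneg: "\<And>x. 0 \<le> x \<Longrightarrow> x \<le> t \<Longrightarrow> 0 \<le> f x"
    and int: "f integrable_on {0..t}"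
  shows "(\<Sum>j=1..nat \<lfloor>t\<rfloor>. f (real j)) \<le> integral {0..t} f"
    and "integral {0..t} f \<le> f 0 + (\<Sum>j=1..nat \<lfloor>t\<rfloor>. f (real j))"
proof -
  have sub: "f integrable_on {a..b}" if "0 \<le> a" "b \<le> t" for a b
    by (rule integrable_on_subinterval[OF int]) (use that in auto)
  \<comment> \<open>The extra term \<open>f (real n)\<close> in the second inequality is kept to pay
    for the incomplete last interval from \<open>n\<close> to \<open>t\<close>.\<close>
  have bounds: "(\<Sum>j=1..n. f (real j)) \<le> integral {0..real n} f \<and>
      integral {0..real n} f + f (real n) \<le> f 0 + (\<Sum>j=1..n. f (real j))" if "real n \<le> t" for n
    using that
  proof (induction n)
    case (Suc n)
    have split: "integral {0..real (Suc n)} f = integral {0..real n} f + integral {real n..real (Suc n)} f"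
      using Suc.prems by (intro Henstock_Kurzweil_Integration.integral_combine[symmetric] sub) auto
    have "integral {real n..real (Suc n)} (\<lambda>_. f (real (Suc n))) \<le> integral {real n..real (Suc n)} f"
      using Suc.prems by (intro integral_le sub anti) auto
    moreover have "integral {real n..real (Suc n)} f \<le> integral {real n..real (Suc n)} (\<lambda>_. f (real n))"
      using Suc.prems by (intro integral_le sub anti) auto
    ultimately show ?case using Suc split by simp
  qed simp
  let ?n = "nat \<lfloor>t\<rfloor>"
  have n: "real ?n \<le> t" "t - real ?n \<le> 1" using t by linarith+
  have split: "integral {0..t} f = integral {0..real ?n} f + integral {real ?n..t} f"
    using n by (intro Henstock_Kurzweil_Integration.integral_combine[symmetric] int) auto
  have "integral {real ?n..t} f \<le> integral {real ?n..t} (\<lambda>_. f (real ?n))"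
    using n by (intro integral_le sub anti) auto
  also have "\<dots> = (t - real ?n) * f (real ?n)" using n by simp
  also have "\<dots> \<le> 1 * f (real ?n)" using n nonneg[of ?n] by (intro mult_right_mono) auto
  finally have up: "integral {real ?n..t} f \<le> f (real ?n)" by simp
  have lo: "0 \<le> integral {real ?n..t} f"
  proof (intro Henstock_Kurzweil_Integration.integral_nonneg sub nonneg)
    show "0 \<le> x" if "x \<in> {real ?n..t}" for x
      using that order_trans[of 0 "real ?n" x] by simp
  qed (use n in auto)
  show "(\<Sum>j=1..nat \<lfloor>t\<rfloor>. f (real j)) \<le> integral {0..t} f"
    using bounds[OF n(1)] split lo by linarith
  show "integral {0..t} f \<le> f 0 + (\<Sum>j=1..nat \<lfloor>t\<rfloor>. f (real j))"
    using bounds[OF n(1)] split up by linarith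
qed

lemma sum_symmetric_int_interval:
  fixes f :: "real \<Rightarrow> real"
  shows "(\<Sum>z\<in>{- int n..int n}. f \<bar>real_of_int z\<bar>) = f 0 + 2 * (\<Sum>j=1..n. f (real j))"
proof (induction n)
  case (Suc n)
  have "{- int (Suc n)..int (Suc n)} = insert (- int (Suc n)) (insert (int (Suc n)) {- int n..int n})"
    by auto
  then show ?case using Suc by (simp add: add.commute)
qed simp

text \<open>The integrand is the n-th power of the radius of the slice at height x of a ball of
  radius t. Substituting \<open>x = t * y powr (1 / r)\<close> turns the integral into a Beta
  integral.\<close>

lemma has_integral_lr_slice:
  assumes "0 < t" "0 < r"
  shows "((\<lambda>x. ((t powr r - x powr r) powr (1 / r)) ^ n) has_integral
    t ^ Suc n * (Gamma (1 + 1 / r) * Gamma (1 + real n / r) / Gamma (1 + real (Suc n) / r))) {0..t}"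
proof -
  define f where "f x = ((t powr r - x powr r) powr (1 / r)) ^ n" for x
  define g where "g y = t * y powr (1 / r)" for y
  define g' where "g' y = t / r * y powr (1 / r - 1)" for y
  have cf: "continuous_on {0..t} f"
    unfolding f_def using assms
    by (intro continuous_intros continuous_on_powr') (auto simp: powr_mono2)
  \<comment> \<open>For r > 1 the substitution has infinite slope at 0, which is therefore an
    exceptional point.\<close>
  have "((\<lambda>y. g' y *\<^sub>R f (g y)) has_integral integral {g 0..g 1} f) {0..1}"
  proof (rule has_integral_substitution_strong[where s = "{0}" and c = 0 and d = t])
    show "g ` {0..1} \<subseteq> {0..t}"
    proof (rule image_subsetI)
      fix y :: real assume "y \<in> {0..1}"
      then have "y powr (1 / r) \<le> 1" using assms by (intro powr_le1) auto
      then show "g y \<in> {0..t}" using assms by (simp add: g_def mult_left_le)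
    qed
    show "continuous_on {0..1} g"
      unfolding g_def using assms by (intro continuous_intros continuous_on_powr') auto
    show "(g has_real_derivative g' x) (at x within {0..1})" if "x \<in> {0..1} - {0}" for x
      unfolding g_def g'_def using that assms
      by (auto intro!: derivative_eq_intros simp: powr_diff field_simps)
  qed (use cf assms in \<open>auto simp: g_def\<close>)
  then have 1: "((\<lambda>y. g' y * f (g y)) has_integral integral {0..t} f) {0..1}"
    by (simp add: g_def)
  define a where "a = t ^ Suc n / r"
  have 2: "((\<lambda>y. a * (y powr (1 / r - 1) * (1 - y) powr ((real n / r + 1) - 1))) has_integral
      a * Beta (1 / r) (real n / r + 1)) {0..1}"
    using assms by (intro has_integral_mult_right has_integral_Beta_real add_nonneg_pos) auto
  \<comment> \<open>The point 1 is left out because for \<open>n = 0\<close> the two forms disagree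
    there: \<open>0 ^ 0 = 1\<close>, but \<open>0 powr 0 = 0\<close>.\<close>
  have "((\<lambda>y. g' y * f (g y)) has_integral a * Beta (1 / r) (real n / r + 1)) {0..1}"
  proof (rule has_integral_spike_finite[where S = "{1}", OF _ _ 2])
    fix y :: real assume y: "y \<in> {0..1} - {1}"
    have "(g y) powr r = t powr r * y"
      using y assms by (simp add: g_def powr_mult powr_powr)
    then have "f (g y) = ((t powr r * (1 - y)) powr (1 / r)) ^ n"
      by (simp add: f_def algebra_simps)
    also have "\<dots> = (t * (1 - y) powr (1 / r)) ^ n"
      using y assms by (simp add: powr_mult powr_powr)
    also have "\<dots> = t ^ n * (1 - y) powr (real n / r)"
      using y by (simp add: power_mult_distrib powr_power)
    finally show "g' y * f (g y) = a * (y powr (1 / r - 1) * (1 - y) powr ((real n / r + 1) - 1))"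
      by (simp add: g'_def a_def)
  qed simp
  with 1 have "integral {0..t} f = a * Beta (1 / r) (real n / r + 1)"
    by (rule has_integral_unique)
  also have "\<dots> = t ^ Suc n * (Gamma (1 + 1 / r) * Gamma (1 + real n / r) / Gamma (1 + real (Suc n) / r))"
  proof -
    have "1 / r \<notin> \<int>\<^sub>\<le>\<^sub>0" using assms nonpos_Ints_nonpos[of "1 / r"] by auto
    then have "Gamma (1 + 1 / r) = 1 / r * Gamma (1 / r)"
      using Gamma_plus1[of "1 / r"] assms by (simp add: add.commute)
    moreover have "1 / r + (real n / r + 1) = 1 + real (Suc n) / r"
      using assms by (simp add: field_simps)
    then have "Beta (1 / r) (real n / r + 1)
        = Gamma (1 / r) * Gamma (1 + real n / r) / Gamma (1 + real (Suc n) / r)"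
      unfolding Beta_def by (simp only: add.commute[of "real n / r" 1])
    ultimately show ?thesis by (simp add: a_def)
  qed
  finally show ?thesis
    using integrable_integral[OF integrable_continuous_interval[OF cf]] by (simp add: f_def[abs_def])
qed

text \<open>Dirichlet's formula for the volume of the unit ball of l_r^n with finite r. The
  dimension is a parameter because lattice points are counted by induction on it.\<close>

definition lr_volume :: "real \<Rightarrow> nat \<Rightarrow> real" where
  "lr_volume r n = (2 * Gamma (1 + 1 / r)) ^ n / Gamma (1 + real n / r)"

lemma lr_volume_Suc:
  assumes "0 < r"
  shows "lr_volume r (Suc n) =
    2 * lr_volume r n * (Gamma (1 + 1 / r) * Gamma (1 + real n / r) / Gamma (1 + real (Suc n) / r))"
proof -
  have "0 < Gamma (1 + real n / r)" using assms by (intro Gamma_real_pos add_pos_nonneg) auto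
  then show ?thesis by (simp add: lr_volume_def)
qed

lemma lr_volume_pos: "0 < r \<Longrightarrow> 0 < lr_volume r n"
  by (simp add: lr_volume_def add_pos_nonneg)

text \<open>Fixing the coordinates outside \<open>S\<close> to 0 keeps balls of every lower
  dimension in the one type \<open>int ^ 'd\<close>, so the induction on the dimension becomes an
  induction on \<open>S\<close>.\<close>

definition lr_ball_on :: "real \<Rightarrow> 'd set \<Rightarrow> real \<Rightarrow> (int ^ 'd) set" where
  "lr_ball_on r S t = {k. (\<forall>j. j \<notin> S \<longrightarrow> k $ j = 0) \<and>
     (\<Sum>j\<in>S. \<bar>real_of_int (k $ j)\<bar> powr r) \<le> t powr r}"

lemma lr_ball_on_insert:
  fixes S :: "'d::finite set"
  assumes "i \<notin> S" "0 < r" "0 \<le> t"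
  shows "lr_ball_on r (insert i S) t = (\<Union>z\<in>{- int (nat \<lfloor>t\<rfloor>)..int (nat \<lfloor>t\<rfloor>)}.
    (\<lambda>k. \<chi> j. if j = i then z else k $ j) `
      lr_ball_on r S ((t powr r - \<bar>real_of_int z\<bar> powr r) powr (1 / r)))" (is "_ = ?R")
proof -
  have fS: "finite S" by simp
  have upd: "(\<Sum>j\<in>S. \<bar>real_of_int ((\<chi> j. if j = i then z else k $ j) $ j)\<bar> powr r)
      = (\<Sum>j\<in>S. \<bar>real_of_int (k $ j)\<bar> powr r)" for z and k :: "int ^ 'd"
    using assms(1) by (intro sum.cong) auto
  have pp: "((t powr r - \<bar>real_of_int z\<bar> powr r) powr (1 / r)) powr r = t powr r - \<bar>real_of_int z\<bar> powr r"
    if "\<bar>real_of_int z\<bar> powr r \<le> t powr r" for z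
    using that assms by (simp add: powr_powr)
  have z: "z \<in> {- int (nat \<lfloor>t\<rfloor>)..int (nat \<lfloor>t\<rfloor>)} \<longleftrightarrow> \<bar>real_of_int z\<bar> powr r \<le> t powr r" for z
  proof -
    have "\<bar>real_of_int z\<bar> powr r \<le> t powr r \<longleftrightarrow> \<bar>real_of_int z\<bar> \<le> t"
      using assms powr_less_mono2[of r t "\<bar>real_of_int z\<bar>"] powr_mono2[of r "\<bar>real_of_int z\<bar>" t] by force
    also have "\<dots> \<longleftrightarrow> z \<in> {- int (nat \<lfloor>t\<rfloor>)..int (nat \<lfloor>t\<rfloor>)}"
      using assms(3) by (auto simp: abs_le_iff le_floor_iff floor_le_iff) linarith+
    finally show ?thesis by blast
  qed
  show ?thesis
  proof (intro equalityI subsetI)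
    fix k assume k: "k \<in> lr_ball_on r (insert i S) t"
    let ?k = "\<chi> j. if j = i then 0 else k $ j"
    have le: "\<bar>real_of_int (k $ i)\<bar> powr r + (\<Sum>j\<in>S. \<bar>real_of_int (k $ j)\<bar> powr r) \<le> t powr r"
      using k assms(1) by (simp add: lr_ball_on_def)
    moreover have "0 \<le> (\<Sum>j\<in>S. \<bar>real_of_int (k $ j)\<bar> powr r)" by (simp add: sum_nonneg)
    ultimately have zi: "\<bar>real_of_int (k $ i)\<bar> powr r \<le> t powr r" by linarith
    have "?k \<in> lr_ball_on r S ((t powr r - \<bar>real_of_int (k $ i)\<bar> powr r) powr (1 / r))"
      using k le unfolding lr_ball_on_def mem_Collect_eq upd pp[OF zi] by auto
    moreover have "k = (\<chi> j. if j = i then k $ i else ?k $ j)" by (simp add: vec_eq_iff)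
    ultimately show "k \<in> ?R" using zi z by blast
  next
    fix k assume "k \<in> ?R"
    then obtain z k' where z': "z \<in> {- int (nat \<lfloor>t\<rfloor>)..int (nat \<lfloor>t\<rfloor>)}"
      and k': "k' \<in> lr_ball_on r S ((t powr r - \<bar>real_of_int z\<bar> powr r) powr (1 / r))"
      "k = (\<chi> j. if j = i then z else k' $ j)" by blast
    note zk = z'[unfolded z] k'
    have "(\<Sum>j\<in>S. \<bar>real_of_int (k $ j)\<bar> powr r) = (\<Sum>j\<in>S. \<bar>real_of_int (k' $ j)\<bar> powr r)"
      unfolding zk(3) by (rule upd)
    then show "k \<in> lr_ball_on r (insert i S) t"
      using zk assms(1) by (simp add: lr_ball_on_def pp[OF zk(1)])
  qed
qed

lemma card_lr_ball_on_insert: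
  fixes S :: "'d::finite set"
  assumes "i \<notin> S" "0 < r" "0 \<le> t" and fin: "\<And>u. 0 \<le> u \<Longrightarrow> finite (lr_ball_on r S u)"
  shows "finite (lr_ball_on r (insert i S) t)"
    and "card (lr_ball_on r (insert i S) t) = (\<Sum>z\<in>{- int (nat \<lfloor>t\<rfloor>)..int (nat \<lfloor>t\<rfloor>)}.
      card (lr_ball_on r S ((t powr r - \<bar>real_of_int z\<bar> powr r) powr (1 / r))))"
proof -
  let ?u = "\<lambda>z k. \<chi> j. if j = i then z else k $ j"
  let ?B = "\<lambda>z. lr_ball_on r S ((t powr r - \<bar>real_of_int z\<bar> powr r) powr (1 / r))"
  have finB: "finite (?B z)" for z by (intro fin) simp
  show "finite (lr_ball_on r (insert i S) t)"
    unfolding lr_ball_on_insert[OF assms(1-3)] using finB by blast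
  have "card (lr_ball_on r (insert i S) t) = (\<Sum>z\<in>{- int (nat \<lfloor>t\<rfloor>)..int (nat \<lfloor>t\<rfloor>)}. card (?u z ` ?B z))"
    unfolding lr_ball_on_insert[OF assms(1-3)]
    by (intro card_UN_disjoint) (auto simp: finB vec_eq_iff dest!: spec[of _ i])
  also have "\<dots> = (\<Sum>z\<in>{- int (nat \<lfloor>t\<rfloor>)..int (nat \<lfloor>t\<rfloor>)}. card (?B z))"
  proof (intro sum.cong refl card_image inj_onI)
    fix z k k' assume "k \<in> ?B z" "k' \<in> ?B z" and eq: "?u z k = ?u z k'"
    then have "k $ i = k' $ i" using assms(1) by (simp add: lr_ball_on_def)
    then show "k = k'" using eq by (simp add: vec_eq_iff) metis
  qed
  finally show "card (lr_ball_on r (insert i S) t) = (\<Sum>z\<in>{- int (nat \<lfloor>t\<rfloor>)..int (nat \<lfloor>t\<rfloor>)}. card (?B z))" .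
qed

text \<open>Cavalieri's principle: slice along a new coordinate. Replacing counts by volumes costs
  an error of order \<open>(t + 1) ^ (n - 1)\<close> on each of O(t + 1) slices, and replacing the
  sum over slices by an integral costs at most the largest slice. The factor
  \<open>real (card S)\<close> makes the error vanish in dimension 0, where the count is exact and
  the exponent \<open>card S - 1\<close> is truncated.\<close>

lemma card_lr_ball_on:
  fixes S :: "'d::finite set"
  assumes r: "0 < r"
  shows "\<exists>C\<ge>0. \<forall>t\<ge>0. finite (lr_ball_on r S t) \<and>
    \<bar>real (card (lr_ball_on r S t)) - lr_volume r (card S) * t ^ card S\<bar>
      \<le> C * (real (card S) * (t + 1) ^ (card S - 1))"
proof (induction S rule: finite_induct[OF finite])
  case 1
  have "lr_ball_on r ({} :: 'd set) t = {0}" for t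
    by (auto simp: lr_ball_on_def vec_eq_iff)
  then show ?case by (intro exI[of _ 0]) (simp add: lr_volume_def)
next
  case (2 i S)
  define n where "n = card S"
  define v where "v = lr_volume r n"
  have v: "0 < v" using lr_volume_pos[OF r] by (simp add: v_def)
  from 2 obtain C where C: "0 \<le> C" "\<And>t. 0 \<le> t \<Longrightarrow> finite (lr_ball_on r S t)"
    "\<And>t. 0 \<le> t \<Longrightarrow> \<bar>real (card (lr_ball_on r S t)) - v * t ^ n\<bar> \<le> C * (real n * (t + 1) ^ (n - 1))"
    unfolding n_def v_def by blast
  have cardS: "card (insert i S) = Suc n" using 2 by (simp add: n_def)
  have main: "\<bar>real (card (lr_ball_on r (insert i S) t)) - lr_volume r (Suc n) * t ^ Suc n\<bar>
      \<le> (2 * C * real n + v) * (t + 1) ^ n" if t: "0 \<le> t" for t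
  proof -
    define g where "g x = (t powr r - x powr r) powr (1 / r)" for x
    define A where "A = {- int (nat \<lfloor>t\<rfloor>)..int (nat \<lfloor>t\<rfloor>)}"
    have cardA: "real (card A) \<le> 2 * (t + 1)"
      using t unfolding A_def by simp linarith
    have anti: "g y \<le> g x" if "0 \<le> x" "x \<le> y" "y \<le> t" for x y
      unfolding g_def using that r by (intro powr_mono2) (auto simp: powr_mono2)
    have g0: "0 \<le> g x" for x by (simp add: g_def)
    have gt: "g 0 = t" using r t by (simp add: g_def powr_powr)
    have Ag: "g \<bar>real_of_int z\<bar> \<le> t" if "z \<in> A" for z
    proof -
      have "\<bar>real_of_int z\<bar> \<le> t" using that t unfolding A_def by auto linarith+
      then show ?thesis using anti[of 0 "\<bar>real_of_int z\<bar>"] gt by simp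
    qed
    have integ: "((\<lambda>x. g x ^ n) has_integral t ^ Suc n *
        (Gamma (1 + 1 / r) * Gamma (1 + real n / r) / Gamma (1 + real (Suc n) / r))) {0..t}" (is "(_ has_integral ?I) _")
    proof (cases "t = 0")
      case True
      then show ?thesis using has_integral_refl(2)[of "\<lambda>x. g x ^ n" 0] by simp
    next
      case False
      then show ?thesis unfolding g_def using t r by (intro has_integral_lr_slice) auto
    qed
    have V: "lr_volume r (Suc n) * t ^ Suc n = v * (2 * ?I)"
      using lr_volume_Suc[OF r, of n] by (simp add: v_def)
    define s where "s = (\<Sum>z\<in>A. g \<bar>real_of_int z\<bar> ^ n)"
    have "s = g 0 ^ n + 2 * (\<Sum>j=1..nat \<lfloor>t\<rfloor>. g (real j) ^ n)"
      unfolding s_def A_def by (rule sum_symmetric_int_interval)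
    moreover have "(\<Sum>j=1..nat \<lfloor>t\<rfloor>. g (real j) ^ n) \<le> ?I" "?I \<le> g 0 ^ n + (\<Sum>j=1..nat \<lfloor>t\<rfloor>. g (real j) ^ n)"
      using sum_antimono_integral_bounds[of t "\<lambda>x. g x ^ n"] t integ anti g0
      by (auto simp: integral_unique has_integral_integrable power_mono)
    \<comment> \<open>The central slice occurs once and the others twice, so both one-sided
      comparisons are off by at most \<open>g 0 ^ n\<close>.\<close>
    ultimately have "\<bar>s - 2 * ?I\<bar> \<le> t ^ n" unfolding gt by linarith
    also have "\<dots> \<le> (t + 1) ^ n" using t by (intro power_mono) auto
    finally have "v * \<bar>s - 2 * ?I\<bar> \<le> v * (t + 1) ^ n" using v by (intro mult_left_mono) auto
    then have e1: "\<bar>v * s - v * (2 * ?I)\<bar> \<le> v * (t + 1) ^ n"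
      using v by (simp only: abs_mult abs_of_pos right_diff_distrib[symmetric])
    have cardE: "real (card (lr_ball_on r (insert i S) t)) = (\<Sum>z\<in>A. real (card (lr_ball_on r S (g \<bar>real_of_int z\<bar>))))"
      using card_lr_ball_on_insert(2)[OF \<open>i \<notin> S\<close> r t C(2)] by (simp add: A_def g_def)
    have "\<bar>real (card (lr_ball_on r (insert i S) t)) - v * s\<bar>
        = \<bar>\<Sum>z\<in>A. real (card (lr_ball_on r S (g \<bar>real_of_int z\<bar>))) - v * g \<bar>real_of_int z\<bar> ^ n\<bar>"
      unfolding cardE s_def by (simp add: sum_subtractf sum_distrib_left)
    also have "\<dots> \<le> (\<Sum>z\<in>A. \<bar>real (card (lr_ball_on r S (g \<bar>real_of_int z\<bar>))) - v * g \<bar>real_of_int z\<bar> ^ n\<bar>)"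
      by (rule sum_abs)
    also have "\<dots> \<le> (\<Sum>z\<in>A. C * (real n * (t + 1) ^ (n - 1)))"
    proof (rule sum_mono)
      fix z assume z: "z \<in> A"
      have "\<bar>real (card (lr_ball_on r S (g \<bar>real_of_int z\<bar>))) - v * g \<bar>real_of_int z\<bar> ^ n\<bar>
        \<le> C * (real n * (g \<bar>real_of_int z\<bar> + 1) ^ (n - 1))" by (intro C(3) g0)
      also have "\<dots> \<le> C * (real n * (t + 1) ^ (n - 1))"
        using C(1) Ag[OF z] g0 by (intro mult_left_mono power_mono add_right_mono) auto
      finally show "\<bar>real (card (lr_ball_on r S (g \<bar>real_of_int z\<bar>))) - v * g \<bar>real_of_int z\<bar> ^ n\<bar>
        \<le> C * (real n * (t + 1) ^ (n - 1))" .
    qed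
    also have "\<dots> = real (card A) * (C * (real n * (t + 1) ^ (n - 1)))" by simp
    also have "\<dots> \<le> 2 * (t + 1) * (C * (real n * (t + 1) ^ (n - 1)))"
      using cardA C(1) t by (intro mult_right_mono) auto
    also have "\<dots> = 2 * C * real n * (t + 1) ^ n"
      by (cases n) auto
    finally show ?thesis using e1 unfolding V by (simp add: distrib_right)
  qed
  show ?case
  proof (intro exI[of _ "2 * C * real n + v"] conjI allI impI)
    show "0 \<le> 2 * C * real n + v" using C(1) v by simp
    fix t :: real assume t: "0 \<le> t"
    show "finite (lr_ball_on r (insert i S) t)"
      using card_lr_ball_on_insert(1)[OF \<open>i \<notin> S\<close> r t C(2)] .
    have "(2 * C * real n + v) * (t + 1) ^ n \<le> (2 * C * real n + v) * (real (Suc n) * (t + 1) ^ n)"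
      using C(1) v t mult_right_mono[of 1 "real (Suc n)" "(t + 1) ^ n"] by (intro mult_left_mono) auto
    then show "\<bar>real (card (lr_ball_on r (insert i S) t)) - lr_volume r (card (insert i S)) * t ^ card (insert i S)\<bar>
      \<le> (2 * C * real n + v) * (real (card (insert i S)) * (t + 1) ^ (card (insert i S) - 1))"
      unfolding cardS using main[OF t] by simp
  qed
qed

section \<open>Counting lattice points in balls and shells\<close>

lemma vec_norm_nonneg: "0 \<le> vec_norm r (k :: int ^ 'd)"
proof (cases "r = \<infinity>")
  case True
  have "\<bar>real_of_int (k $ undefined)\<bar> \<le> vec_norm r k"
    using True by (simp add: vec_norm_def)
  then show ?thesis by linarith
qed (simp add: vec_norm_def)

lemma component_le_vec_norm:
  fixes k :: "int ^ 'd"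
  assumes "0 < r"
  shows "\<bar>real_of_int (k $ j)\<bar> \<le> vec_norm r k"
proof (cases "r = \<infinity>")
  case False
  note r' = recip_pos_finite[OF assms False]
  let ?r = "enn2real r"
  have "\<bar>real_of_int (k $ j)\<bar> powr ?r \<le> (\<Sum>j\<in>UNIV. \<bar>real_of_int (k $ j)\<bar> powr ?r)"
    by (intro member_le_sum) auto
  then have "(\<bar>real_of_int (k $ j)\<bar> powr ?r) powr recip r \<le> vec_norm r k"
    using False by (auto simp: vec_norm_def recip_nonneg intro!: powr_mono2)
  then show ?thesis using r' by (simp add: powr_powr)
qed (simp add: vec_norm_def)

lemma vec_norm_ge_1:
  fixes k :: "int ^ 'd"
  assumes "0 < r" "k \<noteq> 0"
  shows "1 \<le> vec_norm r k"
proof -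
  obtain j where "k $ j \<noteq> 0" using assms(2) by (auto simp: vec_eq_iff)
  then have "1 \<le> \<bar>k $ j\<bar>" by linarith
  then have "1 \<le> \<bar>real_of_int (k $ j)\<bar>" by linarith
  then show ?thesis using component_le_vec_norm[OF assms(1), of k j] by linarith
qed

lemma vec_norm_zero: "0 < r \<Longrightarrow> vec_norm r (0 :: int ^ 'd) = 0"
  using recip_pos_finite[of r] by (simp add: vec_norm_def)

definition lattice_ball :: "ennreal \<Rightarrow> real \<Rightarrow> (int ^ 'd) set" where
  "lattice_ball r t = {k. vec_norm r k \<le> t}"

lemma abs_power_diff_le:
  fixes a b M :: real
  assumes "0 \<le> a" "a \<le> M" "0 \<le> b" "b \<le> M"
  shows "\<bar>a ^ n - b ^ n\<bar> \<le> real n * \<bar>a - b\<bar> * M ^ (n - 1)"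
proof (induction n)
  case (Suc n)
  have M: "0 \<le> M" using assms by linarith
  have "a ^ Suc n - b ^ Suc n = a * (a ^ n - b ^ n) + (a - b) * b ^ n" by (simp add: algebra_simps)
  then have "\<bar>a ^ Suc n - b ^ Suc n\<bar> \<le> \<bar>a * (a ^ n - b ^ n)\<bar> + \<bar>(a - b) * b ^ n\<bar>"
    by (metis abs_triangle_ineq)
  also have "\<dots> = a * \<bar>a ^ n - b ^ n\<bar> + \<bar>a - b\<bar> * b ^ n"
    using assms by (simp add: abs_mult)
  also have "\<dots> \<le> M * (real n * \<bar>a - b\<bar> * M ^ (n - 1)) + \<bar>a - b\<bar> * M ^ n"
    using assms M Suc by (intro add_mono mult_mono mult_left_mono power_mono) auto
  also have "\<dots> = real (Suc n) * \<bar>a - b\<bar> * M ^ (Suc n - 1)"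
    by (cases n) (auto simp: algebra_simps)
  finally show ?case .
qed simp

lemma card_vec_cube:
  fixes A :: "int set"
  assumes "finite A"
  shows "finite {k :: int ^ 'd. \<forall>j. k $ j \<in> A}" "card {k :: int ^ 'd. \<forall>j. k $ j \<in> A} = card A ^ CARD('d)"
proof -
  have "bij_betw vec_nth {k :: int ^ 'd. \<forall>j. k $ j \<in> A} (UNIV \<rightarrow>\<^sub>E A)"
    by (rule bij_betwI[where g = vec_lambda]) (auto simp: PiE_def)
  moreover have "card (UNIV \<rightarrow>\<^sub>E A :: ('d \<Rightarrow> int) set) = card A ^ CARD('d)"
    by (simp add: card_PiE)
  moreover have "finite (UNIV \<rightarrow>\<^sub>E A :: ('d \<Rightarrow> int) set)"
    using assms by (intro finite_PiE) auto
  ultimately show "finite {k :: int ^ 'd. \<forall>j. k $ j \<in> A}" "card {k :: int ^ 'd. \<forall>j. k $ j \<in> A} = card A ^ CARD('d)"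
    by (auto simp: bij_betw_finite bij_betw_same_card)
qed

lemma lattice_ball_infinity:
  assumes "0 \<le> t"
  shows "lattice_ball \<infinity> t = {k :: int ^ 'd. \<forall>j. k $ j \<in> {- \<lfloor>t\<rfloor>..\<lfloor>t\<rfloor>}}"
proof -
  have "\<bar>real_of_int z\<bar> \<le> t \<longleftrightarrow> z \<in> {- \<lfloor>t\<rfloor>..\<lfloor>t\<rfloor>}" for z
    by (auto simp: abs_le_iff le_floor_iff) linarith+
  then show ?thesis
    by (simp add: lattice_ball_def vec_norm_def)
qed

lemma M_const_pos: "0 < M_const r d"
proof -
  have "0 < Gamma (1 + recip r)" "0 < Gamma (1 + real d * recip r)"
    by (intro Gamma_real_pos add_pos_nonneg; simp add: recip_nonneg)+
  then show ?thesis by (simp add: M_const_def)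
qed

lemma card_lattice_ball:
  assumes r: "0 < r"
  obtains C where "0 \<le> C" "\<And>t. 0 \<le> t \<Longrightarrow> finite (lattice_ball r t :: (int ^ 'd) set)"
    "\<And>t. 0 \<le> t \<Longrightarrow> \<bar>real (card (lattice_ball r t :: (int ^ 'd) set)) - M_const r CARD('d) * t ^ CARD('d)\<bar>
      \<le> C * (t + 1) ^ (CARD('d) - 1)"
proof (cases "r = \<infinity>")
  case True
  show ?thesis
  proof (rule that[of "real CARD('d) * 2 ^ (CARD('d) - 1)"])
    fix t :: real assume t: "0 \<le> t"
    note B = lattice_ball_infinity[OF t, where 'd = 'd]
    show "finite (lattice_ball r t :: (int ^ 'd) set)"
      unfolding True B by (rule card_vec_cube) simp
    define a where "a = real (nat (2 * \<lfloor>t\<rfloor> + 1))"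
    have fl: "0 \<le> \<lfloor>t\<rfloor>" using t by simp
    have a_eq: "a = 2 * real_of_int \<lfloor>t\<rfloor> + 1" using fl by (simp add: a_def)
    have "a \<le> 2 * t + 1"
      unfolding a_eq using of_int_floor_le[of t] by linarith
    moreover have "2 * t - 1 \<le> a"
      unfolding a_eq using real_of_int_floor_add_one_gt[of t] by linarith
    moreover have "0 \<le> a" by (simp add: a_def)
    ultimately have a: "0 \<le> a" "a \<le> 2 * (t + 1)" "\<bar>a - 2 * t\<bar> \<le> 1" by auto
    have "card {- \<lfloor>t\<rfloor>..\<lfloor>t\<rfloor>} = nat (2 * \<lfloor>t\<rfloor> + 1)" by simp
    then have card: "real (card (lattice_ball r t :: (int ^ 'd) set)) = a ^ CARD('d)"
      unfolding True B card_vec_cube(2)[OF finite_atLeastAtMost_int] a_def by simp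
    \<comment> \<open>For r = \<infinity> both Gamma factors are Gamma(1), so the constant is the
      volume 2^d of the cube.\<close>
    have M: "M_const r CARD('d) * t ^ CARD('d) = (2 * t) ^ CARD('d)"
      using True by (simp add: M_const_def power_mult_distrib)
    have "\<bar>a ^ CARD('d) - (2 * t) ^ CARD('d)\<bar> \<le> real CARD('d) * \<bar>a - 2 * t\<bar> * (2 * (t + 1)) ^ (CARD('d) - 1)"
      using a t by (intro abs_power_diff_le) auto
    also have "\<dots> \<le> real CARD('d) * 1 * (2 * (t + 1)) ^ (CARD('d) - 1)"
      using a t by (intro mult_right_mono mult_left_mono) auto
    also have "\<dots> = real CARD('d) * 2 ^ (CARD('d) - 1) * (t + 1) ^ (CARD('d) - 1)"
      by (simp only: power_mult_distrib mult.assoc mult_1_right mult_1_left)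
    finally show "\<bar>real (card (lattice_ball r t :: (int ^ 'd) set)) - M_const r CARD('d) * t ^ CARD('d)\<bar>
        \<le> real CARD('d) * 2 ^ (CARD('d) - 1) * (t + 1) ^ (CARD('d) - 1)"
      unfolding card M .
  qed simp
next
  case False
  let ?r = "enn2real r"
  note r' = recip_pos_finite[OF r False]
  have B: "lattice_ball r t = lr_ball_on ?r (UNIV :: 'd set) t" if t: "0 \<le> t" for t
  proof -
    have "s powr (1 / ?r) \<le> t \<longleftrightarrow> s \<le> t powr ?r" if "0 \<le> s" for s
    proof
      assume "s powr (1 / ?r) \<le> t"
      then have "(s powr (1 / ?r)) powr ?r \<le> t powr ?r" using r' by (intro powr_mono2) auto
      then show "s \<le> t powr ?r" using r' that by (simp add: powr_powr)
    next
      assume "s \<le> t powr ?r"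
      then have "s powr (1 / ?r) \<le> (t powr ?r) powr (1 / ?r)" using r' that by (intro powr_mono2) auto
      then show "s powr (1 / ?r) \<le> t" using r' t by (simp add: powr_powr)
    qed
    then show ?thesis
      using False r' by (simp add: lattice_ball_def lr_ball_on_def vec_norm_def sum_nonneg)
  qed
  have M: "lr_volume ?r CARD('d) = M_const r CARD('d)"
    using r' by (simp add: lr_volume_def M_const_def)
  from card_lr_ball_on[OF r'(1), of "UNIV :: 'd set"] obtain C where C: "0 \<le> C"
    "\<And>t. 0 \<le> t \<Longrightarrow> finite (lr_ball_on ?r (UNIV :: 'd set) t)"
    "\<And>t. 0 \<le> t \<Longrightarrow> \<bar>real (card (lr_ball_on ?r (UNIV :: 'd set) t)) - M_const r CARD('d) * t ^ CARD('d)\<bar>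
      \<le> C * (real CARD('d) * (t + 1) ^ (CARD('d) - 1))"
    unfolding M by blast
  show ?thesis
    by (rule that[of "C * real CARD('d)"]) (use C in \<open>auto simp: B mult.assoc\<close>)
qed

lemma finite_lattice_ball: "0 < r \<Longrightarrow> finite (lattice_ball r t :: (int ^ 'd) set)"
proof (cases "0 \<le> t")
  case True
  assume "0 < r"
  then show ?thesis using card_lattice_ball[where 'd = 'd, of r] True by blast
next
  case False
  have "t < vec_norm r k" for k :: "int ^ 'd"
    using False vec_norm_nonneg[of r k] by linarith
  then have "lattice_ball r t = ({} :: (int ^ 'd) set)"
    by (auto simp: lattice_ball_def not_le)
  then show ?thesis by simp
qed

text \<open>Enlarging the radius by \<open>c\<close> adds to M t^d at least M c (t + c)^(d-1), which
  swallows the boundary error for large \<open>c\<close>. All later uses of the count go through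
  such shifts or through shells.\<close>

lemma card_lattice_ball_shift:
  assumes r: "0 < r"
  obtains c where "1 \<le> c"
    "\<And>t. 0 \<le> t \<Longrightarrow> M_const r CARD('d) * t ^ CARD('d) \<le> real (card (lattice_ball r (t + c) :: (int ^ 'd) set))"
    "\<And>t. 0 \<le> t \<Longrightarrow> real (card (lattice_ball r t :: (int ^ 'd) set)) \<le> M_const r CARD('d) * (t + c) ^ CARD('d)"
proof -
  let ?M = "M_const r CARD('d)" and ?d = "CARD('d)"
  let ?V = "\<lambda>t. real (card (lattice_ball r t :: (int ^ 'd) set))"
  obtain C where C: "0 \<le> C" "\<And>t. 0 \<le> t \<Longrightarrow> \<bar>?V t - ?M * t ^ ?d\<bar> \<le> C * (t + 1) ^ (?d - 1)"
    by (rule card_lattice_ball[where 'd = 'd, OF r]) blast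
  obtain e where e: "?d = Suc e" using not0_implies_Suc[of ?d] by auto
  have M: "0 < ?M" by (rule M_const_pos)
  \<comment> \<open>Large enough for both directions: \<open>?M * c\<close> dominates
    \<open>C * 2 ^ e\<close>, where the power of 2 comes from
    \<open>t + c + 1 \<le> 2 * (t + c)\<close>, and \<open>?M * (c - 1)\<close> dominates
    \<open>C\<close>.\<close>
  define c where "c = 1 + C * 2 ^ e / ?M"
  have c: "1 \<le> c" using C M by (simp add: c_def)
  have cM: "C * 2 ^ e \<le> ?M * c" using M by (simp add: c_def distrib_left)
  have cM': "C \<le> ?M * (c - 1)"
    using M C(1) mult_left_mono[of 1 "2 ^ e" C] by (simp add: c_def)
  show ?thesis
  proof (rule that[OF c])
    fix t :: real assume t: "0 \<le> t"
    have "C * (t + c + 1) ^ e \<le> C * (2 * (t + c)) ^ e"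
      using t c C by (intro mult_left_mono power_mono) auto
    also have "\<dots> = C * 2 ^ e * (t + c) ^ e" by (simp only: power_mult_distrib mult.assoc)
    also have "\<dots> \<le> ?M * c * (t + c) ^ e" using cM t c by (intro mult_right_mono) auto
    finally have *: "C * (t + c + 1) ^ e \<le> ?M * c * (t + c) ^ e" .
    have "?M * t ^ ?d \<le> ?M * ((t + c) ^ e * t)"
      unfolding e power_Suc2 using t c less_imp_le[OF M[unfolded e]]
      by (intro mult_left_mono mult_right_mono power_mono) auto
    also have "\<dots> = ?M * (t + c) ^ ?d - ?M * c * (t + c) ^ e"
      unfolding e by (simp add: algebra_simps)
    also have "\<dots> \<le> ?V (t + c)"
      using C(2)[of "t + c"] t c * unfolding e by simp
    finally show "?M * t ^ ?d \<le> ?V (t + c)" .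
    have "?V t \<le> ?M * t ^ ?d + C * (t + 1) ^ e"
      using C(2)[OF t] e by simp
    also have "\<dots> \<le> ?M * ((t + c) ^ e * (t + 1)) + ?M * (c - 1) * (t + c) ^ e"
    proof (intro add_mono mult_left_mono mult_mono)
      show "t ^ ?d \<le> (t + c) ^ e * (t + 1)"
        unfolding e power_Suc2 using t c by (intro mult_mono power_mono) auto
    qed (use t c M C cM' in \<open>auto intro!: power_mono\<close>)
    also have "\<dots> = ?M * (t + c) ^ ?d" unfolding e by (simp add: algebra_simps)
    finally show "?V t \<le> ?M * (t + c) ^ ?d" .
  qed
qed

text \<open>The boundary errors at the two radii have the same order as the volume of the shell, so
  subtracting the two counts is enough for an upper bound.\<close>

lemma card_lattice_shell:
  assumes r: "0 < r"
  obtains C where "0 < C"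
    "\<And>t. 1 \<le> t \<Longrightarrow> real (card (lattice_ball r t - lattice_ball r (t - 1) :: (int ^ 'd) set)) \<le> C * t ^ (CARD('d) - 1)"
proof -
  let ?M = "M_const r CARD('d)" and ?d = "CARD('d)"
  let ?B = "\<lambda>t. lattice_ball r t :: (int ^ 'd) set"
  obtain C where C: "0 \<le> C" "\<And>t. 0 \<le> t \<Longrightarrow> \<bar>real (card (?B t)) - ?M * t ^ ?d\<bar> \<le> C * (t + 1) ^ (?d - 1)"
    by (rule card_lattice_ball[where 'd = 'd, OF r]) blast
  have M: "0 < ?M" by (rule M_const_pos)
  show ?thesis
  proof (rule that)
    show "0 < ?M * real ?d + 2 * (C * 2 ^ (?d - 1))"
      using M C(1) by (intro add_pos_nonneg mult_pos_pos) auto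
    fix t :: real assume t: "1 \<le> t"
    have "?B (t - 1) \<subseteq> ?B t" by (auto simp: lattice_ball_def)
    then have "real (card (?B t - ?B (t - 1))) = real (card (?B t)) - real (card (?B (t - 1)))"
      using finite_lattice_ball[OF r, where 'd = 'd] by (simp add: card_Diff_subset card_mono of_nat_diff)
    also have "\<dots> \<le> (?M * t ^ ?d + C * (t + 1) ^ (?d - 1)) - (?M * (t - 1) ^ ?d - C * (t - 1 + 1) ^ (?d - 1))"
      using C(2)[of t] C(2)[of "t - 1"] t by (simp add: abs_le_iff)
    also have "\<dots> = ?M * (t ^ ?d - (t - 1) ^ ?d) + C * (t + 1) ^ (?d - 1) + C * t ^ (?d - 1)"
      by (simp add: algebra_simps)
    also have "\<dots> \<le> ?M * (real ?d * t ^ (?d - 1)) + C * (2 * t) ^ (?d - 1) + C * (2 * t) ^ (?d - 1)"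
    proof (intro add_mono mult_left_mono power_mono)
      have "t ^ ?d - (t - 1) ^ ?d \<le> \<bar>t ^ ?d - (t - 1) ^ ?d\<bar>" by simp
      also have "\<dots> \<le> real ?d * \<bar>t - (t - 1)\<bar> * t ^ (?d - 1)"
        using t by (intro abs_power_diff_le) auto
      finally show "t ^ ?d - (t - 1) ^ ?d \<le> real ?d * t ^ (?d - 1)" by simp
    qed (use t M C in auto)
    also have "\<dots> = (?M * real ?d + 2 * (C * 2 ^ (?d - 1))) * t ^ (?d - 1)"
      by (simp only: power_mult_distrib) (simp add: algebra_simps)
    finally show "real (card (?B t - ?B (t - 1))) \<le> (?M * real ?d + 2 * (C * 2 ^ (?d - 1))) * t ^ (?d - 1)" .
  qed
qed

section \<open>The weight function\<close>

lemma slope_commute: "(a - b) / (c - d) = (b - a) / (d - c)" for a b c d :: real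
  by (metis minus_diff_eq minus_divide_divide)

text \<open>By convexity the slopes of the chords starting at \<open>t\<close> decrease as the other
  endpoint approaches \<open>t\<close>, so their limit exists in \<open>ereal\<close> and is their
  infimum.\<close>

lemma right_deriv_eq_INF:
  assumes "convex_on {1..} \<psi>" "1 \<le> t"
  shows "right_deriv \<psi> t = (INF s\<in>{t<..}. ereal ((\<psi> s - \<psi> t) / (s - t)))"
proof -
  let ?S = "\<lambda>s. ereal ((\<psi> s - \<psi> t) / (s - t))"
  have mono: "?S s \<le> ?S s'" if "t < s" "s < s'" for s s'
    using convex_on_slope_le(1)[OF assms(1), of t s' s] assms(2) that
    by (simp add: slope_commute[of "\<psi> t" "\<psi> s" t s] slope_commute[of "\<psi> t" "\<psi> s'" t s'])
  have "(?S \<longlongrightarrow> (INF s\<in>{t<..}. ?S s)) (at_right t)"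
  proof (rule order_tendstoI)
    fix a assume "a < (INF s\<in>{t<..}. ?S s)"
    then have "a < ?S s" if "t < s" for s
      using that by (auto elim!: less_le_trans intro!: INF_lower)
    then show "\<forall>\<^sub>F s in at_right t. a < ?S s"
      by (auto simp: eventually_at_filter)
  next
    fix a assume "(INF s\<in>{t<..}. ?S s) < a"
    then obtain s0 where s0: "t < s0" "?S s0 < a" by (auto simp: INF_less_iff)
    have "?S s < a" if "t < s" "s < s0" for s
      using le_less_trans[OF mono[OF that] s0(2)] .
    then show "\<forall>\<^sub>F s in at_right t. ?S s < a"
      using s0(1) unfolding eventually_at_right[OF s0(1)] by blast
  qed
  then show ?thesis
    unfolding right_deriv_def by (intro tendsto_Lim) auto
qed

text \<open>With \<open>Q = quot \<psi>\<close> this records all that is needed of the two classes; \<open>Q_supp\<close> says that the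
  tangent with slope \<open>-\<psi> t / Q t\<close> supports \<open>\<psi>\<close> from below.\<close>

locale rapid_decay =
  fixes \<psi> Q :: "real \<Rightarrow> real" and K :: real
  assumes psi_pos: "1 \<le> t \<Longrightarrow> 0 < \<psi> t"
    and psi_antimono: "1 \<le> s \<Longrightarrow> s \<le> t \<Longrightarrow> \<psi> t \<le> \<psi> s"
    and Q_pos: "1 \<le> t \<Longrightarrow> 0 < Q t"
    and Q_supp: "1 \<le> s \<Longrightarrow> 1 \<le> t \<Longrightarrow> \<psi> t * (1 - (s - t) / Q t) \<le> \<psi> s"
    and Q_ratio: "1 \<le> s \<Longrightarrow> s \<le> t \<Longrightarrow> Q t / t \<le> Q s / s"
    and Q_lim: "((\<lambda>t. Q t / t) \<longlongrightarrow> 0) at_top"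
    and K_ge_1: "1 \<le> K"
    and Q_quasi_mono: "1 \<le> s \<Longrightarrow> s \<le> t \<Longrightarrow> Q s \<le> K * Q t"

text \<open>Once a convex function has gone up, its chords cannot descend below the old value again,
  as the limit 0 would demand.\<close>

lemma class_M_antimono:
  assumes "\<psi> \<in> class_M" "1 \<le> s" "s \<le> t"
  shows "\<psi> t \<le> \<psi> s"
proof (rule ccontr)
  assume "\<not> \<psi> t \<le> \<psi> s"
  then have lt: "\<psi> s < \<psi> t" and st: "s < t" using assms(3) by (auto simp: le_less)
  have conv: "convex_on {1..} \<psi>" and pos: "0 < \<psi> s" and lim: "(\<psi> \<longlongrightarrow> 0) at_top"
    using assms by (auto simp: class_M_def)
  have "\<forall>\<^sub>F u in at_top. \<psi> u < \<psi> s \<and> t < u"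
    using order_tendstoD(2)[OF lim pos] eventually_gt_at_top by (rule eventually_conj)
  then obtain u where u: "\<psi> u < \<psi> s" "t < u"
    using eventually_happens'[OF trivial_limit_at_top_linorder] by blast
  have "(\<psi> s - \<psi> t) / (s - t) \<le> (\<psi> s - \<psi> u) / (s - u)"
    using conv assms(2) st u by (intro convex_on_slope_le(1)[of "{1..}"]) auto
  moreover have "0 < (\<psi> s - \<psi> t) / (s - t)" using lt st by (intro divide_neg_neg) auto
  moreover have "(\<psi> s - \<psi> u) / (s - u) < 0" using u st by (intro divide_pos_neg) auto
  ultimately show False by linarith
qed

text \<open>The right derivative lies between the slopes of the chords to the left and to the right.
  The limit 0 supplies a descending right chord, and for \<open>t > 1\<close> a left chord excludes
  the value \<open>-\<infinity>\<close>.\<close>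

lemma class_M_right_deriv:
  assumes "\<psi> \<in> class_M" "1 \<le> t"
  shows "right_deriv \<psi> t < 0"
    and "1 < t \<Longrightarrow> right_deriv \<psi> t \<noteq> -\<infinity>"
    and "right_deriv \<psi> t = ereal D \<Longrightarrow> 1 \<le> s \<Longrightarrow> \<psi> t + D * (s - t) \<le> \<psi> s"
proof -
  have conv: "convex_on {1..} \<psi>" and pos: "0 < \<psi> t" and lim: "(\<psi> \<longlongrightarrow> 0) at_top"
    using assms by (auto simp: class_M_def)
  note R = right_deriv_eq_INF[OF conv assms(2)]
  have "\<forall>\<^sub>F u in at_top. \<psi> u < \<psi> t \<and> t < u"
    using order_tendstoD(2)[OF lim pos] eventually_gt_at_top by (rule eventually_conj)
  then obtain u where u: "\<psi> u < \<psi> t" "t < u"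
    using eventually_happens'[OF trivial_limit_at_top_linorder] by blast
  show "right_deriv \<psi> t < 0"
    unfolding R INF_less_iff using u by (intro bexI[of _ u]) (auto simp: divide_neg_pos)
  have left: "ereal ((\<psi> s - \<psi> t) / (s - t)) \<le> right_deriv \<psi> t" if s: "1 \<le> s" "s < t" for s
    unfolding R
  proof (rule INF_greatest)
    fix u assume "u \<in> {t<..}"
    then have "(\<psi> s - \<psi> t) / (s - t) \<le> (\<psi> s - \<psi> u) / (s - u)"
       "(\<psi> s - \<psi> u) / (s - u) \<le> (\<psi> t - \<psi> u) / (t - u)"
      using conv s by (auto intro!: convex_on_slope_le[of "{1..}"])
    then show "ereal ((\<psi> s - \<psi> t) / (s - t)) \<le> ereal ((\<psi> u - \<psi> t) / (u - t))"
      by (simp add: slope_commute[of "\<psi> t" "\<psi> u" t u])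
  qed
  show "right_deriv \<psi> t \<noteq> -\<infinity>" if "1 < t"
    using left[of 1] that by auto
  show "\<psi> t + D * (s - t) \<le> \<psi> s" if D: "right_deriv \<psi> t = ereal D" and s: "1 \<le> s"
  proof (cases s t rule: linorder_cases)
    case less
    then have "(\<psi> s - \<psi> t) / (s - t) \<le> D" using left[OF s] D by simp
    then have "D * (s - t) \<le> \<psi> s - \<psi> t"
      using less by (simp add: neg_divide_le_eq)
    then show ?thesis by simp
  next
    case greater
    then have "right_deriv \<psi> t \<le> ereal ((\<psi> s - \<psi> t) / (s - t))"
      unfolding R by (intro INF_lower) auto
    then have "D * (s - t) \<le> \<psi> s - \<psi> t"
      using greater D by (simp add: pos_le_divide_eq)
    then show ?thesis by simp
  qed simp
qed

text \<open>An infinite slope at 1 is covered too: both sides are then 0.\<close>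

lemma alpha_eq_quot:
  assumes "\<psi> \<in> class_M" "1 \<le> t"
  shows "alpha \<psi> t = quot \<psi> t / t"
proof -
  have "right_deriv \<psi> t < 0" using class_M_right_deriv(1)[OF assms] .
  then show ?thesis
    using assms(2) by (cases "right_deriv \<psi> t") (auto simp: alpha_def quot_def divide_simps)
qed

text \<open>The two classes are distinguished only here: \<open>K\<close> is 1 if the quotient
  increases, and \<open>K5 / K4\<close> if it lies between two constants.\<close>

lemma rapid_decay_quot:
  assumes "\<psi> \<in> class_M_inf' \<union> class_M_inf_c"
  obtains K where "rapid_decay \<psi> (quot \<psi>) K"
proof -
  have M: "\<psi> \<in> class_M" and anti: "antimono_on {1..} (alpha \<psi>)" and lim: "(alpha \<psi> \<longlongrightarrow> 0) at_top"
    using assms by (auto simp: class_M_inf'_def class_M_inf_c_def)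
  have pos: "0 < \<psi> t" if "1 \<le> t" for t using M that by (auto simp: class_M_def)
  have fin: "\<exists>D<0. right_deriv \<psi> t = ereal D" if t: "1 < t" for t
    using class_M_right_deriv(1,2)[OF M, of t] t by (cases "right_deriv \<psi> t") auto
  have "0 < alpha \<psi> 2"
    using fin[of 2] pos[of 2] by (auto simp: alpha_def divide_pos_neg)
  \<comment> \<open>An infinite slope at 1 would give \<open>alpha \<psi> 1 = 0 < alpha \<psi> 2\<close>.\<close>
  also have "alpha \<psi> 2 \<le> alpha \<psi> 1"
    using anti by (auto simp: monotone_on_def)
  finally have "right_deriv \<psi> 1 \<noteq> -\<infinity>" by (auto simp: alpha_def)
  then have fin1: "\<exists>D<0. right_deriv \<psi> t = ereal D" if t: "1 \<le> t" for t
    using fin[of t] class_M_right_deriv(1)[OF M, of 1] t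
    by (cases "t = 1"; cases "right_deriv \<psi> 1") auto
  have Qpos: "0 < quot \<psi> t" if t: "1 \<le> t" for t
    using fin1[OF t] pos[OF t] by (auto simp: quot_def divide_pos_neg)
  obtain K where K: "1 \<le> K" "\<And>s t. 1 \<le> s \<Longrightarrow> s \<le> t \<Longrightarrow> quot \<psi> s \<le> K * quot \<psi> t"
  proof (cases "\<psi> \<in> class_M_inf'")
    case True
    then show ?thesis by (intro that[of 1]) (auto simp: class_M_inf'_def monotone_on_def)
  next
    case False
    with assms obtain K4 K5 where K: "0 < K4" "0 < K5" "\<And>t. 1 \<le> t \<Longrightarrow> K4 \<le> quot \<psi> t"
      "\<And>t. 1 \<le> t \<Longrightarrow> quot \<psi> t \<le> K5"
      by (auto simp: class_M_inf_c_def)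
    show ?thesis
    proof (rule that[of "K5 / K4"])
      show "1 \<le> K5 / K4" using K(1) order_trans[OF K(3,4), of 1] by simp
      fix s t :: real assume st: "1 \<le> s" "s \<le> t"
      have "quot \<psi> s \<le> K5 / K4 * K4" using K st by simp
      also have "\<dots> \<le> K5 / K4 * quot \<psi> t" using K st by (intro mult_left_mono) auto
      finally show "quot \<psi> s \<le> K5 / K4 * quot \<psi> t" .
    qed
  qed
  have "rapid_decay \<psi> (quot \<psi>) K"
  proof
    show "\<psi> t * (1 - (s - t) / quot \<psi> t) \<le> \<psi> s" if "1 \<le> s" "1 \<le> t" for s t
    proof -
      obtain D where D: "D < 0" "right_deriv \<psi> t = ereal D" using fin1 \<open>1 \<le> t\<close> by blast
      have "\<psi> t / quot \<psi> t = - D" using D pos[OF \<open>1 \<le> t\<close>] by (simp add: quot_def)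
      moreover have "\<psi> t * (1 - (s - t) / quot \<psi> t) = \<psi> t - (s - t) * (\<psi> t / quot \<psi> t)"
        by (simp add: algebra_simps)
      ultimately have "\<psi> t * (1 - (s - t) / quot \<psi> t) = \<psi> t + D * (s - t)"
        by (simp add: algebra_simps)
      then show ?thesis using class_M_right_deriv(3)[OF M \<open>1 \<le> t\<close> D(2) \<open>1 \<le> s\<close>] by simp
    qed
    show "quot \<psi> t / t \<le> quot \<psi> s / s" if "1 \<le> s" "s \<le> t" for s t
      using anti that by (simp add: monotone_on_def alpha_eq_quot[OF M, symmetric])
    show "((\<lambda>t. quot \<psi> t / t) \<longlongrightarrow> 0) at_top"
      using lim by (rule Lim_transform_eventually)
        (use eventually_ge_at_top[of 1] in eventually_elim, simp add: alpha_eq_quot[OF M])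
  qed (fact pos Qpos K class_M_antimono[OF M])+
  then show ?thesis by (rule that)
qed

section \<open>Local and global decay of the weight\<close>

context rapid_decay
begin

lemma Q_lower: "1 \<le> t \<Longrightarrow> Q 1 / K \<le> Q t"
  using Q_quasi_mono[of 1 t] K_ge_1 by (simp add: divide_simps mult.commute)

lemma Q_upper: "1 \<le> s \<Longrightarrow> s \<le> t \<Longrightarrow> Q t \<le> t / s * Q s"
  using Q_ratio[of s t] by (simp add: divide_simps mult.commute split: if_splits)

text \<open>The step \<open>Q s / (2 * K)\<close> is at most half of \<open>Q v\<close> at every
  later point \<open>v\<close>, so the tangent at \<open>v\<close> loses at most a factor 2 along
  it.\<close>

lemma psi_shift_steps:
  assumes s: "1 \<le> s" and x: "0 \<le> x" "x \<le> real N * (Q s / (2 * K))"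
  shows "\<psi> s \<le> 2 ^ N * \<psi> (s + x)"
  using x
proof (induction N arbitrary: x)
  case 0
  then show ?case by simp
next
  case (Suc N)
  define h where "h = Q s / (2 * K)"
  have h: "0 \<le> h" using Q_pos[OF s] K_ge_1 by (simp add: h_def)
  show ?case
  proof (cases "x \<le> real N * h")
    case True
    then have "\<psi> s \<le> 2 ^ N * \<psi> (s + x)" using Suc by (simp add: h_def)
    moreover have "0 < 2 ^ N * \<psi> (s + x)" using psi_pos s Suc.prems by simp
    ultimately show ?thesis unfolding power_Suc mult.assoc by linarith
  next
    case False
    define v where "v = s + real N * h"
    have "0 \<le> real N * h" using h by simp
    then have v: "1 \<le> v" "s \<le> v" using s unfolding v_def by linarith+
    have y: "0 \<le> s + x - v" "s + x - v \<le> h" using False Suc.prems(2)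
      by (auto simp: v_def h_def[symmetric] distrib_right)
    have "h \<le> Q v / 2"
      using Q_quasi_mono[OF s v(2)] K_ge_1 by (simp add: h_def divide_simps mult.commute)
    then have "1 / 2 \<le> 1 - (s + x - v) / Q v"
      using y Q_pos[OF v(1)] by (simp add: divide_simps)
    then have "\<psi> v * (1 / 2) \<le> \<psi> v * (1 - (s + x - v) / Q v)"
      using psi_pos[OF v(1)] by (intro mult_left_mono) auto
    also have "\<dots> \<le> \<psi> (s + x)"
      using v Suc.prems s by (intro Q_supp) auto
    finally have "\<psi> v \<le> 2 * \<psi> (s + x)" by simp
    moreover have "\<psi> s \<le> 2 ^ N * \<psi> v"
      unfolding v_def by (rule Suc.IH) (use h in \<open>auto simp: h_def[symmetric]\<close>)
    ultimately have "\<psi> s \<le> 2 ^ N * (2 * \<psi> (s + x))"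
      by (meson mult_left_mono order_trans zero_le_numeral zero_le_power)
    then show ?thesis by simp
  qed
qed

lemma psi_shift:
  obtains C :: real where "1 \<le> C" "\<And>s x. 1 \<le> s \<Longrightarrow> 0 \<le> x \<Longrightarrow> x \<le> B * Q s \<Longrightarrow> \<psi> s \<le> C * \<psi> (s + x)"
proof
  define N where "N = nat \<lceil>2 * K * B\<rceil>"
  show "(1 :: real) \<le> 2 ^ N" by simp
  fix s x :: real assume s: "1 \<le> s" "0 \<le> x" "x \<le> B * Q s"
  have "B * Q s = 2 * K * B * (Q s / (2 * K))" using K_ge_1 by simp
  also have "\<dots> \<le> real N * (Q s / (2 * K))"
    using K_ge_1 Q_pos[OF s(1)] real_nat_ceiling_ge[of "2 * K * B"]
    by (intro mult_right_mono) (auto simp: N_def)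
  finally show "\<psi> s \<le> 2 ^ N * \<psi> (s + x)" using s by (intro psi_shift_steps) auto
qed

text \<open>As \<open>Q\<close> is bounded below by \<open>Q 1 / K\<close>, a bounded distance is a
  bounded multiple of \<open>Q s\<close>. This makes the shifts from lattice point counting
  harmless.\<close>

lemma psi_shift_const:
  obtains C where "1 \<le> C" "\<And>s x. 1 \<le> s \<Longrightarrow> 0 \<le> x \<Longrightarrow> x \<le> c \<Longrightarrow> \<psi> s \<le> C * \<psi> (s + x)"
proof -
  obtain C where C: "1 \<le> C"
    "\<And>s x. 1 \<le> s \<Longrightarrow> 0 \<le> x \<Longrightarrow> x \<le> c * K / Q 1 * Q s \<Longrightarrow> \<psi> s \<le> C * \<psi> (s + x)"
    using psi_shift[of "c * K / Q 1"] by blast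
  show ?thesis
  proof (rule that[OF C(1)])
    fix s x :: real assume s: "1 \<le> s" "0 \<le> x" "x \<le> c"
    have "c = c * K / Q 1 * (Q 1 / K)" using Q_pos[of 1] K_ge_1 by simp
    also have "\<dots> \<le> c * K / Q 1 * Q s"
      using s Q_lower[OF s(1)] Q_pos[of 1] K_ge_1 by (intro mult_left_mono) auto
    finally show "\<psi> s \<le> C * \<psi> (s + x)" using s by (intro C(2)) auto
  qed
qed

text \<open>A discrete form of the fact that \<psi>^\<sigma> has derivative -\<sigma>
  \<psi>^\<sigma> / Q. The tangent at \<open>u + 1\<close>, evaluated at \<open>u\<close>, gives a
  factor \<open>1 + 1 / Q (u + 1)\<close>; as \<open>1 / Q\<close> is bounded, its power \<sigma>
  can be linearised uniformly.\<close>

lemma psi_powr_unit_step: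
  assumes "0 < \<sigma>"
  obtains c where "0 < c"
    "\<And>u. 1 \<le> u \<Longrightarrow> \<psi> (u + 1) powr \<sigma> \<le> \<psi> u powr \<sigma> * (1 - c / Q (u + 1))"
proof
  define X where "X = K / Q 1"
  have X: "0 < X" using K_ge_1 Q_pos[of 1] by (simp add: X_def)
  \<comment> \<open>The factor \<open>1 + X\<close> comes from
    \<open>ln (1 + x) \<ge> x / (1 + x)\<close>, the factor \<open>1 + \<sigma> * X\<close> from
    writing \<open>1 / (1 + y)\<close> as \<open>1 - y / (1 + y)\<close>.\<close>
  define c where "c = \<sigma> / ((1 + X) * (1 + \<sigma> * X))"
  show "0 < c" using X assms by (auto simp: c_def intro!: divide_pos_pos mult_pos_pos add_pos_pos)
  fix u :: real assume u: "1 \<le> u"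
  define x where "x = 1 / Q (u + 1)"
  have x: "0 < x" "x \<le> X"
    using Q_pos[of "u + 1"] Q_lower[of "u + 1"] u Q_pos[of 1] K_ge_1
    by (auto simp: x_def X_def divide_simps mult.commute split: if_splits)
  have pu: "0 < \<psi> u" "0 < \<psi> (u + 1)" using psi_pos u by auto
  define y where "y = \<sigma> * x / (1 + X)"
  have y: "0 < y" "y \<le> \<sigma> * X"
  proof -
    show "0 < y" using x X assms by (simp add: y_def)
    have "y \<le> \<sigma> * x / 1" unfolding y_def using x X assms by (intro divide_left_mono) auto
    also have "\<dots> \<le> \<sigma> * X" using x assms by simp
    finally show "y \<le> \<sigma> * X" .
  qed
  have "x / (1 + X) \<le> x / (1 + x)" using x by (intro divide_left_mono) auto
  also have "\<dots> = 1 - 1 / (1 + x)" using x by (simp add: divide_simps)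
  also have "\<dots> \<le> ln (1 + x)"
    using ln_le_minus_one[of "1 / (1 + x)"] x by (simp add: ln_div)
  finally have "\<sigma> * (x / (1 + X)) \<le> \<sigma> * ln (1 + x)" using assms by (intro mult_left_mono) auto
  then have lnx: "y \<le> \<sigma> * ln (1 + x)" by (simp add: y_def)
  have "\<psi> (u + 1) * (1 + x) \<le> \<psi> u"
    using Q_supp[of u "u + 1"] u by (simp add: x_def)
  then have "(\<psi> (u + 1) * (1 + x)) powr \<sigma> \<le> \<psi> u powr \<sigma>"
    using pu x assms by (intro powr_mono2) auto
  then have "\<psi> (u + 1) powr \<sigma> * (1 + x) powr \<sigma> \<le> \<psi> u powr \<sigma>"
    using pu x by (simp add: powr_mult)
  moreover have "1 + y \<le> (1 + x) powr \<sigma>"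
    using order_trans[OF add_left_mono[OF lnx, of 1] exp_ge_add_one_self] x by (simp add: powr_def)
  ultimately have "\<psi> (u + 1) powr \<sigma> * (1 + y) \<le> \<psi> u powr \<sigma>"
    by (meson mult_left_mono order_trans powr_ge_zero)
  then have "\<psi> (u + 1) powr \<sigma> \<le> \<psi> u powr \<sigma> * (1 / (1 + y))"
    using y by (simp add: divide_simps)
  also have "\<dots> \<le> \<psi> u powr \<sigma> * (1 - c / Q (u + 1))"
  proof (intro mult_left_mono)
    have "c / Q (u + 1) = y / (1 + \<sigma> * X)"
      by (simp add: c_def y_def x_def)
    also have "\<dots> \<le> y / (1 + y)" using y by (intro divide_left_mono) auto
    finally have "c / Q (u + 1) \<le> y / (1 + y)" .
    moreover have "1 / (1 + y) = 1 - y / (1 + y)" using y by (simp add: divide_simps)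
    ultimately show "1 / (1 + y) \<le> 1 - c / Q (u + 1)" by linarith
  qed simp
  finally show "\<psi> (u + 1) powr \<sigma> \<le> \<psi> u powr \<sigma> * (1 - c / Q (u + 1))" .
qed

text \<open>The tangent at \<open>2 * t\<close>, evaluated at \<open>t\<close>, gains the factor
  \<open>1 + t / Q (2 * t)\<close>, which tends to infinity because \<open>Q t / t\<close> tends to
  0.\<close>

lemma psi_doubling:
  assumes "0 < \<epsilon>"
  obtains n0 where "1 \<le> n0" "\<And>t. n0 \<le> t \<Longrightarrow> \<psi> (2 * t) \<le> \<epsilon> * \<psi> t"
proof -
  have "\<forall>\<^sub>F t in at_top. Q t / t < \<epsilon> / 2"
    using order_tendstoD(2)[OF Q_lim, of "\<epsilon> / 2"] assms by simp
  then obtain N where N: "\<And>t. N \<le> t \<Longrightarrow> Q t / t < \<epsilon> / 2"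
    by (auto simp: eventually_at_top_linorder)
  show ?thesis
  proof (rule that[of "max 1 N"])
    fix t assume "max 1 N \<le> t"
    then have t: "1 \<le> t" "N \<le> 2 * t" by auto
    then have Qt: "0 < Q (2 * t)" "Q (2 * t) < \<epsilon> * t"
      using N[of "2 * t"] Q_pos[of "2 * t"] by (auto simp: divide_simps)
    have pt: "0 < \<psi> (2 * t)" using psi_pos t by simp
    have "1 / \<epsilon> \<le> t / Q (2 * t)"
      using Qt assms t by (simp add: divide_simps mult.commute)
    then have "\<psi> (2 * t) * (1 / \<epsilon>) \<le> \<psi> (2 * t) * (1 + t / Q (2 * t))"
      using pt by (intro mult_left_mono) auto
    also have "\<dots> = \<psi> (2 * t) * (1 - (t - 2 * t) / Q (2 * t))" by simp
    also have "\<dots> \<le> \<psi> t" by (rule Q_supp) (use t in auto)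
    finally show "\<psi> (2 * t) \<le> \<epsilon> * \<psi> t" using assms by (simp add: divide_simps mult.commute)
  qed simp
qed

text \<open>Decay faster than any power, in a form uniform in the starting point. Beyond
  \<open>n0\<close> each doubling of the argument beats the factor 2^d; before \<open>n0\<close> the
  polynomial factor is bounded.\<close>

lemma psi_powr_poly:
  assumes "0 < \<sigma>"
  obtains C where "1 \<le> C"
    "\<And>t u. 1 \<le> t \<Longrightarrow> t \<le> u \<Longrightarrow> u ^ d * \<psi> u powr \<sigma> \<le> C * (t ^ d * \<psi> t powr \<sigma>)"
proof -
  define \<epsilon> where "\<epsilon> = (1 / 2 ^ d) powr (1 / \<sigma>)"
  have \<epsilon>: "0 < \<epsilon>" "\<epsilon> powr \<sigma> = 1 / 2 ^ d" using assms by (auto simp: \<epsilon>_def powr_powr)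
  obtain n0 where n0: "1 \<le> n0" "\<And>t. n0 \<le> t \<Longrightarrow> \<psi> (2 * t) \<le> \<epsilon> * \<psi> t"
    using psi_doubling[OF \<epsilon>(1)] by blast
  have anti: "\<psi> u powr \<sigma> \<le> \<psi> t powr \<sigma>" if "1 \<le> t" "t \<le> u" for t u
    using psi_antimono[OF that] psi_pos[of u] that assms by (intro powr_mono2) auto
  have dbl: "(2 * t) ^ d * \<psi> (2 * t) powr \<sigma> \<le> t ^ d * \<psi> t powr \<sigma>" if t: "n0 \<le> t" for t
  proof -
    have "\<psi> (2 * t) powr \<sigma> \<le> (\<epsilon> * \<psi> t) powr \<sigma>"
      using n0 t psi_pos[of "2 * t"] assms by (intro powr_mono2) auto
    also have "\<dots> = 1 / 2 ^ d * \<psi> t powr \<sigma>"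
      using \<epsilon> psi_pos[of t] n0 t by (simp add: powr_mult)
    finally have "(2 * t) ^ d * \<psi> (2 * t) powr \<sigma> \<le> (2 * t) ^ d * (1 / 2 ^ d * \<psi> t powr \<sigma>)"
      using n0 t by (intro mult_left_mono) auto
    then show ?thesis by (simp add: power_mult_distrib)
  qed
  \<comment> \<open>Halving \<open>u\<close> loses nothing; only the last incomplete block, with
    \<open>u \<le> 2 * t\<close>, costs the factor \<open>2 ^ d\<close>.\<close>
  have far: "u ^ d * \<psi> u powr \<sigma> \<le> 2 ^ d * (t ^ d * \<psi> t powr \<sigma>)"
    if "n0 \<le> t" "t \<le> u" "u \<le> 2 ^ i * t" for i t u
    using that
  proof (induction i arbitrary: u)
    case 0
    then have "u = t" by simp
    moreover have "1 * (t ^ d * \<psi> t powr \<sigma>) \<le> 2 ^ d * (t ^ d * \<psi> t powr \<sigma>)"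
      using n0 0 by (intro mult_right_mono) auto
    ultimately show ?case by simp
  next
    case (Suc i)
    show ?case
    proof (cases "u \<le> 2 * t")
      case True
      have "u ^ d * \<psi> u powr \<sigma> \<le> (2 * t) ^ d * \<psi> t powr \<sigma>"
        using True Suc.prems n0 anti[of t u] by (intro mult_mono power_mono) auto
      then show ?thesis by (simp add: power_mult_distrib)
    next
      case False
      then have "u ^ d * \<psi> u powr \<sigma> \<le> (u / 2) ^ d * \<psi> (u / 2) powr \<sigma>"
        using dbl[of "u / 2"] Suc.prems by simp
      also have "\<dots> \<le> 2 ^ d * (t ^ d * \<psi> t powr \<sigma>)"
        using Suc False by (intro Suc.IH) auto
      finally show ?thesis .
    qed
  qed
  have far': "u ^ d * \<psi> u powr \<sigma> \<le> 2 ^ d * (t ^ d * \<psi> t powr \<sigma>)" if t: "n0 \<le> t" "t \<le> u" for t u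
  proof -
    obtain i where "u / t < 2 ^ i" using real_arch_pow[of 2 "u / t"] by auto
    then show ?thesis using t n0 by (intro far[of t u i]) (auto simp: divide_simps split: if_splits)
  qed
  show ?thesis
  proof (rule that[of "2 ^ d * n0 ^ d"])
    show "1 \<le> 2 ^ d * n0 ^ d" using n0 mult_mono[of 1 "2 ^ d" 1 "n0 ^ d"]
      by simp
    fix t u :: real assume t: "1 \<le> t" "t \<le> u"
    have nonneg: "0 \<le> t ^ d * \<psi> t powr \<sigma>" using t by simp
    have n0d: "1 \<le> n0 ^ d" using n0 by simp
    show "u ^ d * \<psi> u powr \<sigma> \<le> 2 ^ d * n0 ^ d * (t ^ d * \<psi> t powr \<sigma>)"
    proof (cases "n0 \<le> t")
      case True
      then have "u ^ d * \<psi> u powr \<sigma> \<le> 2 ^ d * (t ^ d * \<psi> t powr \<sigma>)" using t by (intro far')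
      also have "\<dots> \<le> n0 ^ d * (2 ^ d * (t ^ d * \<psi> t powr \<sigma>))"
        using mult_right_mono[OF n0d, of "2 ^ d * (t ^ d * \<psi> t powr \<sigma>)"] nonneg by simp
      finally show ?thesis by (simp add: mult_ac)
    next
      case False
      have near: "v ^ d * \<psi> v powr \<sigma> \<le> n0 ^ d * (t ^ d * \<psi> t powr \<sigma>)" if "t \<le> v" "v \<le> n0" for v
      proof -
        have "v ^ d * \<psi> v powr \<sigma> \<le> n0 ^ d * (1 * \<psi> t powr \<sigma>)"
          using that t anti[of t v] by (simp, intro mult_mono power_mono) auto
        also have "\<dots> \<le> n0 ^ d * (t ^ d * \<psi> t powr \<sigma>)"
          using t n0 by (intro mult_left_mono mult_right_mono) auto
        finally show ?thesis .
      qed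
      show ?thesis
      proof (cases "u \<le> n0")
        case True
        have "u ^ d * \<psi> u powr \<sigma> \<le> n0 ^ d * (t ^ d * \<psi> t powr \<sigma>)" using near t True by simp
        also have "\<dots> \<le> 2 ^ d * (n0 ^ d * (t ^ d * \<psi> t powr \<sigma>))"
          using mult_right_mono[of 1 "2 ^ d :: real" "n0 ^ d * (t ^ d * \<psi> t powr \<sigma>)"] nonneg n0 by simp
        finally show ?thesis by (simp add: mult_ac)
      next
        case F: False
        have "u ^ d * \<psi> u powr \<sigma> \<le> 2 ^ d * (n0 ^ d * \<psi> n0 powr \<sigma>)" using F by (intro far') auto
        also have "\<dots> \<le> 2 ^ d * (n0 ^ d * (t ^ d * \<psi> t powr \<sigma>))"
          using near[of n0] False by (intro mult_left_mono[where c = "2 ^ d"]) auto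
        finally show ?thesis by (simp add: mult_ac)
      qed
    qed
  qed
qed

end

section \<open>Widths in terms of coefficient sequences\<close>

lemma exists_superset_card:
  assumes "infinite (UNIV :: 'a set)" "finite (A :: 'a set)" "card A \<le> m"
  obtains B where "A \<subseteq> B" "finite B" "card B = m"
proof -
  obtain D where D: "finite D" "card D = m - card A" "D \<subseteq> - A"
    using infinite_arbitrarily_large[of "- A" "m - card A"] assms by auto
  show ?thesis
  proof (rule that[of "A \<union> D"])
    show "card (A \<union> D) = m" using D assms by (subst card_Un_disjoint) auto
  qed (use D assms in auto)
qed

lemma infinite_int_vec: "infinite (UNIV :: (int ^ 'd) set)"
proof
  assume "finite (UNIV :: (int ^ 'd) set)"
  then have "finite (range (\<lambda>z. vec z :: int ^ 'd))" by (rule finite_subset[rotated]) simp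
  moreover have "inj (\<lambda>z. vec z :: int ^ 'd)" by (auto simp: inj_def vec_eq_iff)
  ultimately show False using finite_imageD infinite_UNIV_int by blast
qed

text \<open>A member of \<open>Gamma_sets m\<close> has exactly \<open>m\<close> elements, so
  smaller sets of frequencies are padded; the lattice is infinite.\<close>

lemma Gamma_sets_superset:
  assumes "finite (A :: (int ^ 'd) set)" "card A \<le> m"
  obtains \<gamma> where "A \<subseteq> \<gamma>" "\<gamma> \<in> Gamma_sets m"
  using exists_superset_card[OF infinite_int_vec assms] by (auto simp: Gamma_sets_def)

lemma basis_width_le:
  assumes "\<gamma> \<in> Gamma_sets m" "N \<subseteq> L1"
    and "\<And>f. f \<in> N \<Longrightarrow> lp_norm p (\<lambda>k. if k \<in> \<gamma> then 0 else fourier f k) \<le> B"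
  shows "basis_width p m N \<le> B"
  unfolding basis_width_def
  by (rule INF_lower2[OF assms(1)], rule SUP_least)
    (use assms in \<open>auto simp: best_approx_eq Gamma_sets_def subset_iff\<close>)

lemma best_m_term_le:
  assumes "N \<subseteq> L1"
    and "\<And>f. f \<in> N \<Longrightarrow> \<exists>\<gamma>\<in>Gamma_sets m. lp_norm p (\<lambda>k. if k \<in> \<gamma> then 0 else fourier f k) \<le> B"
  shows "best_m_term p m N \<le> B"
  unfolding best_m_term_def
proof (rule SUP_least)
  fix f assume f: "f \<in> N"
  then obtain \<gamma> where "\<gamma> \<in> Gamma_sets m" "lp_norm p (\<lambda>k. if k \<in> \<gamma> then 0 else fourier f k) \<le> B"
    using assms(2) by blast
  then show "(INF \<gamma>\<in>Gamma_sets m. best_approx p \<gamma> f) \<le> B"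
    using f assms(1) by (intro INF_lower2[of \<gamma>]) (auto simp: best_approx_eq Gamma_sets_def subset_iff)
qed

text \<open>A supremum of infima is at most the infimum of suprema. For p < q this squeezes both
  quantities between one pair of bounds.\<close>

lemma best_m_term_le_basis_width: "best_m_term p m N \<le> basis_width p m N"
  unfolding best_m_term_def basis_width_def
  by (intro SUP_least INF_greatest INF_lower2) (auto intro: SUP_upper)

text \<open>Whichever \<open>m\<close> frequencies are removed, at least \<open>L\<close> points of
  \<open>A\<close> keep the coefficient \<open>c\<close>.\<close>

lemma best_approx_flat:
  assumes "0 < p" "finite (A :: (int ^ 'd) set)" "\<gamma> \<in> Gamma_sets m" "0 \<le> c" "0 < L" "real m + L \<le> real (card A)"
  shows "ennreal (c * L powr recip p) \<le> best_approx p \<gamma> (\<lambda>x. \<Sum>k\<in>A. of_real c * expo k x)"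
proof -
  have \<gamma>: "finite \<gamma>" "card \<gamma> = m" using assms by (auto simp: Gamma_sets_def)
  have "real (card A) - real (card \<gamma>) \<le> real (card (A - \<gamma>))"
    using diff_card_le_card_Diff[OF \<gamma>(1), of A] by linarith
  then have "L \<le> real (card (A - \<gamma>))" using assms \<gamma> by simp
  then show ?thesis
    unfolding best_approx_eq[OF L1_trig_poly \<gamma>(1)]
    using assms by (intro lp_norm_flat_lower[of p "A - \<gamma>"]) (auto simp: fourier_trig_poly)
qed

section \<open>Power sums of the weights inside and outside balls\<close>

context rapid_decay
begin

lemma Psi_pos:
  assumes "0 < r"
  shows "0 < Psi \<psi> r k"
  using psi_pos vec_norm_ge_1[OF assms, of k] by (simp add: Psi_def)

lemmas Psi_nonneg = less_imp_le[OF Psi_pos]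

lemma Psi_le_1:
  assumes "0 < r"
  shows "Psi \<psi> r k \<le> \<psi> 1"
  using psi_antimono vec_norm_ge_1[OF assms, of k] by (simp add: Psi_def)

lemma Psi_le:
  fixes k :: "int ^ 'd"
  assumes "0 < r" "1 \<le> t" "k \<notin> lattice_ball r t"
  shows "Psi \<psi> r k \<le> \<psi> t"
  using psi_antimono[of t "vec_norm r k"] vec_norm_zero[OF assms(1), where 'd = 'd] assms
  by (auto simp: Psi_def lattice_ball_def)

lemma Psi_ge:
  assumes "0 < r" "1 \<le> t" "k \<in> lattice_ball r t"
  shows "\<psi> t \<le> Psi \<psi> r k"
  using psi_antimono[of "vec_norm r k" t] psi_antimono[of 1 t] vec_norm_ge_1[OF assms(1), of k] assms
  by (auto simp: Psi_def lattice_ball_def)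

text \<open>Induction on the radius in unit steps. Passing from \<open>u - 1\<close> to
  \<open>u\<close>, the growth of \<psi>^(-q) frees a share \<open>c / Q u\<close> of the bound, and
  this pays for the points of the new shell.\<close>

lemma head_sum:
  assumes r: "0 < r" and q: "0 < q"
  obtains C where "0 < C" "\<And>T. 1 \<le> T \<Longrightarrow>
    (\<Sum>k\<in>lattice_ball r T. Psi \<psi> r (k :: int ^ 'd) powr (- q)) \<le> C * (T ^ (CARD('d) - 1) * Q T * \<psi> T powr (- q))"
proof -
  let ?d = "CARD('d)" and ?B = "\<lambda>t. lattice_ball r t :: (int ^ 'd) set"
  define S where "S u = (\<Sum>k\<in>?B u. Psi \<psi> r k powr (- q))" for u
  obtain c where c: "0 < c" "\<And>u. 1 \<le> u \<Longrightarrow> \<psi> (u + 1) powr q \<le> \<psi> u powr q * (1 - c / Q (u + 1))"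
    using psi_powr_unit_step[OF q] by blast
  obtain C1 where C1: "0 < C1" "\<And>t. 1 \<le> t \<Longrightarrow> real (card (?B t - ?B (t - 1))) \<le> C1 * t ^ (?d - 1)"
    using card_lattice_shell[OF r, where 'd = 'd] by blast
  define V where "V = real (card (?B 2))"
  note fin = finite_lattice_ball[OF r, where 'd = 'd]
  have Q1: "0 < Q 1" by (simp add: Q_pos)
  have ge: "Psi \<psi> r k powr (- q) \<le> \<psi> u powr (- q)" if "k \<in> ?B u" "1 \<le> u" for k u
    using Psi_ge[OF r that(2,1)] psi_pos[OF that(2)] q by (intro powr_mono2') auto
  \<comment> \<open>The factor \<open>b\<close> stays fixed along the induction, so it is adapted to
    the final radius \<open>T\<close> and has to pay for every shell below it. The base case covers
    u < 2, where all points lie in the ball of radius 2.\<close>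
  have one: "S u \<le> b * \<psi> u powr (- q)"
    if T: "1 \<le> T" and b: "V \<le> b" "0 \<le> b" "\<And>u. 1 \<le> u \<Longrightarrow> u \<le> T \<Longrightarrow> C1 * u ^ (?d - 1) \<le> b * (c / Q u)"
      and u: "1 \<le> u" "u \<le> T" "u < real n + 2" for T b u n
    using u
  proof (induction n arbitrary: u)
    case 0
    have "?B u \<subseteq> ?B 2" using 0 by (auto simp: lattice_ball_def)
    then have "real (card (?B u)) \<le> V" unfolding V_def using fin by (simp add: card_mono)
    have "S u \<le> (\<Sum>k\<in>?B u. \<psi> u powr (- q))"
      unfolding S_def using ge 0 by (intro sum_mono) auto
    also have "\<dots> = real (card (?B u)) * \<psi> u powr (- q)" by simp
    also have "\<dots> \<le> b * \<psi> u powr (- q)"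
      using \<open>_ \<le> V\<close> b by (intro mult_right_mono) auto
    finally show ?case .
  next
    case (Suc n)
    show ?case
    proof (cases "u < real n + 2")
      case False
      then have u2: "2 \<le> u" by linarith
      have pu: "0 < \<psi> u" "0 < \<psi> (u - 1)" using psi_pos u2 by auto
      have "\<psi> u powr q \<le> \<psi> (u - 1) powr q * (1 - c / Q u)"
        using c(2)[of "u - 1"] u2 by simp
      then have step: "\<psi> (u - 1) powr (- q) \<le> \<psi> u powr (- q) * (1 - c / Q u)"
        using pu by (simp add: powr_minus divide_simps mult.commute)
      have "?B (u - 1) \<subseteq> ?B u" by (auto simp: lattice_ball_def)
      then have "S u = S (u - 1) + (\<Sum>k\<in>?B u - ?B (u - 1). Psi \<psi> r k powr (- q))"
        unfolding S_def using fin by (subst sum.subset_diff) (auto simp: add.commute)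
      also have "\<dots> \<le> b * \<psi> (u - 1) powr (- q) + (\<Sum>k\<in>?B u - ?B (u - 1). \<psi> u powr (- q))"
        using Suc.IH[of "u - 1"] Suc.prems u2 ge by (intro add_mono sum_mono) auto
      also have "\<dots> = b * \<psi> (u - 1) powr (- q) + real (card (?B u - ?B (u - 1))) * \<psi> u powr (- q)"
        by simp
      also have "\<dots> \<le> b * (\<psi> u powr (- q) * (1 - c / Q u)) + C1 * u ^ (?d - 1) * \<psi> u powr (- q)"
        using step b(2) C1(2)[of u] u2 by (intro add_mono mult_left_mono mult_right_mono) auto
      also have "\<dots> \<le> b * (\<psi> u powr (- q) * (1 - c / Q u)) + b * (c / Q u) * \<psi> u powr (- q)"
        using b(3)[of u] Suc.prems by (intro add_left_mono mult_right_mono) auto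
      also have "\<dots> = b * \<psi> u powr (- q)" by (simp add: algebra_simps)
      finally show ?thesis .
    qed (use Suc in auto)
  qed
  show ?thesis
  proof (rule that)
    let ?C = "V * K / Q 1 + C1 * K / c"
    have K0: "0 < K" using K_ge_1 by simp
    have V0: "0 \<le> V" by (simp add: V_def)
    show "0 < ?C" using V0 K0 Q1 C1 c by (intro add_nonneg_pos divide_nonneg_pos divide_pos_pos mult_pos_pos mult_nonneg_nonneg) auto
    fix T :: real assume T: "1 \<le> T"
    define w where "w = T ^ (?d - 1) * Q T"
    have T1: "1 \<le> T ^ (?d - 1)" using T by simp
    have QT: "0 < Q T" "Q 1 / K \<le> Q T" using Q_pos[OF T] Q_lower[OF T] by auto
    have w0: "0 < w" using T1 QT by (simp add: w_def)
    have w: "Q 1 / K \<le> w" using mult_mono[OF T1 QT(2)] Q1 K0 T by (simp add: w_def)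
    have "S T \<le> ?C * w * \<psi> T powr (- q)"
    proof (rule one[where n = "nat \<lceil>T\<rceil>", OF T])
      have "V = V * K / Q 1 * (Q 1 / K)" using Q1 K0 by simp
      also have "\<dots> \<le> V * K / Q 1 * w" using w V0 K0 Q1 by (intro mult_left_mono) auto
      also have "\<dots> \<le> ?C * w" using w0 C1 c K0 by (intro mult_right_mono) auto
      finally show "V \<le> ?C * w" .
      show "0 \<le> ?C * w" using V0 K0 Q1 C1 c w0 by auto
      fix u assume u: "1 \<le> u" "u \<le> T"
      have "C1 * u ^ (?d - 1) \<le> C1 * T ^ (?d - 1)" using C1 u by (intro mult_left_mono power_mono) auto
      also have "\<dots> \<le> C1 * T ^ (?d - 1) * (K * Q T / Q u)"
        using Q_quasi_mono[OF u] Q_pos[OF u(1)] C1 T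
          mult_left_mono[of 1 "K * Q T / Q u" "C1 * T ^ (?d - 1)"] by simp
      also have "\<dots> = C1 * K / c * w * (c / Q u)" using c by (simp add: w_def)
      also have "\<dots> \<le> ?C * w * (c / Q u)"
        using w0 V0 K0 Q1 c Q_pos[OF u(1)] by (intro mult_right_mono) auto
      finally show "C1 * u ^ (?d - 1) \<le> ?C * w * (c / Q u)" .
    qed (use T in \<open>auto, linarith\<close>)
    then show "(\<Sum>k\<in>?B T. Psi \<psi> r k powr (- q)) \<le> ?C * (T ^ (?d - 1) * Q T * \<psi> T powr (- q))"
      by (simp add: S_def w_def mult.assoc)
  qed
qed

text \<open>The exponent is split into two halves \<sigma>: one copy of \<psi>^\<sigma> absorbs the
  polynomial size of the shells, the other one telescopes.\<close>

lemma tail_sum_shells: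
  assumes r: "0 < r" and s: "0 < s"
  obtains C where "0 < C" "\<And>t (F :: (int ^ 'd) set). 1 \<le> t \<Longrightarrow> finite F \<Longrightarrow> F \<inter> lattice_ball r t = {} \<Longrightarrow>
    (\<Sum>k\<in>F. Psi \<psi> r k powr s) \<le> C * (t ^ (CARD('d) - 1) * Q t * \<psi> t powr s)"
proof -
  let ?d = "CARD('d)" and ?B = "\<lambda>t. lattice_ball r t :: (int ^ 'd) set"
  define \<sigma> where "\<sigma> = s / 2"
  have \<sigma>: "0 < \<sigma>" "s = \<sigma> + \<sigma>" using s by (auto simp: \<sigma>_def)
  obtain c where c: "0 < c" "\<And>u. 1 \<le> u \<Longrightarrow> \<psi> (u + 1) powr \<sigma> \<le> \<psi> u powr \<sigma> * (1 - c / Q (u + 1))"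
    using psi_powr_unit_step[OF \<sigma>(1)] by blast
  obtain C1 where C1: "0 < C1" "\<And>t. 1 \<le> t \<Longrightarrow> real (card (?B t - ?B (t - 1))) \<le> C1 * t ^ (?d - 1)"
    using card_lattice_shell[OF r, where 'd = 'd] by blast
  obtain C2 where C2: "1 \<le> C2"
    "\<And>t u. 1 \<le> t \<Longrightarrow> t \<le> u \<Longrightarrow> u ^ ?d * \<psi> u powr \<sigma> \<le> C2 * (t ^ ?d * \<psi> t powr \<sigma>)"
    using psi_powr_poly[OF \<sigma>(1), of ?d] by blast
  note fin = finite_lattice_ball[OF r, where 'd = 'd]
  define b where "b t = C1 / c * 2 ^ ?d * (Q t / t) * (C2 * (t ^ ?d * \<psi> t powr \<sigma>))" for t
  have b0: "0 \<le> b t" if "1 \<le> t" for t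
    using that Q_pos[OF that] C1 C2(1) c by (simp add: b_def)
  have step: "C1 * (u + 1) ^ (?d - 1) * \<psi> u powr s \<le> b t * (\<psi> u powr \<sigma> - \<psi> (u + 1) powr \<sigma>)"
    if t: "1 \<le> t" "t \<le> u" for t u
  proof -
    have u: "1 \<le> u" "0 < Q (u + 1)" "0 \<le> Q t" "0 \<le> Q t / t" using t Q_pos[of "u + 1"] Q_pos[of t] by auto
    \<comment> \<open>The monotonicity of \<open>Q t / t\<close> brings \<open>Q (u + 1)\<close>
      back to the radius \<open>t\<close>, at the price of one more factor
      \<open>u + 1\<close>.\<close>
    have "(u + 1) ^ (?d - 1) * Q (u + 1) \<le> (u + 1) ^ (?d - 1) * ((u + 1) * (Q t / t))"
      using Q_ratio[of t "u + 1"] t u by (intro mult_left_mono) (auto simp: divide_simps mult.commute)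
    also have "\<dots> = (u + 1) ^ ?d * (Q t / t)"
      by (simp add: power_eq_if mult_ac)
    also have "\<dots> \<le> (2 * u) ^ ?d * (Q t / t)"
      using u by (intro mult_right_mono power_mono) auto
    finally have "(u + 1) ^ (?d - 1) * Q (u + 1) * \<psi> u powr \<sigma> \<le> (2 * u) ^ ?d * (Q t / t) * \<psi> u powr \<sigma>"
      by (rule mult_right_mono) simp
    also have "\<dots> = 2 ^ ?d * (Q t / t) * (u ^ ?d * \<psi> u powr \<sigma>)" by (simp only: power_mult_distrib mult_ac)
    also have "\<dots> \<le> 2 ^ ?d * (Q t / t) * (C2 * (t ^ ?d * \<psi> t powr \<sigma>))"
      using u t by (intro mult_left_mono C2) auto
    finally have "C1 * ((u + 1) ^ (?d - 1) * Q (u + 1) * \<psi> u powr \<sigma>)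
        \<le> C1 * (2 ^ ?d * (Q t / t) * (C2 * (t ^ ?d * \<psi> t powr \<sigma>)))"
      using C1 by (intro mult_left_mono) auto
    also have "\<dots> = b t * c" using c by (simp add: b_def)
    finally have "C1 * (u + 1) ^ (?d - 1) * \<psi> u powr \<sigma> \<le> b t * (c / Q (u + 1))"
      using u by (simp add: divide_simps mult_ac)
    then have "C1 * (u + 1) ^ (?d - 1) * \<psi> u powr \<sigma> * \<psi> u powr \<sigma> \<le> b t * (c / Q (u + 1)) * \<psi> u powr \<sigma>"
      by (rule mult_right_mono) simp
    moreover have "b t * (\<psi> u powr \<sigma> * (c / Q (u + 1))) \<le> b t * (\<psi> u powr \<sigma> - \<psi> (u + 1) powr \<sigma>)"
      using c(2)[OF u(1)] b0[OF t(1)] by (intro mult_left_mono) (auto simp: algebra_simps)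
    ultimately show ?thesis unfolding \<sigma>(2) powr_add by (simp add: mult_ac)
  qed
  have ball: "(\<Sum>k\<in>?B (t + real j) - ?B t. Psi \<psi> r k powr s) \<le> b t * (\<psi> t powr \<sigma> - \<psi> (t + real j) powr \<sigma>)"
    if t: "1 \<le> t" for t j
  proof (induction j)
    case (Suc j)
    define u where "u = t + real j"
    have u: "t \<le> u" "1 \<le> u" "t + real (Suc j) = u + 1" using t by (auto simp: u_def)
    have eq: "?B (u + 1) - ?B t = (?B u - ?B t) \<union> (?B (u + 1) - ?B u)"
      using u by (auto simp: lattice_ball_def)
    have "(\<Sum>k\<in>?B (u + 1) - ?B t. Psi \<psi> r k powr s)
        = (\<Sum>k\<in>?B u - ?B t. Psi \<psi> r k powr s) + (\<Sum>k\<in>?B (u + 1) - ?B u. Psi \<psi> r k powr s)"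
      unfolding eq using fin by (intro sum.union_disjoint) auto
    also have "(\<Sum>k\<in>?B (u + 1) - ?B u. Psi \<psi> r k powr s) \<le> (\<Sum>k\<in>?B (u + 1) - ?B u. \<psi> u powr s)"
      using Psi_le[OF r u(2)] Psi_nonneg[OF r] s by (intro sum_mono powr_mono2) auto
    also have "\<dots> = real (card (?B (u + 1) - ?B u)) * \<psi> u powr s" by simp
    also have "\<dots> \<le> C1 * (u + 1) ^ (?d - 1) * \<psi> u powr s"
      using C1(2)[of "u + 1"] u by (intro mult_right_mono) auto
    also have "\<dots> \<le> b t * (\<psi> u powr \<sigma> - \<psi> (u + 1) powr \<sigma>)" using step[OF t u(1)] .
    also have "(\<Sum>k\<in>?B u - ?B t. Psi \<psi> r k powr s) \<le> b t * (\<psi> t powr \<sigma> - \<psi> u powr \<sigma>)"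
      using Suc by (simp add: u_def)
    finally show ?case unfolding u(3) by (simp add: algebra_simps)
  qed simp
  show ?thesis
  proof (rule that)
    show "0 < C1 / c * 2 ^ ?d * C2" using C1 c C2(1) by simp
    fix t :: real and F :: "(int ^ 'd) set"
    assume t: "1 \<le> t" and F: "finite F" "F \<inter> ?B t = {}"
    obtain j where j: "\<And>k. k \<in> F \<Longrightarrow> vec_norm r k \<le> real j"
    proof -
      have "vec_norm r k \<le> real (nat \<lceil>Max (vec_norm r ` F)\<rceil>)" if "k \<in> F" for k
        using F that by (intro order_trans[OF _ real_nat_ceiling_ge] Max_ge) auto
      then show ?thesis using that by blast
    qed
    have "F \<subseteq> ?B (t + real j) - ?B t"
      using F j t by (fastforce simp: lattice_ball_def)
    then have "(\<Sum>k\<in>F. Psi \<psi> r k powr s) \<le> (\<Sum>k\<in>?B (t + real j) - ?B t. Psi \<psi> r k powr s)"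
      using fin by (intro sum_mono2) auto
    also have "\<dots> \<le> b t * (\<psi> t powr \<sigma> - \<psi> (t + real j) powr \<sigma>)" by (rule ball[OF t])
    also have "\<dots> \<le> b t * \<psi> t powr \<sigma>" using b0[OF t] by (intro mult_left_mono) auto
    also have "\<dots> = C1 / c * 2 ^ ?d * C2 * (t ^ (?d - 1) * Q t * \<psi> t powr s)"
      using t unfolding b_def \<sigma>(2) powr_add by (simp add: power_eq_if[of t ?d])
    finally show "(\<Sum>k\<in>F. Psi \<psi> r k powr s) \<le> C1 / c * 2 ^ ?d * C2 * (t ^ (?d - 1) * Q t * \<psi> t powr s)" .
  qed
qed

text \<open>At \<open>t = 1\<close> the ball need not be removed, which treats the small values of \<open>m\<close>
  together with the others.\<close>

lemma tail_sum:
  assumes r: "0 < r" and s: "0 < s"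
  obtains C where "0 < C" "\<And>t (F :: (int ^ 'd) set). 1 \<le> t \<Longrightarrow> finite F \<Longrightarrow> F \<inter> lattice_ball r t = {} \<or> t = 1 \<Longrightarrow>
    (\<Sum>k\<in>F. Psi \<psi> r k powr s) \<le> C * (t ^ (CARD('d) - 1) * Q t * \<psi> t powr s)"
proof -
  let ?B = "\<lambda>t. lattice_ball r t :: (int ^ 'd) set"
  obtain C where C: "0 < C" "\<And>t (F :: (int ^ 'd) set). 1 \<le> t \<Longrightarrow> finite F \<Longrightarrow> F \<inter> lattice_ball r t = {} \<Longrightarrow>
    (\<Sum>k\<in>F. Psi \<psi> r k powr s) \<le> C * (t ^ (CARD('d) - 1) * Q t * \<psi> t powr s)"
    using tail_sum_shells[OF r s, where 'd = 'd] by blast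
  note fin = finite_lattice_ball[OF r, where 'd = 'd]
  \<comment> \<open>Bounds the contribution of the unit ball when \<open>t = 1\<close>; dividing by
    \<open>Q 1\<close> compensates the factor \<open>Q t\<close> of the target.\<close>
  define D where "D = real (card (?B 1)) / Q 1"
  have Q1: "0 < Q 1" by (simp add: Q_pos)
  show ?thesis
  proof (rule that[of "D + C"])
    have D0: "0 \<le> D" using Q1 by (simp add: D_def)
    then show "0 < D + C" using C by simp
    fix t :: real and F :: "(int ^ 'd) set"
    assume t: "1 \<le> t" and F: "finite F" "F \<inter> ?B t = {} \<or> t = 1"
    show "(\<Sum>k\<in>F. Psi \<psi> r k powr s) \<le> (D + C) * (t ^ (CARD('d) - 1) * Q t * \<psi> t powr s)"
    proof (cases "F \<inter> ?B t = {}")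
      case True
      have "(\<Sum>k\<in>F. Psi \<psi> r k powr s) \<le> C * (t ^ (CARD('d) - 1) * Q t * \<psi> t powr s)"
        using C(2)[OF t F(1) True] .
      also have "\<dots> \<le> (D + C) * (t ^ (CARD('d) - 1) * Q t * \<psi> t powr s)"
        using D0 t Q_pos[OF t] by (intro mult_right_mono) auto
      finally show ?thesis .
    next
      case False
      then have t1: "t = 1" using F by simp
      have "(\<Sum>k\<in>F. Psi \<psi> r k powr s) = (\<Sum>k\<in>F \<inter> ?B 1. Psi \<psi> r k powr s) + (\<Sum>k\<in>F - ?B 1. Psi \<psi> r k powr s)"
        using F by (subst sum.Int_Diff[of F _ "?B 1"]) auto
      also have "(\<Sum>k\<in>F \<inter> ?B 1. Psi \<psi> r k powr s) \<le> (\<Sum>k\<in>F \<inter> ?B 1. \<psi> 1 powr s)"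
        using Psi_le_1[OF r] Psi_nonneg[OF r] s by (intro sum_mono powr_mono2) auto
      also have "\<dots> \<le> real (card (?B 1)) * \<psi> 1 powr s"
        using fin by (simp add: card_mono mult_right_mono)
      also have "\<dots> = D * (Q 1 * \<psi> 1 powr s)" using Q1 by (simp add: D_def)
      also have "(\<Sum>k\<in>F - ?B 1. Psi \<psi> r k powr s) \<le> C * (Q 1 * \<psi> 1 powr s)"
        using C(2)[of 1 "F - ?B 1"] F by auto
      finally show ?thesis by (simp add: t1 distrib_right)
    qed
  qed
qed

end

section \<open>Order estimates\<close>

lemma F_class_subset_L1: "F_class q r \<psi> \<subseteq> L1"
  by (auto simp: F_class_def)

lemma flat_mem_F_class:
  assumes "0 < q" "finite (A :: (int ^ 'd) set)" "\<And>k :: int ^ 'd. 0 < Psi \<psi> r k" "0 < c"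
    and "q \<noteq> \<infinity> \<Longrightarrow> (\<Sum>k\<in>A. Psi \<psi> r k powr (- enn2real q)) \<le> c powr (- enn2real q)"
    and "\<And>k. q = \<infinity> \<Longrightarrow> k \<in> A \<Longrightarrow> c \<le> Psi \<psi> r k"
  shows "(\<lambda>x. \<Sum>k\<in>A. of_real c * expo k x) \<in> F_class q r \<psi>"
  using lp_norm_flat_upper[of q A "Psi \<psi> r" c] assms
  by (simp add: F_class_def L1_trig_poly fourier_trig_poly)

lemma Psi_bound_F_class:
  assumes "f \<in> F_class q r \<psi>"
  shows "lp_norm q (\<lambda>k. fourier f k / of_real (Psi \<psi> r k)) \<le> 1"
  using assms by (simp add: F_class_def)

context rapid_decay
begin

text \<open>In the following lemmas \<open>m\<close> and \<open>n\<close> are linked by \<open>m = M n\<^sup>d\<close>, so that \<open>m alpha(n) = M n\<^bsup>d-1\<^esup> Q(n)\<close>.\<close>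

lemma inner_ball:
  assumes r: "0 < r"
  obtains c where "1 \<le> c" "\<And>m n. 1 \<le> n \<Longrightarrow> real m = M_const r CARD('d) * n ^ CARD('d) \<Longrightarrow>
    \<exists>\<gamma>\<in>Gamma_sets m. lattice_ball r (max 1 (n - c)) \<subseteq> (\<gamma> :: (int ^ 'd) set) \<or> max 1 (n - c) = 1"
proof -
  obtain c where c: "1 \<le> c"
    "\<And>t. 0 \<le> t \<Longrightarrow> real (card (lattice_ball r t :: (int ^ 'd) set)) \<le> M_const r CARD('d) * (t + c) ^ CARD('d)"
    by (rule card_lattice_ball_shift[OF r, where 'd = 'd]) blast
  show ?thesis
  proof (rule that[OF c(1)])
    fix m n assume n: "1 \<le> n" and m: "real m = M_const r CARD('d) * n ^ CARD('d)"
    show "\<exists>\<gamma>\<in>Gamma_sets m. lattice_ball r (max 1 (n - c)) \<subseteq> (\<gamma> :: (int ^ 'd) set) \<or> max 1 (n - c) = 1"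
    proof (cases "1 \<le> n - c")
      case True
      then have "card (lattice_ball r (n - c) :: (int ^ 'd) set) \<le> m"
        using c(2)[of "n - c"] m by simp
      then obtain \<gamma> where \<gamma>: "lattice_ball r (n - c) \<subseteq> (\<gamma> :: (int ^ 'd) set)" "\<gamma> \<in> Gamma_sets m"
        by (rule Gamma_sets_superset[OF finite_lattice_ball[OF r]])
      have "max 1 (n - c) = n - c" using True by simp
      then show ?thesis using \<gamma> by auto
    next
      \<comment> \<open>The radius is clipped to 1, and any \<open>m\<close> frequencies will do,
        since the estimates at radius 1 hold on the whole lattice.\<close>
      case False
      obtain \<gamma> :: "(int ^ 'd) set" where \<gamma>: "\<gamma> \<in> Gamma_sets m"
        by (rule Gamma_sets_superset[of "{}" m]) simp_all
      have "max 1 (n - c) = 1" using False by simp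
      then show ?thesis using \<gamma> by auto
    qed
  qed
qed

text \<open>The ball of radius \<open>n - c\<close> fits into \<open>m\<close> frequencies, outside
  it the weights are at most \<psi>(n - c), and the shift by \<open>c\<close> costs a
  constant.\<close>

lemma basis_width_upper_embed:
  assumes r: "0 < r" and q: "0 < q" "q \<le> p"
  obtains C where "0 < C" "\<And>m n. 1 \<le> n \<Longrightarrow> real m = M_const r CARD('d) * n ^ CARD('d) \<Longrightarrow>
    basis_width p m (F_class q r \<psi> :: (real ^ 'd \<Rightarrow> complex) set) \<le> ennreal (C * \<psi> n)"
proof -
  obtain c where c: "1 \<le> c" "\<And>m n. 1 \<le> n \<Longrightarrow> real m = M_const r CARD('d) * n ^ CARD('d) \<Longrightarrow>
    \<exists>\<gamma>\<in>Gamma_sets m. lattice_ball r (max 1 (n - c)) \<subseteq> (\<gamma> :: (int ^ 'd) set) \<or> max 1 (n - c) = 1"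
    by (rule inner_ball[where 'd = 'd, OF r]) blast
  obtain C where C: "1 \<le> C" "\<And>s x. 1 \<le> s \<Longrightarrow> 0 \<le> x \<Longrightarrow> x \<le> c \<Longrightarrow> \<psi> s \<le> C * \<psi> (s + x)"
    using psi_shift_const[of c] by blast
  show ?thesis
  proof (rule that[of C])
    fix m n assume n: "1 \<le> n" and m: "real m = M_const r CARD('d) * n ^ CARD('d)"
    define t where "t = max 1 (n - c)"
    have t: "1 \<le> t" "0 \<le> n - t" "n - t \<le> c" using n c(1) by (auto simp: t_def)
    obtain \<gamma> :: "(int ^ 'd) set" where \<gamma>: "\<gamma> \<in> Gamma_sets m" "lattice_ball r t \<subseteq> \<gamma> \<or> t = 1"
      using c(2)[OF n m] unfolding t_def by blast
    have "basis_width p m (F_class q r \<psi> :: (real ^ 'd \<Rightarrow> complex) set) \<le> ennreal (\<psi> t)"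
    proof (rule basis_width_le[OF \<gamma>(1) F_class_subset_L1])
      fix f :: "real ^ 'd \<Rightarrow> complex" assume f: "f \<in> F_class q r \<psi>"
      show "lp_norm p (\<lambda>k. if k \<in> \<gamma> then 0 else fourier f k) \<le> ennreal (\<psi> t)"
        by (rule lp_norm_embed[OF q Psi_pos[OF r] Psi_bound_F_class[OF f]])
          (use \<gamma>(2) Psi_le[OF r t(1)] Psi_le_1[OF r] psi_pos[OF t(1)] in auto)
    qed
    also have "\<psi> t \<le> C * \<psi> n" using C(2)[OF t] by simp
    finally show "basis_width p m (F_class q r \<psi> :: (real ^ 'd \<Rightarrow> complex) set) \<le> ennreal (C * \<psi> n)"
      by (simp add: ennreal_leI)
  qed (use C in auto)
qed

lemma basis_width_upper_hoelder:
  assumes r: "0 < r" and p: "0 < p" "p < q"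
  obtains C where "0 < C" "\<And>m n. 1 \<le> n \<Longrightarrow> real m = M_const r CARD('d) * n ^ CARD('d) \<Longrightarrow>
    basis_width p m (F_class q r \<psi> :: (real ^ 'd \<Rightarrow> complex) set)
      \<le> ennreal (C * (\<psi> n * (n ^ (CARD('d) - 1) * Q n) powr (recip p - recip q)))"
proof -
  let ?d = "CARD('d)"
  define e where "e = recip p - recip q"
  have e: "0 < e" using recip_strict_antimono[OF p] by (simp add: e_def)
  define s where "s = 1 / e"
  have s: "0 < s" using e by (simp add: s_def)
  obtain c where c: "1 \<le> c" "\<And>m n. 1 \<le> n \<Longrightarrow> real m = M_const r CARD('d) * n ^ CARD('d) \<Longrightarrow>
    \<exists>\<gamma>\<in>Gamma_sets m. lattice_ball r (max 1 (n - c)) \<subseteq> (\<gamma> :: (int ^ 'd) set) \<or> max 1 (n - c) = 1"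
    by (rule inner_ball[where 'd = 'd, OF r]) blast
  obtain C where C: "1 \<le> C" "\<And>s x. 1 \<le> s \<Longrightarrow> 0 \<le> x \<Longrightarrow> x \<le> c \<Longrightarrow> \<psi> s \<le> C * \<psi> (s + x)"
    using psi_shift_const[of c] by blast
  obtain D where D: "0 < D" "\<And>t (F :: (int ^ 'd) set). 1 \<le> t \<Longrightarrow> finite F \<Longrightarrow> F \<inter> lattice_ball r t = {} \<or> t = 1 \<Longrightarrow>
    (\<Sum>k\<in>F. Psi \<psi> r k powr s) \<le> D * (t ^ (CARD('d) - 1) * Q t * \<psi> t powr s)"
    using tail_sum[OF r s, where 'd = 'd] by blast
  show ?thesis
  proof (rule that[of "(D * K) powr e * C"])
    show "0 < (D * K) powr e * C" using D C K_ge_1 by simp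
    fix m n assume n: "1 \<le> n" and m: "real m = M_const r ?d * n ^ ?d"
    define t where "t = max 1 (n - c)"
    have t: "1 \<le> t" "0 \<le> n - t" "n - t \<le> c" using n c(1) by (auto simp: t_def)
    obtain \<gamma> :: "(int ^ 'd) set" where \<gamma>: "\<gamma> \<in> Gamma_sets m" "lattice_ball r t \<subseteq> \<gamma> \<or> t = 1"
      using c(2)[OF n m] unfolding t_def by blast
    define Z where "Z = D * (t ^ (?d - 1) * Q t * \<psi> t powr s)"
    have Z: "0 < Z" using D t Q_pos[OF t(1)] psi_pos[OF t(1)] by (simp add: Z_def)
    have "basis_width p m (F_class q r \<psi> :: (real ^ 'd \<Rightarrow> complex) set) \<le> ennreal (Z powr e)"
    proof (rule basis_width_le[OF \<gamma>(1) F_class_subset_L1])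
      fix f :: "real ^ 'd \<Rightarrow> complex" assume f: "f \<in> F_class q r \<psi>"
      show "lp_norm p (\<lambda>k. if k \<in> \<gamma> then 0 else fourier f k) \<le> ennreal (Z powr e)"
        unfolding e_def
      proof (rule lp_norm_hoelder[OF p Psi_pos[OF r] Psi_bound_F_class[OF f] _ _ Z])
        show "s = 1 / (recip p - recip q)" by (simp add: s_def e_def)
        fix F :: "(int ^ 'd) set" assume F: "finite F" "F \<inter> \<gamma> = {}"
        show "(\<Sum>k\<in>F. Psi \<psi> r k powr s) \<le> Z"
          unfolding Z_def by (rule D(2)[OF t(1) F(1)]) (use F \<gamma> in auto)
      qed
    qed
    also have "Z powr e \<le> (D * K) powr e * C * (\<psi> n * (n ^ (?d - 1) * Q n) powr e)"
    proof -
      have "t ^ (?d - 1) * Q t \<le> n ^ (?d - 1) * (K * Q n)"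
        using t n Q_quasi_mono[OF t(1), of n] Q_pos[OF t(1)] by (intro mult_mono power_mono) auto
      then have "(t ^ (?d - 1) * Q t) powr e \<le> (n ^ (?d - 1) * (K * Q n)) powr e"
        using t Q_pos[OF t(1)] e by (intro powr_mono2) auto
      also have "\<dots> = K powr e * (n ^ (?d - 1) * Q n) powr e"
        using K_ge_1 n Q_pos[OF n] by (simp add: powr_mult mult_ac)
      finally have 1: "(t ^ (?d - 1) * Q t) powr e \<le> K powr e * (n ^ (?d - 1) * Q n) powr e" .
      have 2: "\<psi> t \<le> C * \<psi> n" using C(2)[OF t] by simp
      \<comment> \<open>Since \<open>s * e = 1\<close>, the weight \<psi>(t) comes out with exponent
        one.\<close>
      have "Z powr e = D powr e * ((t ^ (?d - 1) * Q t) powr e * \<psi> t)"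
        using D t Q_pos[OF t(1)] psi_pos[OF t(1)] e by (simp add: Z_def powr_mult powr_powr s_def)
      also have "\<dots> \<le> D powr e * ((K powr e * (n ^ (?d - 1) * Q n) powr e) * (C * \<psi> n))"
        using 1 2 psi_pos[OF t(1)] by (intro mult_left_mono mult_mono) auto
      finally show ?thesis using D K_ge_1 by (simp add: powr_mult mult_ac)
    qed
    finally show "basis_width p m (F_class q r \<psi> :: (real ^ 'd \<Rightarrow> complex) set)
      \<le> ennreal ((D * K) powr e * C * (\<psi> n * (n ^ (?d - 1) * Q n) powr (recip p - recip q)))"
      by (simp add: e_def ennreal_leI)
  qed
qed

text \<open>A fraction \<open>L\<close> of the \<open>m\<close> frequencies, comparable with \<open>n\<^bsup>d-1\<^esup> Q(n)\<close>, is saved for the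
  largest coefficients outside a ball of radius \<open>n - O(Q(n))\<close>, on which \<open>\<psi>\<close> is still comparable with \<open>\<psi>(n)\<close>.\<close>

lemma best_m_term_upper:
  assumes r: "0 < r" and q: "0 < q" "q \<le> p"
  obtains C where "0 < C" "\<And>m n. 1 \<le> n \<Longrightarrow> real m = M_const r CARD('d) * n ^ CARD('d) \<Longrightarrow>
    best_m_term p m (F_class q r \<psi> :: (real ^ 'd \<Rightarrow> complex) set)
      \<le> ennreal (C * (\<psi> n * (n ^ (CARD('d) - 1) * Q n) powr (recip p - recip q)))"
proof -
  let ?d = "CARD('d)" and ?M = "M_const r CARD('d)"
  define e where "e = recip p - recip q"
  have e: "e \<le> 0" using recip_antimono[OF q] by (simp add: e_def)
  have M: "0 < ?M" by (rule M_const_pos)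
  have Q1: "0 < Q 1" by (simp add: Q_pos)
  have nd: "n ^ ?d = n * n ^ (?d - 1)" for n :: real by (simp add: power_eq_if)
  have approx: "best_m_term p m (F_class q r \<psi> :: (real ^ 'd \<Rightarrow> complex) set) \<le> ennreal (W * L powr e)"
    if L: "0 < L" and A: "finite A" "real (card A) + L \<le> real m"
      and W: "\<And>k. k \<notin> A \<Longrightarrow> Psi \<psi> r k \<le> W" "0 < W" for L W m and A :: "(int ^ 'd) set"
  proof (rule best_m_term_le[OF F_class_subset_L1])
    fix f :: "real ^ 'd \<Rightarrow> complex" assume f: "f \<in> F_class q r \<psi>"
    obtain A' where A': "finite A'" "real (card A') \<le> L"
      "lp_norm p (\<lambda>k. if k \<in> A \<union> A' then 0 else fourier f k) \<le> ennreal (W * L powr (recip p - recip q))"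
      by (rule lp_norm_threshold[OF q Psi_pos[OF r] Psi_bound_F_class[OF f] W L])
    have "card (A \<union> A') \<le> m" using card_Un_le[of A A'] A A' by linarith
    then obtain \<gamma> where \<gamma>: "A \<union> A' \<subseteq> \<gamma>" "\<gamma> \<in> Gamma_sets m"
      using Gamma_sets_superset A A' by (metis finite_UnI)
    have "lp_norm p (\<lambda>k. if k \<in> \<gamma> then 0 else fourier f k) \<le> lp_norm p (\<lambda>k. if k \<in> A \<union> A' then 0 else fourier f k)"
      using \<gamma> by (intro lp_norm_mono) auto
    then show "\<exists>\<gamma>\<in>Gamma_sets m. lp_norm p (\<lambda>k. if k \<in> \<gamma> then 0 else fourier f k) \<le> ennreal (W * L powr e)"
      using \<gamma>(2) A'(3) unfolding e_def by (meson order_trans)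
  qed
  obtain c where c: "1 \<le> c"
    "\<And>t. 0 \<le> t \<Longrightarrow> real (card (lattice_ball r t :: (int ^ 'd) set)) \<le> ?M * (t + c) ^ ?d"
    by (rule card_lattice_ball_shift[OF r, where 'd = 'd]) blast
  \<comment> \<open>As \<open>Q n \<le> n * Q 1\<close>, this gives
    \<open>\<epsilon> * Q n \<le> n / 4\<close>; together with \<open>c \<le> n / 4\<close> the
    reduced radius stays above \<open>n / 2\<close>.\<close>
  define \<epsilon> where "\<epsilon> = 1 / (4 * Q 1)"
  have \<epsilon>: "0 < \<epsilon>" using Q1 by (simp add: \<epsilon>_def)
  obtain C where C: "1 \<le> C"
    "\<And>s x. 1 \<le> s \<Longrightarrow> 0 \<le> x \<Longrightarrow> x \<le> (c * K / Q 1 + 2 * \<epsilon>) * Q s \<Longrightarrow> \<psi> s \<le> C * \<psi> (s + x)"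
    using psi_shift by blast
  obtain C' where C': "1 \<le> C'" "\<And>s x. 1 \<le> s \<Longrightarrow> 0 \<le> x \<Longrightarrow> x \<le> 4 * c \<Longrightarrow> \<psi> s \<le> C' * \<psi> (s + x)"
    using psi_shift_const[of "4 * c"] by blast
  let ?C1 = "C * (?M * \<epsilon>) powr e" and ?C2 = "C' * (?M / Q 1) powr e"
  show ?thesis
  proof (rule that[of "?C1 + ?C2"])
    have C0: "0 < ?C1" "0 < ?C2" using C C' M \<epsilon> Q1 by auto
    then show "0 < ?C1 + ?C2" by simp
    fix m n assume n: "1 \<le> n" and m: "real m = ?M * n ^ ?d"
    define w where "w = n ^ (?d - 1) * Q n"
    have Qn: "0 < Q n" "Q n \<le> n * Q 1" using Q_pos[OF n] Q_upper[of 1 n] n by auto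
    have w: "0 < w" using Qn n by (simp add: w_def)
    have pn: "0 < \<psi> n" by (rule psi_pos[OF n])
    have "best_m_term p m (F_class q r \<psi> :: (real ^ 'd \<Rightarrow> complex) set) \<le> ennreal ((?C1 + ?C2) * (\<psi> n * w powr e))"
    proof (cases "4 * c \<le> n")
      case True
      define x where "x = \<epsilon> * Q n"
      have x: "0 < x" "x \<le> n / 4"
      proof -
        show "0 < x" using \<epsilon> Qn by (simp add: x_def)
        have "x \<le> \<epsilon> * (n * Q 1)" unfolding x_def using Qn \<epsilon> by (intro mult_left_mono) auto
        also have "\<dots> = n / 4" using Q1 by (simp add: \<epsilon>_def)
        finally show "x \<le> n / 4" .
      qed
      define t where "t = n - (c + x)"
      have t: "n / 2 \<le> t" "1 \<le> t" "t \<le> n" "t + c = n - x" using True x c(1) by (auto simp: t_def)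
      \<comment> \<open>The shift has to be measured by \<open>Q t\<close> at the smaller radius:
        \<open>c\<close> is covered by the lower bound of \<open>Q\<close>, and
        \<open>Q n \<le> 2 * Q t\<close> because \<open>n \<le> 2 * t\<close>.\<close>
      have "\<psi> t \<le> C * \<psi> (t + (c + x))"
      proof (rule C(2)[OF t(2)])
        have "c = c * K / Q 1 * (Q 1 / K)" using Q1 K_ge_1 by simp
        also have "\<dots> \<le> c * K / Q 1 * Q t" using c(1) Q1 K_ge_1 Q_lower[OF t(2)] by (intro mult_left_mono) auto
        finally have 1: "c \<le> c * K / Q 1 * Q t" .
        have "Q n \<le> n / t * Q t" by (rule Q_upper[OF t(2,3)])
        also have "\<dots> \<le> 2 * Q t" using t Q_pos[OF t(2)] by (intro mult_right_mono) (auto simp: divide_simps)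
        finally have "x \<le> \<epsilon> * (2 * Q t)" unfolding x_def using \<epsilon> by (intro mult_left_mono) auto
        with 1 show "c + x \<le> (c * K / Q 1 + 2 * \<epsilon>) * Q t" by (simp add: algebra_simps)
      qed (use x c in auto)
      then have W: "\<psi> t \<le> C * \<psi> n" by (simp add: t_def)
      have "real (card (lattice_ball r t :: (int ^ 'd) set)) \<le> ?M * (n - x) ^ ?d"
        using c(2)[of t] t by simp
      also have "\<dots> \<le> ?M * ((n - x) * n ^ (?d - 1))"
        unfolding nd using M x n by (intro mult_left_mono power_mono) auto
      \<comment> \<open>What the smaller ball leaves free, \<open>?M * \<epsilon> * w\<close>, is
        the number of frequencies available to the threshold argument.\<close>
      also have "\<dots> = real m - ?M * \<epsilon> * w" unfolding m nd by (simp add: x_def w_def algebra_simps)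
      finally have "best_m_term p m (F_class q r \<psi> :: (real ^ 'd \<Rightarrow> complex) set)
          \<le> ennreal (C * \<psi> n * (?M * \<epsilon> * w) powr e)"
        using M \<epsilon> w W psi_pos[OF t(2)] Psi_le[OF r t(2)]
        by (intro approx[where A = "lattice_ball r t"] finite_lattice_ball[OF r]) (auto intro: order_trans)
      also have "C * \<psi> n * (?M * \<epsilon> * w) powr e = ?C1 * (\<psi> n * w powr e)"
        using M \<epsilon> w by (simp add: powr_mult mult_ac)
      also have "\<dots> \<le> (?C1 + ?C2) * (\<psi> n * w powr e)" using C0 pn by (intro mult_right_mono) auto
      finally show ?thesis by (simp add: ennreal_leI)
    next
      \<comment> \<open>For bounded \<open>n\<close> no ball is reserved: \<open>\<psi> 1\<close>
        and \<open>\<psi> n\<close> are comparable, and the thresholding may spend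
        \<open>?M / Q 1 * w \<le> m\<close> frequencies.\<close>
      case False
      have W: "\<psi> 1 \<le> C' * \<psi> n" using C'(2)[of 1 "n - 1"] False n by simp
      have le: "?M / Q 1 * w \<le> real m"
        unfolding m nd w_def using Q1 M n Qn by (simp add: divide_simps mult_ac mult_left_mono)
      have "best_m_term p m (F_class q r \<psi> :: (real ^ 'd \<Rightarrow> complex) set)
          \<le> ennreal (C' * \<psi> n * (?M / Q 1 * w) powr e)"
        using W Psi_le_1[OF r] psi_pos[of 1] Q1 M w le
        by (intro approx[where A = "{}"]) (auto intro: order_trans)
      also have "C' * \<psi> n * (?M / Q 1 * w) powr e = ?C2 * (\<psi> n * w powr e)"
        using M Q1 w by (subst powr_mult) (auto simp: mult_ac)
      also have "\<dots> \<le> (?C1 + ?C2) * (\<psi> n * w powr e)" using C0 pn by (intro mult_right_mono) auto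
      finally show ?thesis by (simp add: ennreal_leI)
    qed
    then show "best_m_term p m (F_class q r \<psi> :: (real ^ 'd \<Rightarrow> complex) set)
      \<le> ennreal ((?C1 + ?C2) * (\<psi> n * (n ^ (?d - 1) * Q n) powr (recip p - recip q)))"
      by (simp add: w_def e_def)
  qed
qed

text \<open>Any \<open>m\<close> frequencies miss a point of a slightly larger ball. The exponential
  at that point, scaled by its own weight, lies in the class and is not approximated at all.\<close>

lemma basis_width_lower:
  assumes r: "0 < r" and p: "0 < p" and q: "0 < q"
  obtains C where "0 < C" "\<And>m n. 1 \<le> n \<Longrightarrow> real m = M_const r CARD('d) * n ^ CARD('d) \<Longrightarrow>
    ennreal (C * \<psi> n) \<le> basis_width p m (F_class q r \<psi> :: (real ^ 'd \<Rightarrow> complex) set)"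
proof -
  let ?d = "CARD('d)" and ?M = "M_const r CARD('d)"
  have M: "0 < ?M" by (rule M_const_pos)
  obtain c where c: "1 \<le> c"
    "\<And>t. 0 \<le> t \<Longrightarrow> ?M * t ^ ?d \<le> real (card (lattice_ball r (t + c) :: (int ^ 'd) set))"
    by (rule card_lattice_ball_shift[OF r, where 'd = 'd]) blast
  obtain C where C: "1 \<le> C" "\<And>s x. 1 \<le> s \<Longrightarrow> 0 \<le> x \<Longrightarrow> x \<le> 1 + c \<Longrightarrow> \<psi> s \<le> C * \<psi> (s + x)"
    using psi_shift_const[of "1 + c"] by blast
  show ?thesis
  proof (rule that[of "1 / C"])
    show "0 < 1 / C" using C by simp
    fix m n assume n: "1 \<le> n" and m: "real m = ?M * n ^ ?d"
    \<comment> \<open>The additional 1 makes the ball contain strictly more than \<open>m\<close>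
      points.\<close>
    define T where "T = n + (1 + c)"
    have T: "1 \<le> T" using n c by (simp add: T_def)
    have "real m < ?M * (n + 1) ^ ?d"
      unfolding m using M n by (intro mult_strict_left_mono power_strict_mono) auto
    also have "\<dots> \<le> real (card (lattice_ball r T :: (int ^ 'd) set))"
      using c(2)[of "n + 1"] n by (simp add: T_def add_ac)
    finally have big: "m < card (lattice_ball r T :: (int ^ 'd) set)" by simp
    have "1 / C * \<psi> n \<le> \<psi> T" using C(2)[of n "1 + c"] C(1) n c(1) by (simp add: T_def divide_simps mult.commute)
    then have "ennreal (1 / C * \<psi> n) \<le> ennreal (\<psi> T)" by (rule ennreal_leI)
    also have "\<dots> \<le> basis_width p m (F_class q r \<psi> :: (real ^ 'd \<Rightarrow> complex) set)"
      unfolding basis_width_def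
    proof (rule INF_greatest)
      fix \<gamma> :: "(int ^ 'd) set" assume \<gamma>: "\<gamma> \<in> Gamma_sets m"
      then have fin: "finite \<gamma>" "card \<gamma> = m" by (auto simp: Gamma_sets_def)
      have "\<not> lattice_ball r T \<subseteq> \<gamma>" using card_mono[OF fin(1)] fin(2) big by (metis leD)
      then obtain k where k: "k \<in> lattice_ball r T" "k \<notin> \<gamma>" by blast
      define f where "f x = (\<Sum>l\<in>{k}. of_real (Psi \<psi> r k) * expo l x)" for x
      have "f \<in> F_class q r \<psi>"
        unfolding f_def by (rule flat_mem_F_class[OF q _ Psi_pos[OF r] Psi_pos[OF r]]) auto
      moreover have "ennreal (\<psi> T * 1 powr recip p) \<le> best_approx p \<gamma> f"
        unfolding f_def best_approx_eq[OF L1_trig_poly fin(1)]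
          fourier_trig_poly[OF finite.insertI[OF finite.emptyI]]
        using Psi_ge[OF r T k(1)] psi_pos[OF T] k(2) p
        by (intro lp_norm_flat_lower[of p "{k}"]) auto
      then have "ennreal (\<psi> T) \<le> best_approx p \<gamma> f" by simp
      ultimately show "ennreal (\<psi> T) \<le> (SUP f\<in>(F_class q r \<psi> :: (real ^ 'd \<Rightarrow> complex) set). best_approx p \<gamma> f)"
        by (intro SUP_upper2[of f])
    qed
    finally show "ennreal (1 / C * \<psi> n) \<le> basis_width p m (F_class q r \<psi> :: (real ^ 'd \<Rightarrow> complex) set)" .
  qed
qed

text \<open>The function is now fixed before the frequencies are chosen, so its mass must be spread:
  a flat polynomial on a ball of radius about \<open>n + Q n\<close> keeps \<open>?M * w\<close>
  coefficients whatever is removed.\<close>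

lemma best_m_term_lower:
  assumes r: "0 < r" and p: "0 < p" and q: "0 < q"
  obtains C where "0 < C" "\<And>m n. 1 \<le> n \<Longrightarrow> real m = M_const r CARD('d) * n ^ CARD('d) \<Longrightarrow>
    ennreal (C * (\<psi> n * (n ^ (CARD('d) - 1) * Q n) powr (recip p - recip q)))
      \<le> best_m_term p m (F_class q r \<psi> :: (real ^ 'd \<Rightarrow> complex) set)"
proof -
  let ?d = "CARD('d)" and ?M = "M_const r CARD('d)"
  have M: "0 < ?M" by (rule M_const_pos)
  have Q1: "0 < Q 1" by (simp add: Q_pos)
  have nd: "n ^ ?d = n * n ^ (?d - 1)" for n :: real by (simp add: power_eq_if)
  obtain c where c: "1 \<le> c"
    "\<And>t. 0 \<le> t \<Longrightarrow> ?M * t ^ ?d \<le> real (card (lattice_ball r (t + c) :: (int ^ 'd) set))"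
    by (rule card_lattice_ball_shift[OF r, where 'd = 'd]) blast
  obtain C where C: "1 \<le> C" "\<And>s x. 1 \<le> s \<Longrightarrow> 0 \<le> x \<Longrightarrow> x \<le> (c * K / Q 1 + 1) * Q s \<Longrightarrow> \<psi> s \<le> C * \<psi> (s + x)"
    using psi_shift by blast
  obtain D where D: "0 < D" "\<And>T. q \<noteq> \<infinity> \<Longrightarrow> 1 \<le> T \<Longrightarrow> (\<Sum>k\<in>lattice_ball r T. Psi \<psi> r (k :: int ^ 'd) powr (- enn2real q))
      \<le> D * (T ^ (?d - 1) * Q T * \<psi> T powr (- enn2real q))"
  proof (cases "q = \<infinity>")
    case False
    then show ?thesis
      using head_sum[OF r recip_pos_finite(1)[OF q False], where 'd = 'd] that by metis
  qed (use that[of 1] in auto)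
  \<comment> \<open>From \<open>Q n \<le> n * Q 1\<close> it follows that
    \<open>T \<le> R * n\<close>, and then \<open>Q T \<le> R * Q n\<close>; quantities at
    \<open>T\<close> are thus comparable with those at \<open>n\<close>.\<close>
  define R where "R = 1 + c + Q 1"
  have R: "1 \<le> R" using c Q1 by (simp add: R_def)
  define E where "E = (D * R ^ ?d) powr (- recip q) / C * ?M powr recip p"
  show ?thesis
  proof (rule that[of E])
    show "0 < E" using D R C M by (simp add: E_def)
    fix m n assume n: "1 \<le> n" and m: "real m = ?M * n ^ ?d"
    define w where "w = n ^ (?d - 1) * Q n"
    define T where "T = n + (c + Q n)"
    have Qn: "0 < Q n" "Q n \<le> n * Q 1" using Q_pos[OF n] Q_upper[of 1 n] n by auto
    have w: "0 < w" using Qn n by (simp add: w_def)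
    have T: "1 \<le> T" "n \<le> T" using n c Qn by (auto simp: T_def)
    have TR: "T \<le> R * n"
    proof -
      have "c * 1 \<le> c * n" using n c(1) by (intro mult_left_mono) auto
      then show ?thesis using Qn(2) by (simp add: T_def R_def algebra_simps)
    qed
    have QT: "0 < Q T" "Q T \<le> R * Q n"
    proof -
      show "0 < Q T" by (rule Q_pos[OF T(1)])
      have "Q T \<le> T / n * Q n" by (rule Q_upper[OF n T(2)])
      also have "\<dots> \<le> R * Q n" using TR n Qn by (intro mult_right_mono) (auto simp: divide_simps)
      finally show "Q T \<le> R * Q n" .
    qed
    have psiT: "\<psi> n \<le> C * \<psi> T"
      unfolding T_def
    proof (rule C(2)[OF n])
      have "c = c * K / Q 1 * (Q 1 / K)" using Q1 K_ge_1 by simp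
      also have "\<dots> \<le> c * K / Q 1 * Q n" using c(1) Q1 K_ge_1 Q_lower[OF n] by (intro mult_left_mono) auto
      finally show "c + Q n \<le> (c * K / Q 1 + 1) * Q n" by (simp add: algebra_simps)
    qed (use c Qn in auto)
    have pT: "0 < \<psi> T" by (rule psi_pos[OF T(1)])
    define Y where "Y = D * (T ^ (?d - 1) * Q T)"
    have Y: "0 < Y" "Y \<le> D * R ^ ?d * w"
    proof -
      show "0 < Y" using D QT T by (simp add: Y_def)
      have "T ^ (?d - 1) * Q T \<le> (R * n) ^ (?d - 1) * (R * Q n)"
        using TR T QT R n by (intro mult_mono power_mono) auto
      also have "\<dots> = R ^ ?d * w" unfolding nd[of R] w_def by (simp add: power_mult_distrib mult_ac)
      finally show "Y \<le> D * R ^ ?d * w" unfolding Y_def mult.assoc using D by (intro mult_left_mono) auto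
    qed
    \<comment> \<open>Normalised so that \<open>a powr (- enn2real q)\<close> is exactly the bound
      from \<open>head_sum\<close>. For q = \<infinity> the power of \<open>Y\<close> is 1 and the
      height is \<psi>(T).\<close>
    define a where "a = Y powr (- recip q) * \<psi> T"
    have a0: "0 < a" using Y pT by (simp add: a_def)
    let ?B = "lattice_ball r T :: (int ^ 'd) set"
    note fin = finite_lattice_ball[OF r, where 'd = 'd, of T]
    define f where "f x = (\<Sum>k\<in>?B. of_real a * expo k x)" for x
    have f: "f \<in> F_class q r \<psi>"
      unfolding f_def
    proof (rule flat_mem_F_class[OF q fin Psi_pos[OF r] a0])
      assume qf: "q \<noteq> \<infinity>"
      note q' = recip_pos_finite[OF q qf]
      have "a powr (- enn2real q) = Y * \<psi> T powr (- enn2real q)"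
        using Y pT q' by (simp add: a_def powr_mult powr_powr)
      then show "(\<Sum>k\<in>?B. Psi \<psi> r k powr (- enn2real q)) \<le> a powr (- enn2real q)"
        using D(2)[OF qf T(1)] by (simp add: Y_def mult_ac)
    next
      fix k assume "q = \<infinity>" "k \<in> ?B"
      then show "a \<le> Psi \<psi> r k" using Psi_ge[OF r T(1)] Y by (simp add: a_def)
    qed
    have card: "real m + ?M * w \<le> real (card ?B)"
    proof -
      have "real m + ?M * w = ?M * ((n + Q n) * n ^ (?d - 1))"
        unfolding m nd w_def by (simp add: algebra_simps)
      also have "\<dots> \<le> ?M * (n + Q n) ^ ?d"
        unfolding nd using M n Qn by (intro mult_left_mono power_mono) auto
      also have "\<dots> \<le> real (card ?B)" using c(2)[of "n + Q n"] n Qn by (simp add: T_def add_ac)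
      finally show ?thesis .
    qed
    have "E * (\<psi> n * w powr (recip p - recip q)) \<le> a * (?M * w) powr recip p"
    proof -
      have "(D * R ^ ?d * w) powr (- recip q) \<le> Y powr (- recip q)"
        using Y recip_nonneg[of q] by (intro powr_mono2') auto
      then have "(D * R ^ ?d * w) powr (- recip q) * (\<psi> n / C) \<le> Y powr (- recip q) * \<psi> T"
        using psiT C psi_pos[OF n] by (intro mult_mono) (auto simp: divide_simps mult.commute)
      then have "(D * R ^ ?d * w) powr (- recip q) * (\<psi> n / C) * (?M * w) powr recip p \<le> a * (?M * w) powr recip p"
        unfolding a_def by (rule mult_right_mono) simp
      moreover have "(D * R ^ ?d * w) powr (- recip q) * (\<psi> n / C) * (?M * w) powr recip p
          = E * (\<psi> n * (w powr recip p * w powr (- recip q)))"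
        using D R w M by (simp add: E_def powr_mult)
      moreover have "w powr recip p * w powr (- recip q) = w powr (recip p - recip q)"
        by (simp add: powr_add[symmetric])
      ultimately show ?thesis by simp
    qed
    then have "ennreal (E * (\<psi> n * w powr (recip p - recip q))) \<le> ennreal (a * (?M * w) powr recip p)"
      by (rule ennreal_leI)
    also have "\<dots> \<le> (INF \<gamma>\<in>Gamma_sets m. best_approx p \<gamma> f)"
      unfolding f_def using card a0 M w by (intro INF_greatest best_approx_flat[OF p fin]) auto
    also have "\<dots> \<le> best_m_term p m (F_class q r \<psi> :: (real ^ 'd \<Rightarrow> complex) set)"
      unfolding best_m_term_def by (rule SUP_upper[OF f])
    finally show "ennreal (E * (\<psi> n * (n ^ (?d - 1) * Q n) powr (recip p - recip q)))
      \<le> best_m_term p m (F_class q r \<psi> :: (real ^ 'd \<Rightarrow> complex) set)"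
      unfolding w_def .
  qed
qed

end

text \<open>The strict inequality between the two constants is obtained by enlarging the upper one
  to \<open>c + C\<close>, which is where \<open>b\<close> has to be nonnegative.\<close>

lemma asymp_eq_onI:
  assumes "0 < c" "0 < C" "\<And>m. m \<in> A \<Longrightarrow> 0 \<le> b m"
    and "\<And>m. m \<in> A \<Longrightarrow> ennreal (c * b m) \<le> a m" "\<And>m. m \<in> A \<Longrightarrow> a m \<le> ennreal (C * b m)"
  shows "asymp_eq_on A a b"
  unfolding asymp_eq_on_def
proof (intro exI conjI ballI)
  show "0 < c" "c < c + C" using assms by auto
  fix m assume m: "m \<in> A"
  show "ennreal (c * b m) \<le> a m" by (rule assms(4)[OF m])
  have "C * b m \<le> (c + C) * b m" using assms(1,3) m by (intro mult_right_mono) auto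
  then show "a m \<le> ennreal ((c + C) * b m)"
    using assms(5)[OF m] by (meson ennreal_leI order_trans)
qed

theorem theorem3:
  fixes p q r :: ennreal and \<psi> :: "real \<Rightarrow> real"
  assumes "0 < p" "0 < q" "0 < r"
    and "\<psi> \<in> class_M_inf' \<union> class_M_inf_c"
  shows "let F = (F_class q r \<psi> :: (real ^ 'd \<Rightarrow> complex) set);
             n = n_tilde r CARD('d)
         in asymp_eq_on {m. 1 \<le> n m} (\<lambda>m. basis_width p m F)
              (\<lambda>m. if q \<le> p then \<psi> (n m)
                   else \<psi> (n m) * (real m * alpha \<psi> (n m)) powr (recip p - recip q))
          \<and> asymp_eq_on {m. 1 \<le> n m} (\<lambda>m. best_m_term p m F)
              (\<lambda>m. \<psi> (n m) * (real m * alpha \<psi> (n m)) powr (recip p - recip q))"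
proof -
  let ?F = "F_class q r \<psi> :: (real ^ 'd \<Rightarrow> complex) set"
  let ?d = "CARD('d)" and ?M = "M_const r CARD('d)" and ?n = "n_tilde r CARD('d)"
  let ?e = "recip p - recip q"
  let ?b = "\<lambda>m. \<psi> (?n m) * (real m * alpha \<psi> (?n m)) powr ?e"
  obtain K where "rapid_decay \<psi> (quot \<psi>) K" by (rule rapid_decay_quot[OF assms(4)])
  then interpret rapid_decay \<psi> "quot \<psi>" K .
  have \<psi>: "\<psi> \<in> class_M" using assms(4) by (auto simp: class_M_inf'_def class_M_inf_c_def)
  have M: "0 < ?M" by (rule M_const_pos)
  have m: "real m = ?M * ?n m ^ ?d" for m
  proof -
    have "?n m ^ ?d = real m / ?M"
      unfolding n_tilde_def using M by (cases "m = 0") (simp_all add: powr_power)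
    then show ?thesis using M by simp
  qed
  have N: "real m * alpha \<psi> (?n m) = ?M * (?n m ^ (?d - 1) * quot \<psi> (?n m))" if "1 \<le> ?n m" for m
    using that by (subst m) (simp add: alpha_eq_quot[OF \<psi>] power_eq_if)
  have b: "?b m = ?M powr ?e * (\<psi> (?n m) * (?n m ^ (?d - 1) * quot \<psi> (?n m)) powr ?e)" if "1 \<le> ?n m" for m
    unfolding N[OF that] using M Q_pos[OF that] that by (simp add: powr_mult mult_ac)
  have Me: "0 < ?M powr ?e" using M by simp
  have b0: "0 \<le> ?b m" if "1 \<le> ?n m" for m using psi_pos[OF that] by simp
  obtain c1 where c1: "0 < c1" "\<And>m. 1 \<le> ?n m \<Longrightarrow> ennreal (c1 * ?b m) \<le> best_m_term p m ?F"
  proof -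
    obtain C where C: "0 < C" "\<And>m n. 1 \<le> n \<Longrightarrow> real m = ?M * n ^ ?d \<Longrightarrow>
      ennreal (C * (\<psi> n * (n ^ (?d - 1) * quot \<psi> n) powr ?e)) \<le> best_m_term p m ?F"
      using best_m_term_lower[OF assms(3,1,2), where 'd = 'd] by blast
    show ?thesis
    proof (rule that[of "C / ?M powr ?e"])
      fix m assume n: "1 \<le> ?n m"
      show "ennreal (C / ?M powr ?e * ?b m) \<le> best_m_term p m ?F"
        unfolding b[OF n] using C(2)[OF n m] M by simp
    qed (use C Me in simp)
  qed
  \<comment> \<open>\<open>?b\<close> differs from the expression in the estimates by the constant
    \<open>?M powr ?e\<close>, which is moved into the constant here.\<close>
  have up: "\<exists>C'>0. \<forall>m. 1 \<le> ?n m \<longrightarrow> X m \<le> ennreal (C' * ?b m)"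
    if "0 < C" "\<And>m n. 1 \<le> n \<Longrightarrow> real m = ?M * n ^ ?d \<Longrightarrow>
      X m \<le> ennreal (C * (\<psi> n * (n ^ (?d - 1) * quot \<psi> n) powr ?e))" for C X
  proof (intro exI[of _ "C / ?M powr ?e"] conjI allI impI)
    fix m assume n: "1 \<le> ?n m"
    show "X m \<le> ennreal (C / ?M powr ?e * ?b m)"
      unfolding b[OF n] using that(2)[OF n m] M by simp
  qed (use that(1) Me in simp)
  have "asymp_eq_on {m. 1 \<le> ?n m} (\<lambda>m. basis_width p m ?F) (\<lambda>m. if q \<le> p then \<psi> (?n m) else ?b m)
      \<and> asymp_eq_on {m. 1 \<le> ?n m} (\<lambda>m. best_m_term p m ?F) ?b"
  proof (cases "q \<le> p")
    case True
    obtain C where C: "0 < C" "\<And>m n. 1 \<le> n \<Longrightarrow> real m = ?M * n ^ ?d \<Longrightarrow> basis_width p m ?F \<le> ennreal (C * \<psi> n)"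
      using basis_width_upper_embed[OF assms(3,2) True, where 'd = 'd] by blast
    \<comment> \<open>For q < p the m-term lower bound may be of smaller order than \<psi>(n), so
      the width takes its own lower bound from single exponentials.\<close>
    obtain c where c: "0 < c" "\<And>m n. 1 \<le> n \<Longrightarrow> real m = ?M * n ^ ?d \<Longrightarrow> ennreal (c * \<psi> n) \<le> basis_width p m ?F"
      using basis_width_lower[OF assms(3,1,2), where 'd = 'd] by blast
    have "asymp_eq_on {m. 1 \<le> ?n m} (\<lambda>m. basis_width p m ?F) (\<lambda>m. \<psi> (?n m))"
      by (rule asymp_eq_onI[OF c(1) C(1)])
        (use c(2)[OF _ m] C(2)[OF _ m] in \<open>auto intro: less_imp_le psi_pos\<close>)
    moreover obtain D where D: "0 < D" "\<And>m. 1 \<le> ?n m \<Longrightarrow> best_m_term p m ?F \<le> ennreal (D * ?b m)"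
    proof -
      obtain D' where "0 < D'" "\<And>m n. 1 \<le> n \<Longrightarrow> real m = ?M * n ^ ?d \<Longrightarrow>
        best_m_term p m ?F \<le> ennreal (D' * (\<psi> n * (n ^ (?d - 1) * quot \<psi> n) powr ?e))"
        using best_m_term_upper[OF assms(3,2) True, where 'd = 'd] by blast
      from up[where X = "\<lambda>m. best_m_term p m ?F", OF this] show ?thesis using that by blast
    qed
    have "asymp_eq_on {m. 1 \<le> ?n m} (\<lambda>m. best_m_term p m ?F) ?b"
      by (rule asymp_eq_onI[OF c1(1) D(1)]) (use c1(2) D(2) b0 in auto)
    ultimately show ?thesis using True by simp
  next
    case False
    then have pq: "p < q" by simp
    \<comment> \<open>For p < q the upper bound of the width matches the m-term lower bound, so it
      serves both quantities.\<close>
    obtain D where D: "0 < D" "\<And>m. 1 \<le> ?n m \<Longrightarrow> basis_width p m ?F \<le> ennreal (D * ?b m)"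
    proof -
      obtain D' where "0 < D'" "\<And>m n. 1 \<le> n \<Longrightarrow> real m = ?M * n ^ ?d \<Longrightarrow>
        basis_width p m ?F \<le> ennreal (D' * (\<psi> n * (n ^ (?d - 1) * quot \<psi> n) powr ?e))"
        using basis_width_upper_hoelder[OF assms(3,1) pq, where 'd = 'd] by blast
      from up[where X = "\<lambda>m. basis_width p m ?F", OF this] show ?thesis using that by blast
    qed
    have "asymp_eq_on {m. 1 \<le> ?n m} (\<lambda>m. basis_width p m ?F) ?b"
      by (rule asymp_eq_onI[OF c1(1) D(1)])
        (use D(2) b0 order_trans[OF c1(2) best_m_term_le_basis_width] in auto)
    moreover have "asymp_eq_on {m. 1 \<le> ?n m} (\<lambda>m. best_m_term p m ?F) ?b"
      by (rule asymp_eq_onI[OF c1(1) D(1)])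
        (use c1(2) b0 order_trans[OF best_m_term_le_basis_width D(2)] in auto)
    ultimately show ?thesis using False by simp
  qed
  then show ?thesis by (simp add: Let_def)
qed

end
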